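(* Let $(L_t)_{t\ge0}$ be a Lévy process as in the context with no Gaussian component ($\sigma^2=0$), whose Lévy density satisfies $\int x^2n(x)\,dx<\infty$, $\int x^4n(x)\,dx<\infty$ and $h\in\mathbb{L}^2(\mathbb{R})$, where $h(x)=x^2n(x)$. Assume that $h\in\mathcal{C}(a,L)$ with $a>1/2$. Consider the asymptotic setting $n\to+\infty$, $\Delta\to0$, $n\Delta\to+\infty$, and assume $m\le n\Delta$. If $n\Delta^2\le1$, then, for a choice of $m=m(n)$ of order $(n\Delta)^{1/(2a+1)}$, $$\mathbb{E}(\|\hat h_m-h\|^2)\le O\big((n\Delta)^{-2a/(2a+1)}\big).$$ If $a\ge1$, the condition $n\Delta^2\le1$ can be replaced by $n\Delta^3\le1$. The same result holds for $\bar h_m$.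
   Context: Under $\int x^2n(x)\,dx<\infty$, $(L_t)$ is a real Lévy process with characteristic function $\mathbb{E}(e^{iuL_t})=\exp\{t(iub-\frac12u^2\sigma^2+\int_{\mathbb{R}}(e^{iux}-1-iux)n(x)\,dx)\}$, where $b=\mathbb{E}L_1$ and $n(\cdot)$ is the Lévy density; here $\sigma^2=0$. Observations: $Z_k=L_{k\Delta}-L_{(k-1)\Delta}$, $1\le k\le 2n$ (i.i.d.), with $\Delta=\Delta_n$. Notation: $f^*(u)=\int e^{iux}f(x)\,dx$; $\|f\|^2=\int|f(x)|^2dx$; for $a,L>0$, $\mathcal{C}(a,L)=\{f\in(\mathbb{L}^1\cap\mathbb{L}^2)(\mathbb{R}):\int(1+u^2)^a|f^*(u)|^2du\le L\}$. "$m$ of order $v_n$" means that $m/v_n$ is bounded above and below by positive constants. Empirical quantities: for $j=0,1,2$ and $q=1,2$, $\hat\psi^{(j)}_{\Delta,q}(u)=\frac1n\sum_{k=1+(q-1)n}^{qn}(iZ_k)^je^{iuZ_k}$, and $\hat\psi^{(2)}_\Delta(u)=\frac1{2n}\sum_{k=1}^{2n}(iZ_k)^2e^{iuZ_k}$. Estimators: $\hat h^*(u)=\frac1\Delta\big(\hat\psi^{(1)}_{\Delta,1}(u)\hat\psi^{(1)}_{\Delta,2}(u)-\hat\psi^{(2)}_{\Delta,1}(u)\hat\psi^{(0)}_{\Delta,2}(u)\big)$, $\bar h^*(u)=-\frac1\Delta\hat\psi^{(2)}_\Delta(u)$, $\hat h_m(x)=\frac1{2\pi}\int_{-\pi m}^{\pi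 m}e^{-iux}\hat h^*(u)\,du$, $\bar h_m(x)=\frac1{2\pi}\int_{-\pi m}^{\pi m}e^{-iux}\bar h^*(u)\,du$. *)

theory Defs
  imports "HOL-Probability.Probability"
begin

section \<open>Levy processes\<close>

text \<open>
  Only \<open>L t\<close> for \<open>t \<ge> 0\<close> is meaningful. Path regularity is required in the form of stochastic
  continuity, so processes with cadlag paths are covered.
\<close>

locale levy_process = prob_space M for M :: "'a measure" +
  fixes L :: "real \<Rightarrow> 'a \<Rightarrow> real"
  assumes measurable_L: "\<And>t. 0 \<le> t \<Longrightarrow> L t \<in> borel_measurable M"
    and starts_at_0: "AE \<omega> in M. L 0 \<omega> = 0"
    and indep_increments: "\<And>(t :: nat \<Rightarrow> real) k. 0 \<le> t 0 \<Longrightarrow> mono t \<Longrightarrow>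
      indep_vars (\<lambda>_. borel) (\<lambda>i \<omega>. L (t (Suc i)) \<omega> - L (t i) \<omega>) {..<k}"
    and stationary_increments: "\<And>s t. 0 \<le> s \<Longrightarrow> 0 \<le> t \<Longrightarrow>
      distr M borel (\<lambda>\<omega>. L (s + t) \<omega> - L s \<omega>) = distr M borel (L t)"
    and stochastically_continuous: "\<And>t e. 0 \<le> t \<Longrightarrow> 0 < e \<Longrightarrow>
      ((\<lambda>s. prob {\<omega> \<in> space M. e < \<bar>L s \<omega> - L t \<omega>\<bar>}) \<longlongrightarrow> 0) (at t within {0..})"

definition levy_density :: "(real \<Rightarrow> real) \<Rightarrow> bool" where
  "levy_density \<nu> \<longleftrightarrow> \<nu> \<in> borel_measurable borel \<and> (\<forall>x. 0 \<le> \<nu> x)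
     \<and> integrable lborel (\<lambda>x. min 1 (x\<^sup>2) * \<nu> x)"

text \<open>
  The jump part is compensated on the whole line, which is legitimate when \<open>x\<^sup>2 \<nu>(x)\<close> is
  integrable; \<open>b\<close> is then the mean of \<open>L 1\<close>.
\<close>

definition levy_exponent :: "real \<Rightarrow> real \<Rightarrow> (real \<Rightarrow> real) \<Rightarrow> real \<Rightarrow> complex" where
  "levy_exponent b \<sigma> \<nu> u = \<i> * of_real (u * b) - of_real (u\<^sup>2 * \<sigma>\<^sup>2 / 2)
     + (CLINT x|lborel. (iexp (u * x) - 1 - \<i> * of_real (u * x)) * of_real (\<nu> x))"


section \<open>Fourier transform, \<open>L\<^sup>2\<close> norm and smoothness classes\<close>

definition fourier :: "(real \<Rightarrow> complex) \<Rightarrow> real \<Rightarrow> complex" where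
  "fourier f u = (CLINT x|lborel. iexp (u * x) * f x)"

definition L2_norm_sq :: "(real \<Rightarrow> complex) \<Rightarrow> ennreal" where
  "L2_norm_sq f = (\<integral>\<^sup>+x. ennreal ((cmod (f x))\<^sup>2) \<partial>lborel)"

definition smoothness_class :: "real \<Rightarrow> real \<Rightarrow> (real \<Rightarrow> complex) set" where
  "smoothness_class a R = {f. integrable lborel f \<and> integrable lborel (\<lambda>x. (cmod (f x))\<^sup>2)
     \<and> (\<integral>\<^sup>+u. ennreal ((1 + u\<^sup>2) powr a * (cmod (fourier f u))\<^sup>2) \<partial>lborel) \<le> ennreal R}"


section \<open>Observations and estimators\<close>

definition increment :: "(real \<Rightarrow> 'a \<Rightarrow> real) \<Rightarrow> real \<Rightarrow> 'a \<Rightarrow> nat \<Rightarrow> real" where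
  "increment L \<Delta> \<omega> k = L (real k * \<Delta>) \<omega> - L ((real k - 1) * \<Delta>) \<omega>"

text \<open>
  Below, \<open>z k\<close> for \<open>1 \<le> k \<le> 2 * n\<close> are the observed increments. \<open>psi_half\<close> uses the first half of
  the sample for \<open>q = 1\<close> and the second half for \<open>q = 2\<close>; its argument \<open>j\<close> is the order of the
  derivative.
\<close>

definition psi_half :: "nat \<Rightarrow> (nat \<Rightarrow> real) \<Rightarrow> nat \<Rightarrow> nat \<Rightarrow> real \<Rightarrow> complex" where
  "psi_half n z j q u =
     (\<Sum>k = 1 + (q - 1) * n..q * n. (\<i> * of_real (z k)) ^ j * iexp (u * z k)) / of_nat n"

definition psi2_full :: "nat \<Rightarrow> (nat \<Rightarrow> real) \<Rightarrow> real \<Rightarrow> complex" where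
  "psi2_full n z u =
     (\<Sum>k = 1..2 * n. (\<i> * of_real (z k)) ^ 2 * iexp (u * z k)) / of_nat (2 * n)"

definition h_hat_star :: "nat \<Rightarrow> real \<Rightarrow> (nat \<Rightarrow> real) \<Rightarrow> real \<Rightarrow> complex" where
  "h_hat_star n \<Delta> z u =
     (psi_half n z 1 1 u * psi_half n z 1 2 u - psi_half n z 2 1 u * psi_half n z 0 2 u)
       / of_real \<Delta>"

definition h_bar_star :: "nat \<Rightarrow> real \<Rightarrow> (nat \<Rightarrow> real) \<Rightarrow> real \<Rightarrow> complex" where
  "h_bar_star n \<Delta> z u = - psi2_full n z u / of_real \<Delta>"

definition cutoff_inverse :: "real \<Rightarrow> (real \<Rightarrow> complex) \<Rightarrow> real \<Rightarrow> complex" where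
  "cutoff_inverse m g x =
     of_real (1 / (2 * pi)) * (CLINT u:{- (pi * m)..pi * m}|lborel. iexp (- (u * x)) * g u)"

definition h_hat :: "nat \<Rightarrow> real \<Rightarrow> real \<Rightarrow> (nat \<Rightarrow> real) \<Rightarrow> real \<Rightarrow> complex" where
  "h_hat n \<Delta> m z = cutoff_inverse m (h_hat_star n \<Delta> z)"

definition h_bar :: "nat \<Rightarrow> real \<Rightarrow> real \<Rightarrow> (nat \<Rightarrow> real) \<Rightarrow> real \<Rightarrow> complex" where
  "h_bar n \<Delta> m z = cutoff_inverse m (h_bar_star n \<Delta> z)"

text \<open>
  The risk is an extended nonnegative expectation, so that a finite bound on it includes the
  integrability of the loss.
\<close>

definition L2_risk :: "'a measure \<Rightarrow> ('a \<Rightarrow> real \<Rightarrow> complex) \<Rightarrow> (real \<Rightarrow> real) \<Rightarrow> ennreal" where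
  "L2_risk M est h = (\<integral>\<^sup>+\<omega>. L2_norm_sq (\<lambda>x. est \<omega> x - of_real (h x)) \<partial>M)"


section \<open>Asymptotic comparison\<close>

text \<open>
  Both notions concern large \<open>n\<close> only.
\<close>

definition of_order :: "(nat \<Rightarrow> real) \<Rightarrow> (nat \<Rightarrow> real) \<Rightarrow> bool" where
  "of_order m v \<longleftrightarrow>
     (\<exists>c C. 0 < c \<and> 0 < C \<and> (\<forall>\<^sub>F n in sequentially. c \<le> m n / v n \<and> m n / v n \<le> C))"

definition risk_bigo :: "(nat \<Rightarrow> ennreal) \<Rightarrow> (nat \<Rightarrow> real) \<Rightarrow> bool" where
  "risk_bigo r v \<longleftrightarrow> (\<exists>C>0. \<forall>\<^sub>F n in sequentially. r n \<le> ennreal (C * v n))"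

end

theory Submission
  imports Defs
begin

text \<open>
  Let \<open>\<phi>\<close> be the Levy exponent and \<open>\<psi> = exp (\<Delta> \<phi>)\<close> the characteristic function of one increment. Since
  \<open>\<phi>'' = - h\<^sup>*\<close>, one has \<open>\<psi>'\<^sup>2 - \<psi>'' \<psi> = \<Delta> h\<^sup>* \<psi>\<^sup>2\<close> and \<open>- \<psi>'' = \<Delta> h\<^sup>* \<psi> - \<Delta>\<^sup>2 \<phi>'\<^sup>2 \<psi>\<close>. So both
  estimators are, on the Fourier side, empirical versions of \<open>h\<^sup>*\<close> up to a factor close to 1 and, for the
  second one, a small additive term.

  An inequality of Plancherel type (\<open>fourier_L2_bound\<close>), applied after Fourier inversion of \<open>h\<close>
  (\<open>fourier_inversion_nonneg\<close>), bounds the squared error of a cutoff estimator by the squared error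
  of its Fourier transform on \<open>[- \<pi> m, \<pi> m]\<close> plus the energy of \<open>h\<^sup>*\<close> outside this interval
  (\<open>L2_error_cutoff_inverse_le\<close>). Only upper bounds are wanted, so constant factors are not
  optimized and the exact bias-variance identity is replaced by triangle inequalities.

  The assumption \<open>a > 1/2\<close> makes \<open>h\<^sup>*\<close> integrable (\<open>integrable_of_weighted_L2\<close>). Hence
  \<open>\<phi>'(u) = i b - \<integral>\<^sub>0\<^sup>u h\<^sup>*\<close> is bounded, \<open>\<bar>\<phi>(u)\<bar> \<le> C \<bar>u\<bar>\<close> and \<open>\<bar>\<psi>(u) - 1\<bar> \<le> C \<Delta> \<bar>u\<bar>\<close>: replacing \<open>\<psi>\<close> by 1
  costs \<open>C \<Delta>\<^sup>2 u\<^sup>2 \<bar>h\<^sup>*(u)\<bar>\<^sup>2\<close>. For the stochastic part, the second and fourth moments of an increment are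
  \<open>O(\<Delta>)\<close>. They are read off from second differences of \<open>\<psi>\<close> and of \<open>\<psi>''\<close> at 0 by Fatou's lemma
  (\<open>second_moment_le_of_cosine_bound\<close>, \<open>fourth_moment\<close>). Independence then gives a mean squared error
  \<open>O(1 / (n \<Delta>))\<close> at each frequency (\<open>h_hat_star_pointwise_error\<close>, \<open>h_bar_star_pointwise_error\<close>).

  Integrating over the frequencies (\<open>L2_risk_cutoff_le\<close>) bounds the risk by a constant times
  \<open>m / (n \<Delta>) + \<Delta>\<^sup>2 (1 + m\<^sup>2)\<^bsup>max 0 (1 - a)\<^esup> + (1 + m\<^sup>2)\<^bsup>- a\<^esup>\<close>, with an additional term \<open>m \<Delta>\<^sup>2\<close> for the second
  estimator. For \<open>m\<close> of order \<open>(n \<Delta>)\<^bsup>1/(2a+1)\<^esup>\<close> the first and third terms have the announced rate. The others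
  are of at most this size, because \<open>n \<Delta>\<^sup>2 \<le> 1\<close> and also \<open>n \<Delta>\<^sup>3 \<le> 1\<close> imply \<open>\<Delta>\<^sup>2 \<le> 1 / (n \<Delta>)\<close>, and the
  former even gives \<open>\<Delta>\<^sup>2 \<le> (n \<Delta>)\<^sup>-\<^sup>2\<close> (\<open>rate_comparison\<close>).
\<close>

section \<open>Fourier transforms and an inequality of Plancherel type\<close>

lemma norm_integral_le_nn_integral:
  fixes f :: "'a \<Rightarrow> 'b :: {banach, second_countable_topology}"
  shows "ennreal (norm (integral\<^sup>L M f)) \<le> (\<integral>\<^sup>+x. ennreal (norm (f x)) \<partial>M)"
  by (cases "integrable M f") (auto simp: not_integrable_integral_eq intro: integral_norm_bound_ennreal)

lemma integrable_iexp_mult: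
  fixes f :: "real \<Rightarrow> complex"
  assumes "integrable lborel f"
  shows "integrable lborel (\<lambda>x. iexp (u * x) * f x)"
  by (rule Bochner_Integration.integrable_bound[OF integrable_norm[OF assms]])
     (use assms in \<open>auto simp: norm_mult\<close>)

lemma fourier_measurable [measurable]:
  assumes [measurable]: "f \<in> borel_measurable lborel"
  shows "fourier f \<in> borel_measurable borel"
  unfolding fourier_def by measurable

lemma norm_fourier_le:
  assumes "integrable lborel f"
  shows "cmod (fourier f u) \<le> (LINT x|lborel. cmod (f x))"
proof -
  have "cmod (fourier f u) \<le> (LINT x|lborel. cmod (iexp (u * x) * f x))"
    unfolding fourier_def by (rule integral_norm_bound)
  then show ?thesis by (simp add: norm_mult)
qed

text \<open>
  Both sides are iterated integrals of \<open>iexp (x * y) * f x * g y\<close>.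
\<close>

lemma fourier_multiplication_formula:
  assumes f: "integrable lborel f" and g: "integrable lborel g"
  shows "(CLINT y|lborel. fourier f y * g y) = (CLINT x|lborel. f x * fourier g x)"
proof -
  have [measurable]: "f \<in> borel_measurable borel" "g \<in> borel_measurable borel"
    using f g by auto
  have int: "integrable (lborel \<Otimes>\<^sub>M lborel) (\<lambda>(y, x). iexp (y * x) * f x * g y)"
  proof (rule lborel_pair.Fubini_integrable)
    show "(\<lambda>(y, x). iexp (y * x) * f x * g y) \<in> borel_measurable (lborel \<Otimes>\<^sub>M lborel)"
      by measurable
    show "integrable lborel (\<lambda>y. LINT x|lborel. cmod (case (y, x) of (y, x) \<Rightarrow> iexp (y * x) * f x * g y))"
      using g by (simp add: norm_mult)
    show "AE y in lborel. integrable lborel (\<lambda>x. case (y, x) of (y, x) \<Rightarrow> iexp (y * x) * f x * g y)"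
      using integrable_iexp_mult[OF f] by (auto simp del: of_real_mult)
  qed
  have "(CLINT y|lborel. fourier f y * g y) = (CLINT y|lborel. CLINT x|lborel. iexp (y * x) * f x * g y)"
    unfolding fourier_def by simp
  also have "\<dots> = (CLINT x|lborel. CLINT y|lborel. iexp (y * x) * f x * g y)"
    using lborel_pair.Fubini_integral[OF int] by simp
  also have "\<dots> = (CLINT x|lborel. f x * fourier g x)"
    unfolding fourier_def
    by (subst integral_mult_right_zero[symmetric]) (simp add: ac_simps)
  finally show ?thesis .
qed

text \<open>
  The weight that regularizes the integral of \<open>\<bar>fourier G\<bar>\<^sup>2\<close> below. Its transform is \<open>2 \<pi>\<close> times a
  probability density, which is where the constant of the Plancherel inequality comes from.
\<close>

lemma fourier_gaussian:
  assumes s: "0 < s"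
  shows "integrable lborel (\<lambda>x. complex_of_real (exp (- (s * x)\<^sup>2 / 2)))"
    and "fourier (\<lambda>x. complex_of_real (exp (- (s * x)\<^sup>2 / 2))) (v - u)
       = complex_of_real (2 * pi * normal_density u s v)"
proof -
  have eq: "exp (- (s * x)\<^sup>2 / 2) = sqrt (2 * pi) / s * normal_density 0 (1 / s) x" for x
    using s by (simp add: normal_density_def power_mult_distrib real_sqrt_mult real_sqrt_divide field_simps)
  show "integrable lborel (\<lambda>x. complex_of_real (exp (- (s * x)\<^sup>2 / 2)))"
    unfolding eq using s by (intro integrable_of_real integrable_mult_right integrable_normal_density) auto
  have "fourier (\<lambda>x. complex_of_real (exp (- (s * x)\<^sup>2 / 2))) t
      = complex_of_real (sqrt (2 * pi) / s) * char std_normal_distribution (t / s)" for t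
  proof -
    have "char std_normal_distribution (t / s)
        = (CLINT x|lborel. std_normal_density x *\<^sub>R iexp (t / s * x))"
      unfolding char_def by (subst integral_density) auto
    also have "\<dots> = \<bar>s\<bar> *\<^sub>R (CLINT x|lborel. std_normal_density (0 + s * x) *\<^sub>R iexp (t / s * (0 + s * x)))"
      using s by (intro lborel_integral_real_affine) simp
    also have "(CLINT x|lborel. std_normal_density (0 + s * x) *\<^sub>R iexp (t / s * (0 + s * x)))
       = (CLINT x|lborel. complex_of_real (1 / sqrt (2 * pi)) * (iexp (t * x) * complex_of_real (exp (- (s * x)\<^sup>2 / 2))))"
      using s by (intro Bochner_Integration.integral_cong) (auto simp: std_normal_density_def scaleR_conv_of_real)
    also have "\<dots> = complex_of_real (1 / sqrt (2 * pi)) * fourier (\<lambda>x. complex_of_real (exp (- (s * x)\<^sup>2 / 2))) t"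
      unfolding fourier_def by simp
    finally show ?thesis using s by (simp add: scaleR_conv_of_real field_simps)
  qed

  moreover have "sqrt (2 * pi) / s * exp (- ((v - u) / s)\<^sup>2 / 2) = 2 * pi * normal_density u s v"
  proof -
    have "sqrt (2 * pi) / s = 2 * pi / sqrt (2 * pi * s\<^sup>2)"
      using s real_sqrt_mult_self[of "2 * pi"] by (simp add: real_sqrt_mult field_simps)
    then show ?thesis
      by (simp add: normal_density_def power_divide mult.commute)
  qed
  ultimately show "fourier (\<lambda>x. complex_of_real (exp (- (s * x)\<^sup>2 / 2))) (v - u)
       = complex_of_real (2 * pi * normal_density u s v)"
    by (simp add: char_std_normal_distribution del: of_real_divide flip: of_real_mult)
qed

lemma cnj_fourier: "cnj (fourier f u) = fourier (\<lambda>x. cnj (f x)) (- u)"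
  unfolding fourier_def
  by (simp add: exp_cnj Bochner_Integration.integral_cnj[symmetric] del: Bochner_Integration.integral_cnj)

lemma borel_measurable_cnj [measurable]: "cnj \<in> borel_measurable borel"
  by (intro borel_measurable_continuous_onI continuous_intros)

text \<open>
  With a Gaussian weight \<open>w\<close> of width \<open>1 / s\<close>, two applications of the multiplication formula turn
  \<open>\<integral> \<bar>fourier G\<bar>\<^sup>2 w\<close> into the double integral of \<open>G(u) cnj (G(v))\<close> against \<open>2 \<pi>\<close> times the normal
  density of mean \<open>u\<close> and deviation \<open>s\<close> at \<open>v\<close>. The inequality \<open>2 x y \<le> x\<^sup>2 + y\<^sup>2\<close> and the symmetry of
  this kernel bound it by \<open>2 \<pi> \<integral> \<bar>G\<bar>\<^sup>2\<close>. Let \<open>s\<close> tend to 0.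
\<close>

theorem fourier_L2_bound:
  assumes G: "integrable lborel G"
  shows "(\<integral>\<^sup>+x. ennreal ((cmod (fourier G x))\<^sup>2) \<partial>lborel)
    \<le> ennreal (2 * pi) * (\<integral>\<^sup>+u. ennreal ((cmod (G u))\<^sup>2) \<partial>lborel)"
proof -
  have [measurable]: "G \<in> borel_measurable borel" using G by auto
  define w where "w s x = complex_of_real (exp (- (s * x)\<^sup>2 / 2))" for s x :: real
  let ?N = "\<integral>\<^sup>+u. ennreal ((cmod (G u))\<^sup>2) \<partial>lborel"
  have weighted: "(\<integral>\<^sup>+x. ennreal ((cmod (fourier G x))\<^sup>2 * exp (- (s * x)\<^sup>2 / 2)) \<partial>lborel) \<le> ennreal (2 * pi) * ?N"
    if s: "0 < s" for s
  proof -
    have [measurable]: "w s \<in> borel_measurable borel" unfolding w_def by measurable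
    have w_int: "integrable lborel (w s)"
      using fourier_gaussian(1)[OF s] unfolding w_def .
    have bounded_times_w: "integrable lborel (\<lambda>x. f x * w s x)"
      if "f \<in> borel_measurable borel" "\<And>x. cmod (f x) \<le> B" for f B
    proof (rule Bochner_Integration.integrable_bound)
      show "integrable lborel (\<lambda>x. of_real B * w s x)" using w_int by simp
      show "(\<lambda>x. f x * w s x) \<in> borel_measurable lborel" using that(1) by measurable
      show "AE x in lborel. norm (f x * w s x) \<le> norm (of_real B * w s x)"
        using that(2) by (intro AE_I2) (auto simp: norm_mult intro!: mult_right_mono intro: order_trans[OF that(2) abs_ge_self])
    qed
    define cG where "cG v = cnj (G v)" for v
    have cG: "integrable lborel cG" unfolding cG_def using G by simp
    have [measurable]: "cG \<in> borel_measurable borel" using cG by auto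
    define g where "g x = cnj (fourier G x) * w s x" for x
    have g: "integrable lborel g"
      unfolding g_def
      by (intro bounded_times_w[where B="LINT x|lborel. cmod (G x)"])
         (measurable, simp_all add: norm_fourier_le[OF G])
    \<comment> \<open>The weight is even, so reflecting the variable removes the sign that conjugation produced.\<close>
    have fourier_g: "fourier g u = (CLINT v|lborel. cG v * of_real (2 * pi * normal_density u s v))" for u
    proof -
      have "fourier g u = (CLINT x|lborel. iexp (u * x) * (fourier cG (- x) * w s x))"
        unfolding fourier_def[of g] g_def cG_def by (simp add: cnj_fourier)
      also have "\<dots> = (CLINT x|lborel. fourier cG x * (iexp (- u * x) * w s x))"
        by (subst lborel_integral_real_affine[where c="-1" and t=0]) (simp_all add: w_def ac_simps)
      also have "\<dots> = (CLINT v|lborel. cG v * fourier (\<lambda>x. iexp (- u * x) * w s x) v)"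
        by (rule fourier_multiplication_formula[OF cG integrable_iexp_mult[OF w_int]])
      also have "(\<lambda>v. fourier (\<lambda>x. iexp (- u * x) * w s x) v) = (\<lambda>v. fourier (w s) (v - u))"
        unfolding fourier_def by (simp add: exp_diff exp_minus left_diff_distrib right_diff_distrib field_simps)
      also have "(\<lambda>v. fourier (w s) (v - u)) = (\<lambda>v. of_real (2 * pi * normal_density u s v))"
        using fourier_gaussian(2)[OF s] unfolding w_def by auto
      finally show ?thesis .
    qed
    have eq: "complex_of_real ((cmod (fourier G x))\<^sup>2 * exp (- (s * x)\<^sup>2 / 2)) = fourier G x * g x" for x
      by (simp only: g_def w_def of_real_mult mult.assoc[symmetric] complex_norm_square)
    have int: "integrable lborel (\<lambda>x. fourier G x * g x)"
    proof -
      have "integrable lborel (\<lambda>x. (fourier G x * cnj (fourier G x)) * w s x)"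
        using norm_fourier_le[OF G]
        by (intro bounded_times_w[where B="(LINT x|lborel. cmod (G x)) * (LINT x|lborel. cmod (G x))"])
           (auto simp: norm_mult intro!: mult_mono)
      then show ?thesis by (simp add: g_def mult.assoc)
    qed
    have int': "integrable lborel (\<lambda>x. (cmod (fourier G x))\<^sup>2 * exp (- (s * x)\<^sup>2 / 2))"
      using integrable_Re[OF int] unfolding eq[symmetric] by simp
    have "(\<integral>\<^sup>+x. ennreal ((cmod (fourier G x))\<^sup>2 * exp (- (s * x)\<^sup>2 / 2)) \<partial>lborel)
        = ennreal (LINT x|lborel. (cmod (fourier G x))\<^sup>2 * exp (- (s * x)\<^sup>2 / 2))"
      by (intro nn_integral_eq_integral int') auto
    also have "(LINT x|lborel. (cmod (fourier G x))\<^sup>2 * exp (- (s * x)\<^sup>2 / 2))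
        \<le> cmod (complex_of_real (LINT x|lborel. (cmod (fourier G x))\<^sup>2 * exp (- (s * x)\<^sup>2 / 2)))"
      by simp
    also have "complex_of_real (LINT x|lborel. (cmod (fourier G x))\<^sup>2 * exp (- (s * x)\<^sup>2 / 2))
        = (CLINT x|lborel. fourier G x * g x)"
      unfolding eq[symmetric] integral_complex_of_real[symmetric] ..
    also have "\<dots> = (CLINT u|lborel. G u * fourier g u)"
      by (rule fourier_multiplication_formula[OF G g])
    also have "ennreal (cmod (CLINT u|lborel. G u * fourier g u))
        \<le> (\<integral>\<^sup>+u. ennreal (cmod (G u * fourier g u)) \<partial>lborel)"
      by (rule norm_integral_le_nn_integral)
    also have "\<dots> \<le> (\<integral>\<^sup>+u. (\<integral>\<^sup>+v. ennreal (cmod (G u) * (cmod (G v) * (2 * pi * normal_density u s v))) \<partial>lborel) \<partial>lborel)"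
    proof (rule nn_integral_mono)
      fix u
      have "ennreal (cmod (G u * fourier g u)) = ennreal (cmod (G u)) * ennreal (cmod (fourier g u))"
        by (simp add: norm_mult ennreal_mult)
      also have "\<dots> \<le> ennreal (cmod (G u)) * (\<integral>\<^sup>+v. ennreal (cmod (cG v * of_real (2 * pi * normal_density u s v))) \<partial>lborel)"
        unfolding fourier_g by (intro mult_left_mono norm_integral_le_nn_integral) auto
      also have "\<dots> = (\<integral>\<^sup>+v. ennreal (cmod (G u) * (cmod (G v) * (2 * pi * normal_density u s v))) \<partial>lborel)"
        by (subst nn_integral_cmult[symmetric]) (auto simp: norm_mult cG_def ennreal_mult)
      finally show "ennreal (cmod (G u * fourier g u)) \<le> \<dots>" .
    qed
    also have "\<dots> \<le> (\<integral>\<^sup>+u. (\<integral>\<^sup>+v. ennreal (pi * ((cmod (G u))\<^sup>2 * normal_density u s v)) +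
          ennreal (pi * ((cmod (G v))\<^sup>2 * normal_density v s u)) \<partial>lborel) \<partial>lborel)"
    proof (intro nn_integral_mono)
      fix u v
      have sym: "normal_density v s u = normal_density u s v"
        by (simp add: normal_density_def power2_commute)
      have "cmod (G u) * (cmod (G v) * (2 * pi * normal_density u s v))
          = (2 * cmod (G u) * cmod (G v)) * (pi * normal_density u s v)" by simp
      also have "\<dots> \<le> ((cmod (G u))\<^sup>2 + (cmod (G v))\<^sup>2) * (pi * normal_density u s v)"
        using sum_squares_bound[of "cmod (G u)" "cmod (G v)"] by (intro mult_right_mono) auto
      also have "\<dots> = pi * ((cmod (G u))\<^sup>2 * normal_density u s v) + pi * ((cmod (G v))\<^sup>2 * normal_density v s u)"
        by (simp add: sym algebra_simps)
      finally show "ennreal (cmod (G u) * (cmod (G v) * (2 * pi * normal_density u s v)))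
          \<le> ennreal (pi * ((cmod (G u))\<^sup>2 * normal_density u s v)) + ennreal (pi * ((cmod (G v))\<^sup>2 * normal_density v s u))"
        by (subst ennreal_plus[symmetric], simp, simp, intro ennreal_leI)
    qed
    also have "\<dots> = (\<integral>\<^sup>+u. (\<integral>\<^sup>+v. ennreal (pi * ((cmod (G u))\<^sup>2 * normal_density u s v)) \<partial>lborel) \<partial>lborel)
        + (\<integral>\<^sup>+u. (\<integral>\<^sup>+v. ennreal (pi * ((cmod (G v))\<^sup>2 * normal_density v s u)) \<partial>lborel) \<partial>lborel)"
      unfolding normal_density_def by (subst nn_integral_add; simp add: nn_integral_add)
    also have "(\<integral>\<^sup>+u. (\<integral>\<^sup>+v. ennreal (pi * ((cmod (G v))\<^sup>2 * normal_density v s u)) \<partial>lborel) \<partial>lborel)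
        = (\<integral>\<^sup>+u. (\<integral>\<^sup>+v. ennreal (pi * ((cmod (G u))\<^sup>2 * normal_density u s v)) \<partial>lborel) \<partial>lborel)"
      unfolding normal_density_def by (subst lborel_pair.Fubini') auto
    also have "(\<integral>\<^sup>+u. (\<integral>\<^sup>+v. ennreal (pi * ((cmod (G u))\<^sup>2 * normal_density u s v)) \<partial>lborel) \<partial>lborel)
        = ennreal pi * ?N"
    proof -
      have "(\<integral>\<^sup>+v. ennreal (pi * ((cmod (G u))\<^sup>2 * normal_density u s v)) \<partial>lborel)
          = ennreal pi * ennreal ((cmod (G u))\<^sup>2)" for u
      proof -
        have "(\<integral>\<^sup>+v. ennreal (pi * ((cmod (G u))\<^sup>2 * normal_density u s v)) \<partial>lborel)
            = ennreal (LINT v|lborel. pi * ((cmod (G u))\<^sup>2 * normal_density u s v))"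
          using s by (intro nn_integral_eq_integral) auto
        then show ?thesis using s by (simp add: ennreal_mult)
      qed
      then show ?thesis by (simp add: nn_integral_cmult)
    qed
    also have "ennreal pi * ?N + ennreal pi * ?N = ennreal (2 * pi) * ?N"
      by (simp flip: distrib_right ennreal_plus)
    finally show ?thesis by (simp add: ennreal_leI)
  qed
  have "(\<integral>\<^sup>+x. ennreal ((cmod (fourier G x))\<^sup>2) \<partial>lborel)
      = (\<integral>\<^sup>+x. liminf (\<lambda>n. ennreal ((cmod (fourier G x))\<^sup>2 * exp (- (inverse (real (Suc n)) * x)\<^sup>2 / 2))) \<partial>lborel)"
  proof (intro nn_integral_cong)
    fix x
    have "(\<lambda>n. ennreal ((cmod (fourier G x))\<^sup>2 * exp (- (inverse (real (Suc n)) * x)\<^sup>2 / 2)))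
        \<longlonglongrightarrow> ennreal ((cmod (fourier G x))\<^sup>2 * exp (- (0 * x)\<^sup>2 / 2))"
      by (intro tendsto_intros LIMSEQ_inverse_real_of_nat) auto
    then show "ennreal ((cmod (fourier G x))\<^sup>2)
        = liminf (\<lambda>n. ennreal ((cmod (fourier G x))\<^sup>2 * exp (- (inverse (real (Suc n)) * x)\<^sup>2 / 2)))"
      by (intro lim_imp_Liminf[symmetric]) auto
  qed
  also have "\<dots> \<le> liminf (\<lambda>n. \<integral>\<^sup>+x. ennreal ((cmod (fourier G x))\<^sup>2 * exp (- (inverse (real (Suc n)) * x)\<^sup>2 / 2)) \<partial>lborel)"
    by (intro nn_integral_liminf) measurable
  also have "\<dots> \<le> ennreal (2 * pi) * ?N"
    by (rule Liminf_le, simp, intro always_eventually allI weighted) simp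
  finally show ?thesis .
qed

section \<open>Fourier inversion and the error of a cutoff estimator\<close>

text \<open>
  The negative parts are moved to the other side, so that two nonnegative densities are compared.
  They define the same measure on half-open intervals, hence on all Borel sets.
\<close>

lemma AE_eq_if_interval_integrals_eq:
  fixes f g :: "real \<Rightarrow> real"
  assumes f: "\<And>a b. set_integrable lborel {a<..b} f"
    and g: "\<And>a b. set_integrable lborel {a<..b} g"
    and eq: "\<And>a b. a < b \<Longrightarrow> (LINT x:{a<..b}|lborel. f x) = (LINT x:{a<..b}|lborel. g x)"
    and [measurable]: "f \<in> borel_measurable borel" "g \<in> borel_measurable borel"
  shows "AE x in lborel. f x = g x"
proof -
  define f' where "f' x = max 0 (f x) + max 0 (- g x)" for x
  define g' where "g' x = max 0 (g x) + max 0 (- f x)" for x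
  have nonneg: "0 \<le> f' x" "0 \<le> g' x" for x unfolding f'_def g'_def by auto
  have [measurable]: "f' \<in> borel_measurable borel" "g' \<in> borel_measurable borel"
    unfolding f'_def g'_def by measurable
  have int: "integrable lborel (\<lambda>x. indicator {a<..b} x * f' x)"
       "integrable lborel (\<lambda>x. indicator {a<..b} x * g' x)" for a b
  proof -
    have "integrable lborel (\<lambda>x. \<bar>indicator {a<..b} x * f x\<bar> + \<bar>indicator {a<..b} x * g x\<bar>)"
      using f[of a b] g[of a b] unfolding set_integrable_def by auto
    then show "integrable lborel (\<lambda>x. indicator {a<..b} x * f' x)"
       "integrable lborel (\<lambda>x. indicator {a<..b} x * g' x)"
      by (rule Bochner_Integration.integrable_bound; auto simp: f'_def g'_def indicator_def)+
  qed
  have em: "emeasure (density lborel f') {a<..b} = ennreal (LINT x|lborel. indicator {a<..b} x * f' x)"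
           "emeasure (density lborel g') {a<..b} = ennreal (LINT x|lborel. indicator {a<..b} x * g' x)" for a b
    using nonneg
    by (simp_all add: emeasure_density nn_integral_eq_integral[OF int(1), symmetric] nn_integral_eq_integral[OF int(2), symmetric])
       (auto intro!: nn_integral_cong split: split_indicator)
  have eq': "(LINT x|lborel. indicator {a<..b} x * f' x) = (LINT x|lborel. indicator {a<..b} x * g' x)" for a b
  proof (cases "a < b")
    case True
    have "(LINT x|lborel. indicator {a<..b} x * f' x) - (LINT x|lborel. indicator {a<..b} x * g' x)
       = (LINT x|lborel. indicator {a<..b} x * f' x - indicator {a<..b} x * g' x)"
      by (rule Bochner_Integration.integral_diff[symmetric, OF int])
    also have "\<dots> = (LINT x|lborel. indicator {a<..b} x * f x - indicator {a<..b} x * g x)"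
      by (intro Bochner_Integration.integral_cong) (auto simp: f'_def g'_def indicator_def max_def)
    also have "\<dots> = (LINT x:{a<..b}|lborel. f x) - (LINT x:{a<..b}|lborel. g x)"
      using f[of a b] g[of a b] unfolding set_integrable_def set_lebesgue_integral_def
      by (simp add: Bochner_Integration.integral_diff)
    finally show ?thesis using eq[OF True] by simp
  qed simp
  have "density lborel f' = density lborel g'"
  proof (rule measure_eqI_generator_eq)
    let ?E = "range (\<lambda>(a, b). {a<..b::real})"
    show "Int_stable ?E"
      by (auto simp: Int_stable_def intro!: rev_image_eqI[where x="(max _ _, min _ _)"])
    show "?E \<subseteq> Pow UNIV" by auto
    show "emeasure (density lborel f') X = emeasure (density lborel g') X" if "X \<in> ?E" for X
      using that em eq' by auto
    show "sets (density lborel f') = sigma_sets UNIV ?E" "sets (density lborel g') = sigma_sets UNIV ?E"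
      by (simp_all add: borel_sigma_sets_Ioc)
    show "range (\<lambda>n. {- real n<..real n}) \<subseteq> ?E" by auto
    show "(\<Union>n. {- real n<..real n}) = UNIV"
    proof (intro equalityI subsetI UNIV_I)
      fix x :: real
      obtain n where "\<bar>x\<bar> < real n" using reals_Archimedean2 by blast
      then show "x \<in> (\<Union>n. {- real n<..real n})" by (intro UN_I[of n]) auto
    qed
    show "emeasure (density lborel f') {- real n<..real n} \<noteq> \<infinity>" for n
      by (simp add: em)
  qed
  then have "AE x in lborel. ennreal (f' x) = ennreal (g' x)"
    by (intro sigma_finite_measure.density_unique[OF sigma_finite_lborel]) auto
  then show ?thesis
    by eventually_elim (use nonneg in \<open>auto simp: f'_def g'_def max_def split: if_splits\<close>)
qed

lemma fourier_indicator_Ioc: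
  assumes "a < b"
  shows "fourier (indicator {a<..b}) t = (if t = 0 then of_real (b - a) else (iexp (t * b) - iexp (t * a)) / (\<i> * t))"
proof -
  have "fourier (indicator {a<..b}) t = (CLBINT x=a..b. iexp (t * x))"
    using assms unfolding fourier_def
    by (simp add: interval_lebesgue_integral_def einterval_eq set_lebesgue_integral_def)
       (rule integral_cong_AE; use AE_lborel_singleton[of b] in \<open>auto simp: indicator_def elim!: eventually_mono\<close>)
  also have "\<dots> = (if t = 0 then of_real (b - a) else (iexp (t * b) - iexp (t * a)) / (\<i> * t))"
  proof (cases "t = 0")
    case True
    have "(CLBINT x=a..b. 1) = complex_of_real b - complex_of_real a"
      using assms by (intro interval_integral_FTC_finite)
        (auto intro!: derivative_eq_intros continuous_intros simp: has_vector_derivative_complex_iff)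
    then show ?thesis using True by simp
  next
    case False
    have "((\<lambda>z. exp (\<i> * t * z) / (\<i> * t)) has_field_derivative iexp (t * x)) (at (complex_of_real x))" for x
      using False by (auto intro!: derivative_eq_intros simp: field_simps)
    from has_vector_derivative_real_field[OF this]
    have "(CLBINT x=a..b. iexp (t * x)) = iexp (t * b) / (\<i> * t) - iexp (t * a) / (\<i> * t)"
      by (intro interval_integral_FTC_finite) (auto intro!: continuous_intros simp: mult.assoc)
    then show ?thesis using False by (simp add: diff_divide_distrib)
  qed
  finally show ?thesis .
qed

lemma lborel_integral_reflect:
  fixes f :: "real \<Rightarrow> 'a :: {banach, second_countable_topology}"
  shows "(LINT x|lborel. f (- x)) = integral\<^sup>L lborel f"
  by (subst (2) lborel_integral_real_affine[where c="-1" and t=0]) simp_all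

text \<open>
  Normalized to total mass 1, \<open>h\<close> is a probability density and its transform a characteristic
  function, so Levy's inversion theorem recovers the mass of every interval. As the transform is
  integrable, the limit in that theorem is an integral over the whole line, and the multiplication
  formula identifies it with the integral of the inverse transform over the interval.
\<close>

theorem fourier_inversion_nonneg:
  assumes h: "integrable lborel h" and h_nonneg: "\<And>x. 0 \<le> h x"
    and fh: "integrable lborel (fourier (\<lambda>x. complex_of_real (h x)))"
  shows "AE x in lborel. complex_of_real (h x) = fourier (fourier (\<lambda>x. complex_of_real (h x))) (- x) / (2 * pi)"
proof (cases "AE x in lborel. h x = 0")
  case True
  have "fourier (\<lambda>x. complex_of_real (h x)) = (\<lambda>_. 0)"
    unfolding fourier_def using h True
    by (intro ext integral_eq_zero_AE) (auto elim!: eventually_mono)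
  then have "fourier (fourier (\<lambda>x. complex_of_real (h x))) x = 0" for x by (simp add: fourier_def)
  with True show ?thesis by (auto elim!: eventually_mono)
next
  case False
  have [measurable]: "h \<in> borel_measurable borel" using h by auto
  define h_star where "h_star = fourier (\<lambda>x. complex_of_real (h x))"
  have h_star_int: "integrable lborel h_star" using fh unfolding h_star_def .
  have [measurable]: "h_star \<in> borel_measurable borel" unfolding h_star_def by measurable
  define k where "k x = fourier h_star (- x) / (2 * pi)" for x
  have [measurable]: "k \<in> borel_measurable borel" unfolding k_def by measurable
  define c where "c = (LINT x|lborel. h x)"
  have c: "c > 0"
    using False h h_nonneg integral_nonneg_eq_0_iff_AE[of lborel h] Bochner_Integration.integral_nonneg[of lborel h]
    unfolding c_def by (auto simp: order_less_le)
  define P where "P = density lborel (\<lambda>x. ennreal (h x / c))"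
  have emP: "emeasure P A = ennreal ((LINT x:A|lborel. h x) / c)" if A: "A \<in> sets borel" for A
  proof -
    have "integrable lborel (\<lambda>x. indicator A x * (h x / c))"
      using integrable_mult_indicator[of A lborel "\<lambda>x. h x / c"] A h by simp
    then have "ennreal (LINT x|lborel. indicator A x * (h x / c)) = (\<integral>\<^sup>+x. ennreal (indicator A x * (h x / c)) \<partial>lborel)"
      using h_nonneg c by (intro nn_integral_eq_integral[symmetric]) auto
    also have "\<dots> = emeasure P A"
      unfolding P_def using A by (auto simp: emeasure_density intro!: nn_integral_cong split: split_indicator)
    finally show ?thesis by (simp add: set_lebesgue_integral_def)
  qed
  have "prob_space P"
    using emP[of UNIV] c by (intro prob_spaceI) (simp add: P_def c_def set_lebesgue_integral_def)
  then interpret P: real_distribution P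
    by (simp add: real_distribution_def real_distribution_axioms_def P_def)
  have measP: "measure P A = (LINT x:A|lborel. h x) / c" if A: "A \<in> sets borel" for A
    using emP[OF A] c h_nonneg
    by (simp add: measure_def set_lebesgue_integral_def Bochner_Integration.integral_nonneg divide_nonneg_pos)
  have char: "char P t = h_star t / c" for t
  proof -
    have "char P t = (CLINT x|lborel. (h x / c) *\<^sub>R iexp (t * x))"
      unfolding char_def P_def using h_nonneg c by (subst integral_density) auto
    also have "\<dots> = (CLINT x|lborel. iexp (t * x) * complex_of_real (h x) / c)"
      by (intro Bochner_Integration.integral_cong) (auto simp: scaleR_conv_of_real)
    finally show ?thesis unfolding h_star_def fourier_def by simp
  qed
  have eq: "complex_of_real (LINT x:{a<..b}|lborel. h x) = (CLINT x:{a<..b}|lborel. k x)" if ab: "a < b" for a b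
  proof -
    have atom: "measure P {x} = 0" for x
    proof -
      have "(LINT y:{x}|lborel. h y) = 0"
        unfolding set_lebesgue_integral_def using AE_lborel_singleton[of x]
        by (intro integral_eq_zero_AE) (auto elim!: eventually_mono)
      then show ?thesis by (simp add: measP)
    qed
    \<comment> \<open>The kernel of Levy's theorem; away from 0 it is the transform of the interval's indicator.\<close>
    define F where "F t = (iexp (-(t * a)) - iexp (-(t * b))) / (\<i> * t)" for t :: real
    have F: "F t = fourier (indicator {a<..b}) (- t)" if "t \<noteq> 0" for t
      using that fourier_indicator_Ioc[OF ab, of "- t"] by (simp add: F_def field_simps)
    have Fbound: "cmod (F t) \<le> b - a" for t
      using Levy_Inversion_aux2[of a b "-t"] ab by (cases "t = 0") (auto simp: F_def norm_divide norm_mult norm_minus_commute)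
    have [measurable]: "F \<in> borel_measurable borel" unfolding F_def by measurable
    have ind: "integrable lborel (indicator {a<..b} :: real \<Rightarrow> complex)"
    proof -
      have "integrable lborel (\<lambda>x. complex_of_real (indicator {a<..b} x))"
        using ab by (intro integrable_of_real integrable_real_indicator) auto
      then show ?thesis by (simp add: of_real_indicator)
    qed
    have "(\<lambda>T. 1 / (2 * pi) * (CLBINT t=-real T..real T. F t * char P t)) \<longlonglongrightarrow> measure P {a<..b}"
      using P.Levy_Inversion[of a b] ab atom unfolding F_def by simp
    moreover have "(\<lambda>T. 1 / (2 * pi) * (CLBINT t=-real T..real T. F t * char P t)) \<longlonglongrightarrow> 1 / (2 * pi) * (CLINT t|lborel. F t * char P t)"
    proof (intro tendsto_intros)
      have "(CLBINT t=-real T..real T. F t * char P t) = (CLINT t|lborel. indicator {-real T<..<real T} t *\<^sub>R (F t * char P t))" for T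
        by (simp add: interval_lebesgue_integral_def einterval_eq set_lebesgue_integral_def)
      moreover have "(\<lambda>T. CLINT t|lborel. indicator {-real T<..<real T} t *\<^sub>R (F t * char P t)) \<longlonglongrightarrow> (CLINT t|lborel. F t * char P t)"
      proof (rule integral_dominated_convergence[where w="\<lambda>t. (b - a) * cmod (char P t)"])
        show "integrable lborel (\<lambda>t. (b - a) * cmod (char P t))" unfolding char using h_star_int by simp
        show "AE t in lborel. (\<lambda>T. indicator {-real T<..<real T} t *\<^sub>R (F t * char P t)) \<longlonglongrightarrow> F t * char P t"
        proof (intro AE_I2 tendsto_eventually)
          fix t :: real
          obtain n where n: "\<bar>t\<bar> < real n" using reals_Archimedean2 by blast
          show "\<forall>\<^sub>F T in sequentially. indicator {-real T<..<real T} t *\<^sub>R (F t * char P t) = F t * char P t"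
            using eventually_ge_at_top[of n] by eventually_elim (use n in \<open>auto simp: indicator_def\<close>)
        qed
        show "AE t in lborel. norm (indicator {-real T<..<real T} t *\<^sub>R (F t * char P t)) \<le> (b - a) * cmod (char P t)" for T
          using Fbound ab by (intro AE_I2) (auto simp: norm_mult indicator_def intro!: mult_mono)
      qed measurable
      ultimately show "(\<lambda>T. CLBINT t=-real T..real T. F t * char P t) \<longlonglongrightarrow> (CLINT t|lborel. F t * char P t)" by simp
    qed
    ultimately have "complex_of_real (measure P {a<..b}) = 1 / (2 * pi) * (CLINT t|lborel. F t * char P t)"
      by (rule LIMSEQ_unique)
    also have "(CLINT t|lborel. F t * char P t) = (CLINT t|lborel. fourier (indicator {a<..b}) (- t) * h_star t / c)"
    proof (rule integral_cong_AE)
      show "AE t in lborel. F t * char P t = fourier (indicator {a<..b}) (- t) * h_star t / c"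
        using AE_lborel_singleton[of 0] by eventually_elim (simp add: F char)
    qed measurable
    also have "\<dots> = (CLINT t|lborel. fourier (indicator {a<..b}) t * h_star (- t)) / c"
      using lborel_integral_reflect[of "\<lambda>t. fourier (indicator {a<..b}) (- t) * h_star t"] by auto
    also have "(CLINT t|lborel. fourier (indicator {a<..b}) t * h_star (- t)) = (CLINT t|lborel. indicator {a<..b} t * fourier (\<lambda>t. h_star (- t)) t)"
      using lborel_integrable_real_affine[OF h_star_int, of "-1" 0] by (intro fourier_multiplication_formula[OF ind]) simp
    also have "(\<lambda>t. fourier (\<lambda>t. h_star (- t)) t) = (\<lambda>t. fourier h_star (- t))"
      unfolding fourier_def by (subst lborel_integral_reflect[symmetric]) simp
    finally show ?thesis
      using c measP[of "{a<..b}"]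
      by (simp add: set_lebesgue_integral_def k_def scaleR_conv_of_real field_simps of_real_indicator)
  qed
  have kb: "cmod (k x) \<le> (LINT u|lborel. cmod (h_star u)) / (2 * pi)" for x
    unfolding k_def using norm_fourier_le[OF h_star_int, of "- x"] by (simp add: norm_divide divide_right_mono)
  have k_int: "set_integrable lborel {a<..b} k" for a b
    unfolding set_integrable_def
  proof (rule Bochner_Integration.integrable_bound)
    show "integrable lborel (\<lambda>x. indicator {a<..b} x * ((LINT u|lborel. cmod (h_star u)) / (2 * pi)))"
      by (intro integrable_mult_left integrable_real_indicator) (cases "a \<le> b"; simp)+
  qed (auto intro!: AE_I2 kb[THEN order_trans] simp: indicator_def)
  have h_int: "set_integrable lborel {a<..b} h" for a b
    unfolding set_integrable_def using h by (intro integrable_mult_indicator) auto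
  have "AE x in lborel. h x = Re (k x)"
  proof (rule AE_eq_if_interval_integrals_eq)
    show "(LINT x:{a<..b}|lborel. h x) = (LINT x:{a<..b}|lborel. Re (k x))" if "a < b" for a b
      using arg_cong[OF eq[OF that], of Re] k_int[of a b]
      by (simp add: set_lebesgue_integral_def set_integrable_def flip: integral_Re)
    show "set_integrable lborel {a<..b} (\<lambda>x. Re (k x))" for a b
      using integrable_Re[OF k_int[of a b, unfolded set_integrable_def]] by (simp add: set_integrable_def)
  qed (use h_int in auto)
  moreover have "AE x in lborel. 0 = Im (k x)"
  proof (rule AE_eq_if_interval_integrals_eq)
    show "(LINT x:{a<..b}|lborel. 0) = (LINT x:{a<..b}|lborel. Im (k x))" if "a < b" for a b
      using arg_cong[OF eq[OF that], of Im] k_int[of a b]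
      by (simp add: set_lebesgue_integral_def set_integrable_def flip: integral_Im)
    show "set_integrable lborel {a<..b} (\<lambda>x. Im (k x))" for a b
      using integrable_Im[OF k_int[of a b, unfolded set_integrable_def]] by (simp add: set_integrable_def)
  qed (auto simp: set_integrable_def)
  ultimately show ?thesis
    unfolding h_star_def[symmetric] k_def[symmetric] by eventually_elim (simp add: complex_eq_iff)
qed

text \<open>
  After inversion of \<open>h\<close>, the error is itself an inverse transform, of the difference between the
  truncated \<open>g\<close> and the transform of \<open>h\<close>.
\<close>

theorem L2_error_cutoff_inverse_le:
  assumes h: "integrable lborel h" and h_nonneg: "\<And>x. 0 \<le> h x"
    and fh: "integrable lborel (fourier (\<lambda>x. complex_of_real (h x)))"
    and g: "continuous_on UNIV g"
  shows "L2_norm_sq (\<lambda>x. cutoff_inverse m g x - complex_of_real (h x))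
    \<le> ennreal (1 / (2 * pi)) * (\<integral>\<^sup>+u. ennreal ((cmod (indicator {- (pi * m)..pi * m} u * g u
          - fourier (\<lambda>x. complex_of_real (h x)) u))\<^sup>2) \<partial>lborel)"
proof -
  define h_star where "h_star = fourier (\<lambda>x. complex_of_real (h x))"
  have h_star_int: "integrable lborel h_star" using fh unfolding h_star_def .
  define gm where "gm u = indicator {- (pi * m)..pi * m} u * g u" for u
  have "set_integrable lborel {- (pi * m)..pi * m} g"
    using g by (intro borel_integrable_atLeastAtMost' continuous_on_subset[OF g]) auto
  then have gm: "integrable lborel gm"
    unfolding set_integrable_def gm_def by (simp add: scaleR_conv_of_real of_real_indicator)
  define G where "G u = gm u - h_star u" for u
  have G: "integrable lborel G" unfolding G_def using gm h_star_int by simp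
  have [measurable]: "fourier G \<in> borel_measurable borel" using G by measurable
  have cut: "cutoff_inverse m g x = fourier gm (- x) / (2 * pi)" for x
    unfolding cutoff_inverse_def fourier_def set_lebesgue_integral_def gm_def
    by (simp add: scaleR_conv_of_real of_real_indicator ac_simps)
  have "AE x in lborel. ennreal ((cmod (cutoff_inverse m g x - complex_of_real (h x)))\<^sup>2)
      = ennreal (1 / (2 * pi)\<^sup>2) * ennreal ((cmod (fourier G (- x)))\<^sup>2)"
    using fourier_inversion_nonneg[OF h h_nonneg fh]
  proof eventually_elim
    case (elim x)
    have "fourier G (- x) = fourier gm (- x) - fourier h_star (- x)"
      unfolding fourier_def[of G] fourier_def[of gm] fourier_def[of h_star] G_def
      using integrable_iexp_mult[OF gm, of "- x"] integrable_iexp_mult[OF h_star_int, of "- x"]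
      by (simp add: right_diff_distrib Bochner_Integration.integral_diff)
    then have "cutoff_inverse m g x - complex_of_real (h x) = fourier G (- x) / (2 * pi)"
      using elim unfolding cut h_star_def by (simp add: diff_divide_distrib)
    moreover have "(cmod (fourier G (- x) / (2 * pi)))\<^sup>2 = 1 / (2 * pi)\<^sup>2 * (cmod (fourier G (- x)))\<^sup>2"
      by (simp add: norm_divide norm_mult power_divide)
    ultimately show ?case
      by (simp only: ennreal_mult[symmetric] zero_le_power2 zero_le_divide_1_iff)
  qed
  then have "L2_norm_sq (\<lambda>x. cutoff_inverse m g x - complex_of_real (h x))
      = (\<integral>\<^sup>+x. ennreal (1 / (2 * pi)\<^sup>2) * ennreal ((cmod (fourier G (- x)))\<^sup>2) \<partial>lborel)"
    unfolding L2_norm_sq_def by (rule nn_integral_cong_AE)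
  also have "\<dots> = ennreal (1 / (2 * pi)\<^sup>2) * (\<integral>\<^sup>+x. ennreal ((cmod (fourier G x))\<^sup>2) \<partial>lborel)"
    by (subst (2) nn_integral_real_affine[where c="-1" and t=0]) (auto simp: nn_integral_cmult)
  also have "\<dots> \<le> ennreal (1 / (2 * pi)\<^sup>2) * (ennreal (2 * pi) * (\<integral>\<^sup>+u. ennreal ((cmod (G u))\<^sup>2) \<partial>lborel))"
    by (intro mult_left_mono fourier_L2_bound G) simp
  also have "\<dots> = ennreal (1 / (2 * pi)) * (\<integral>\<^sup>+u. ennreal ((cmod (G u))\<^sup>2) \<partial>lborel)"
    by (simp add: mult.assoc[symmetric] power2_eq_square flip: ennreal_mult)
  finally show ?thesis unfolding G_def gm_def h_star_def .
qed

section \<open>The Levy exponent and its derivatives\<close>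

lemma norm_integral_le_of_norm_le:
  fixes f :: "'a \<Rightarrow> 'b :: {banach, second_countable_topology}"
  assumes w: "integrable M w" and le: "\<And>x. norm (f x) \<le> w x"
  shows "norm (integral\<^sup>L M f) \<le> integral\<^sup>L M w"
proof (cases "integrable M f")
  case True
  have "norm (integral\<^sup>L M f) \<le> (LINT x|M. norm (f x))" by (rule integral_norm_bound)
  also have "\<dots> \<le> integral\<^sup>L M w" using True w le by (intro integral_mono) auto
  finally show ?thesis .
next
  case False
  have "0 \<le> w x" for x using le[of x] norm_ge_zero[of "f x"] by linarith
  then show ?thesis
    using False by (simp add: not_integrable_integral_eq Bochner_Integration.integral_nonneg)
qed

lemma has_vector_derivative_quadratic_bound:
  fixes f :: "real \<Rightarrow> 'a :: real_normed_vector"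
  assumes "\<And>y. norm (f y - f x - (y - x) *\<^sub>R D) \<le> K * (y - x)\<^sup>2"
  shows "(f has_vector_derivative D) (at x)"
  unfolding has_vector_derivative_def has_derivative_at
proof (intro conjI bounded_linear_intros)
  have "((\<lambda>h. K * \<bar>h\<bar>) \<longlongrightarrow> 0) (at 0)" by (auto intro!: tendsto_eq_intros)
  moreover have "norm (norm (f (x + h) - f x - h *\<^sub>R D) / norm h) \<le> K * \<bar>h\<bar>" for h
  proof (cases "h = 0")
    case False
    have "norm (f (x + h) - f x - h *\<^sub>R D) \<le> K * \<bar>h\<bar> * \<bar>h\<bar>"
      using assms[of "x + h"] by (simp add: power2_eq_square mult.assoc)
    then show ?thesis using False by (simp add: pos_divide_le_eq)
  qed simp
  ultimately show "(\<lambda>h. norm (f (x + h) - f x - h *\<^sub>R D) / norm h) \<midarrow>0\<rightarrow> 0"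
    by (rule Lim_null_comparison[OF always_eventually[OF allI], rotated])
qed

lemma norm_iexp_minus_1_le: "cmod (iexp y - 1) \<le> \<bar>y\<bar>"
  using iexp_approx1[of y 0] by simp

lemma norm_iexp_minus_affine_le: "cmod (iexp y - 1 - \<i> * y) \<le> y\<^sup>2 / 2"
  using iexp_approx1[of y 1] by (simp add: power2_eq_square numeral_2_eq_2 diff_diff_eq abs_mult_self_eq flip: abs_mult)

lemma norm_iexp_second_difference_le: "cmod (iexp y + iexp (- y) - 2) \<le> y\<^sup>2"
proof -
  have "iexp y + iexp (- y) - 2 = (iexp y - 1 - \<i> * y) + (iexp (- y) - 1 - \<i> * (- y))" by simp
  also have "cmod \<dots> \<le> y\<^sup>2 / 2 + (- y)\<^sup>2 / 2"
    using norm_iexp_minus_affine_le[of y] norm_iexp_minus_affine_le[of "- y"]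
    by (intro norm_triangle_mono) simp_all
  finally show ?thesis by simp
qed

text \<open>
  Integrability of the transform of \<open>x\<^sup>2 \<nu>(x)\<close> stands in for the smoothness class: it is all that the
  bounds on the exponent take from it.
\<close>

locale square_integrable_levy_exponent =
  fixes b \<sigma> :: real and \<nu> :: "real \<Rightarrow> real"
  assumes density: "levy_density \<nu>"
    and moment2: "integrable lborel (\<lambda>x. x\<^sup>2 * \<nu> x)"
    and moment4: "integrable lborel (\<lambda>x. x ^ 4 * \<nu> x)"
    and no_gaussian: "\<sigma>\<^sup>2 = 0"
    and fourier_h_integrable: "integrable lborel (fourier (\<lambda>x. complex_of_real (x\<^sup>2 * \<nu> x)))"
begin

abbreviation "phi \<equiv> levy_exponent b \<sigma> \<nu>"

text \<open>
  The first derivative of \<open>phi\<close>; the second one is \<open>- h_star\<close>.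
\<close>

definition "phi1 u = \<i> * of_real b + (CLINT x|lborel. \<i> * of_real x * (iexp (u * x) - 1) * of_real (\<nu> x))"

definition "h_star = fourier (\<lambda>x. complex_of_real (x\<^sup>2 * \<nu> x))"

definition "m2 = (LINT x|lborel. x\<^sup>2 * \<nu> x)"
definition "m3 = (LINT x|lborel. \<bar>x\<bar> ^ 3 * \<nu> x)"
definition "m4 = (LINT x|lborel. x ^ 4 * \<nu> x)"

lemma nu_measurable [measurable]: "\<nu> \<in> borel_measurable borel"
  and nu_nonneg: "0 \<le> \<nu> x"
  using density unfolding levy_density_def by auto

lemma moment3: "integrable lborel (\<lambda>x. \<bar>x\<bar> ^ 3 * \<nu> x)"
proof (rule Bochner_Integration.integrable_bound)
  show "integrable lborel (\<lambda>x. x\<^sup>2 * \<nu> x + x ^ 4 * \<nu> x)" using moment2 moment4 by simp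
  have "\<bar>x\<bar> ^ 3 \<le> x\<^sup>2 + x ^ 4" for x :: real
  proof -
    have "2 * \<bar>x\<bar> \<le> 1 + x\<^sup>2"
      using zero_le_power2[of "\<bar>x\<bar> - 1"] by (simp add: power2_diff)
    then have "x\<^sup>2 * \<bar>x\<bar> \<le> x\<^sup>2 * (1 + x\<^sup>2)"
      using zero_le_power2[of x] by (intro mult_left_mono) auto
    moreover have "\<bar>x\<bar> ^ 3 = x\<^sup>2 * \<bar>x\<bar>" by (simp add: power3_eq_cube power2_eq_square)
    moreover have "x\<^sup>2 * (1 + x\<^sup>2) = x\<^sup>2 + x ^ 4" by (simp add: distrib_left flip: power_add)
    ultimately show ?thesis by simp
  qed
  from mult_right_mono[OF this nu_nonneg]
  show "AE x in lborel. norm (\<bar>x\<bar> ^ 3 * \<nu> x) \<le> norm (x\<^sup>2 * \<nu> x + x ^ 4 * \<nu> x)"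
    using nu_nonneg by (intro AE_I2) (simp add: distrib_right abs_mult)
qed measurable

lemma moments_nonneg: "0 \<le> m2" "0 \<le> m3" "0 \<le> m4"
  unfolding m2_def m3_def m4_def using nu_nonneg by (auto intro!: Bochner_Integration.integral_nonneg)

lemma h_complex_integrable: "integrable lborel (\<lambda>x. complex_of_real (x\<^sup>2 * \<nu> x))"
  using moment2 by (rule integrable_of_real)

lemma integrable_nu_bounded:
  assumes "integrable lborel w" "f \<in> borel_measurable borel" "\<And>x. cmod (f x) * \<nu> x \<le> w x"
  shows "integrable lborel (\<lambda>x. f x * complex_of_real (\<nu> x))"
  using assms(1)
  by (rule Bochner_Integration.integrable_bound)
     (use assms(2,3) nu_nonneg in \<open>auto simp: norm_mult intro!: AE_I2 order_trans[OF _ abs_ge_self]\<close>)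

lemma phi_integrable: "integrable lborel (\<lambda>x. (iexp (u * x) - 1 - \<i> * of_real (u * x)) * of_real (\<nu> x))"
proof (rule integrable_nu_bounded)
  show "integrable lborel (\<lambda>x. u\<^sup>2 / 2 * (x\<^sup>2 * \<nu> x))" using moment2 by simp
  show "cmod (iexp (u * x) - 1 - \<i> * of_real (u * x)) * \<nu> x \<le> u\<^sup>2 / 2 * (x\<^sup>2 * \<nu> x)" for x
    using mult_right_mono[OF norm_iexp_minus_affine_le[of "u * x"] nu_nonneg[of x]]
    by (simp add: power_mult_distrib)
qed measurable

lemma phi1_integrable: "integrable lborel (\<lambda>x. \<i> * of_real x * (iexp (u * x) - 1) * of_real (\<nu> x))"
proof (rule integrable_nu_bounded)
  show "integrable lborel (\<lambda>x. \<bar>u\<bar> * (x\<^sup>2 * \<nu> x))" using moment2 by simp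
  show "cmod (\<i> * of_real x * (iexp (u * x) - 1)) * \<nu> x \<le> \<bar>u\<bar> * (x\<^sup>2 * \<nu> x)" for x
  proof -
    have "cmod (\<i> * of_real x * (iexp (u * x) - 1)) * \<nu> x = \<bar>x\<bar> * (cmod (iexp (u * x) - 1) * \<nu> x)"
      by (simp add: norm_mult)
    also have "\<dots> \<le> \<bar>x\<bar> * (\<bar>u * x\<bar> * \<nu> x)"
      by (intro mult_left_mono mult_right_mono norm_iexp_minus_1_le nu_nonneg) simp
    also have "\<dots> = \<bar>u\<bar> * ((\<bar>x\<bar> * \<bar>x\<bar>) * \<nu> x)" by (simp only: abs_mult ac_simps)
    finally show ?thesis by (simp add: power2_eq_square)
  qed
qed measurable

lemma h_star_integrable: "integrable lborel (\<lambda>x. iexp (u * x) * complex_of_real (x\<^sup>2 * \<nu> x))"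
  by (rule integrable_iexp_mult[OF h_complex_integrable])

lemma phi_eq: "phi u = \<i> * of_real (u * b) + (CLINT x|lborel. (iexp (u * x) - 1 - \<i> * of_real (u * x)) * of_real (\<nu> x))"
  using no_gaussian unfolding levy_exponent_def by simp

lemma phi_0: "phi 0 = 0" and phi1_0: "phi1 0 = \<i> * of_real b" and h_star_0: "h_star 0 = of_real m2"
  unfolding phi_eq phi1_def h_star_def fourier_def m2_def by (simp_all flip: of_real_mult of_real_power)

lemma phi_deriv: "(phi has_vector_derivative phi1 u) (at u)"
proof (rule has_vector_derivative_quadratic_bound)
  fix v
  let ?t = "v - u"
  have "phi v - phi u - ?t *\<^sub>R phi1 u
     = (CLINT x|lborel. (iexp (v * x) - 1 - \<i> * of_real (v * x)) * of_real (\<nu> x)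
         - (iexp (u * x) - 1 - \<i> * of_real (u * x)) * of_real (\<nu> x)
         - of_real ?t * (\<i> * of_real x * (iexp (u * x) - 1) * of_real (\<nu> x)))"
  proof -
    define f where "f w x = (iexp (w * x) - 1 - \<i> * of_real (w * x)) * complex_of_real (\<nu> x)" for w x :: real
    define g where "g x = \<i> * of_real x * (iexp (u * x) - 1) * complex_of_real (\<nu> x)" for x :: real
    have "integrable lborel (f w)" for w using phi_integrable unfolding f_def .
    moreover have "integrable lborel g" using phi1_integrable unfolding g_def .
    ultimately have "(CLINT x|lborel. f v x - f u x - of_real ?t * g x)
        = (CLINT x|lborel. f v x) - (CLINT x|lborel. f u x) - of_real ?t * (CLINT x|lborel. g x)"
      by simp
    then show ?thesis unfolding phi_eq phi1_def f_def[symmetric] g_def[symmetric]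
      by (simp add: scaleR_conv_of_real algebra_simps)
  qed
  also have "\<dots> = (CLINT x|lborel. iexp (u * x) * (iexp (?t * x) - 1 - \<i> * of_real (?t * x)) * of_real (\<nu> x))"
  proof (intro Bochner_Integration.integral_cong refl)
    fix x
    have "iexp (v * x) = iexp (u * x) * iexp (?t * x)"
      by (simp flip: exp_add) (simp add: algebra_simps)
    then show "(iexp (v * x) - 1 - \<i> * of_real (v * x)) * of_real (\<nu> x)
         - (iexp (u * x) - 1 - \<i> * of_real (u * x)) * of_real (\<nu> x)
         - of_real ?t * (\<i> * of_real x * (iexp (u * x) - 1) * of_real (\<nu> x))
      = iexp (u * x) * (iexp (?t * x) - 1 - \<i> * of_real (?t * x)) * of_real (\<nu> x)"
      by (simp only:) (simp add: algebra_simps)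
  qed
  also have "cmod \<dots> \<le> (LINT x|lborel. ?t\<^sup>2 / 2 * (x\<^sup>2 * \<nu> x))"
  proof (rule norm_integral_le_of_norm_le)
    show "integrable lborel (\<lambda>x. ?t\<^sup>2 / 2 * (x\<^sup>2 * \<nu> x))" using moment2 by simp
    show "cmod (iexp (u * x) * (iexp (?t * x) - 1 - \<i> * of_real (?t * x)) * of_real (\<nu> x)) \<le> ?t\<^sup>2 / 2 * (x\<^sup>2 * \<nu> x)" for x
      using mult_right_mono[OF norm_iexp_minus_affine_le[of "?t * x"] nu_nonneg[of x]] nu_nonneg[of x]
      by (simp add: power_mult_distrib norm_mult)
  qed
  also have "\<dots> = m2 / 2 * ?t\<^sup>2" unfolding m2_def by simp
  finally show "cmod (phi v - phi u - ?t *\<^sub>R phi1 u) \<le> m2 / 2 * ?t\<^sup>2" .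
qed

lemma phi1_deriv: "(phi1 has_vector_derivative - h_star u) (at u)"
proof (rule has_vector_derivative_quadratic_bound)
  fix v
  let ?t = "v - u"
  have "phi1 v - phi1 u - ?t *\<^sub>R (- h_star u)
     = (CLINT x|lborel. \<i> * of_real x * (iexp (v * x) - 1) * of_real (\<nu> x)
         - \<i> * of_real x * (iexp (u * x) - 1) * of_real (\<nu> x)
         + of_real ?t * (iexp (u * x) * complex_of_real (x\<^sup>2 * \<nu> x)))"
  proof -
    define f where "f w x = \<i> * of_real x * (iexp (w * x) - 1) * complex_of_real (\<nu> x)" for w x :: real
    define g where "g x = iexp (u * x) * complex_of_real (x\<^sup>2 * \<nu> x)" for x :: real
    have "integrable lborel (f w)" for w using phi1_integrable unfolding f_def .
    moreover have "integrable lborel g" using h_star_integrable unfolding g_def .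
    ultimately have "(CLINT x|lborel. f v x - f u x + of_real ?t * g x)
        = (CLINT x|lborel. f v x) - (CLINT x|lborel. f u x) + of_real ?t * (CLINT x|lborel. g x)"
      by simp
    then show ?thesis unfolding phi1_def h_star_def fourier_def f_def[symmetric] g_def[symmetric]
      by (simp add: scaleR_conv_of_real)
  qed
  also have "\<dots> = (CLINT x|lborel. \<i> * of_real x * iexp (u * x) * (iexp (?t * x) - 1 - \<i> * of_real (?t * x)) * of_real (\<nu> x))"
  proof (intro Bochner_Integration.integral_cong refl)
    fix x
    have "iexp (v * x) = iexp (u * x) * iexp (?t * x)"
      by (simp flip: exp_add) (simp add: algebra_simps)
    then show "\<i> * of_real x * (iexp (v * x) - 1) * of_real (\<nu> x)
         - \<i> * of_real x * (iexp (u * x) - 1) * of_real (\<nu> x)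
         + of_real ?t * (iexp (u * x) * complex_of_real (x\<^sup>2 * \<nu> x))
      = \<i> * of_real x * iexp (u * x) * (iexp (?t * x) - 1 - \<i> * of_real (?t * x)) * of_real (\<nu> x)"
      by (simp only:) (simp add: algebra_simps power2_eq_square)
  qed
  also have "cmod \<dots> \<le> (LINT x|lborel. ?t\<^sup>2 / 2 * (\<bar>x\<bar> ^ 3 * \<nu> x))"
  proof (rule norm_integral_le_of_norm_le)
    show "integrable lborel (\<lambda>x. ?t\<^sup>2 / 2 * (\<bar>x\<bar> ^ 3 * \<nu> x))" using moment3 by simp
    show "cmod (\<i> * of_real x * iexp (u * x) * (iexp (?t * x) - 1 - \<i> * of_real (?t * x)) * of_real (\<nu> x)) \<le> ?t\<^sup>2 / 2 * (\<bar>x\<bar> ^ 3 * \<nu> x)" for x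
      using mult_left_mono[OF mult_right_mono[OF norm_iexp_minus_affine_le[of "?t * x"] nu_nonneg[of x]], of "\<bar>x\<bar>"] nu_nonneg[of x]
      by (simp add: power_mult_distrib norm_mult power3_eq_cube ac_simps power2_eq_square)
  qed
  also have "\<dots> = m3 / 2 * ?t\<^sup>2" unfolding m3_def by simp
  finally show "cmod (phi1 v - phi1 u - ?t *\<^sub>R (- h_star u)) \<le> m3 / 2 * ?t\<^sup>2" .
qed

text \<open>
  An upper bound of \<open>\<bar>phi1\<bar>\<close>: its value at 0 is \<open>i b\<close> and the total variation of \<open>phi1\<close> is at most the
  integral of \<open>\<bar>h_star\<bar>\<close>.
\<close>

definition "phi1_bound = \<bar>b\<bar> + (LINT u|lborel. cmod (h_star u))"

lemma phi1_bound_nonneg: "0 \<le> phi1_bound"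
  unfolding phi1_bound_def by (simp add: Bochner_Integration.integral_nonneg)

lemma h_star_lipschitz: "cmod (h_star u - h_star v) \<le> m3 * \<bar>u - v\<bar>"
proof -
  have "h_star u - h_star v = (CLINT x|lborel. iexp (u * x) * complex_of_real (x\<^sup>2 * \<nu> x) - iexp (v * x) * complex_of_real (x\<^sup>2 * \<nu> x))"
    unfolding h_star_def fourier_def
    by (rule Bochner_Integration.integral_diff[symmetric, OF h_star_integrable h_star_integrable])
  also have "cmod \<dots> \<le> (LINT x|lborel. \<bar>u - v\<bar> * (\<bar>x\<bar> ^ 3 * \<nu> x))"
  proof (rule norm_integral_le_of_norm_le)
    show "integrable lborel (\<lambda>x. \<bar>u - v\<bar> * (\<bar>x\<bar> ^ 3 * \<nu> x))" using moment3 by simp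
    fix x
    have "iexp (u * x) = iexp (v * x) * iexp ((u - v) * x)"
      by (simp flip: exp_add) (simp add: algebra_simps)
    then have "iexp (u * x) * complex_of_real (x\<^sup>2 * \<nu> x) - iexp (v * x) * complex_of_real (x\<^sup>2 * \<nu> x)
        = iexp (v * x) * (iexp ((u - v) * x) - 1) * complex_of_real (x\<^sup>2 * \<nu> x)"
      by (simp only:) (simp add: algebra_simps)
    then have "cmod (iexp (u * x) * complex_of_real (x\<^sup>2 * \<nu> x) - iexp (v * x) * complex_of_real (x\<^sup>2 * \<nu> x))
        = cmod (iexp ((u - v) * x) - 1) * (x\<^sup>2 * \<nu> x)"
      using nu_nonneg[of x] by (simp add: norm_mult norm_power)
    also have "\<dots> \<le> \<bar>(u - v) * x\<bar> * (x\<^sup>2 * \<nu> x)"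
      by (intro mult_right_mono norm_iexp_minus_1_le) (use nu_nonneg[of x] in simp)
    also have "\<dots> = \<bar>u - v\<bar> * (\<bar>x\<bar> ^ 3 * \<nu> x)"
      by (simp add: abs_mult power3_eq_cube power2_eq_square)
    finally show "cmod (iexp (u * x) * complex_of_real (x\<^sup>2 * \<nu> x) - iexp (v * x) * complex_of_real (x\<^sup>2 * \<nu> x))
        \<le> \<bar>u - v\<bar> * (\<bar>x\<bar> ^ 3 * \<nu> x)" .
  qed
  also have "\<dots> = m3 * \<bar>u - v\<bar>" unfolding m3_def by simp
  finally show ?thesis .
qed

lemma h_star_continuous: "continuous_on A h_star"
proof (rule continuous_on_subset[of UNIV], rule lipschitz_on_continuous_on[of m3])
  show "m3-lipschitz_on UNIV h_star"
    using h_star_lipschitz moments_nonneg by (auto intro!: lipschitz_onI simp: dist_norm)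
qed simp

lemma h_star_measurable [measurable]: "h_star \<in> borel_measurable borel"
  by (intro borel_measurable_continuous_onI h_star_continuous)

lemma norm_h_star_le: "cmod (h_star u) \<le> m2"
  unfolding h_star_def using norm_fourier_le[OF h_complex_integrable, of u] nu_nonneg
  by (simp add: m2_def norm_mult norm_power)

text \<open>
  The variation of \<open>phi1\<close> is the integral of its derivative \<open>- h_star\<close>. This bounds \<open>phi1\<close> even if the
  small jumps are not summable, when \<open>\<bar>h_star\<bar> \<le> m2\<close> alone would only give linear growth.
\<close>

lemma norm_phi1_diff_le: "cmod (phi1 u - phi1 0) \<le> (LINT u|lborel. cmod (h_star u))"
proof -
  have FTC: "phi1 d - phi1 c = (CLINT v|lborel. indicator {c..d} v *\<^sub>R - h_star v)" if "c \<le> d" for c d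
    using that has_vector_derivative_at_within[OF phi1_deriv] continuous_on_minus[OF h_star_continuous]
    by (intro integral_FTC_atLeastAtMost[symmetric]) auto
  have le: "cmod (CLINT v|lborel. indicator {c..d} v *\<^sub>R - h_star v) \<le> (LINT u|lborel. cmod (h_star u))" for c d
    using fourier_h_integrable
    by (intro norm_integral_le_of_norm_le) (auto simp: h_star_def indicator_def)
  show ?thesis
  proof (cases "0 \<le> u")
    case True then show ?thesis using le[of 0 u] by (simp add: FTC[OF True])
  next
    case False then show ?thesis using le[of u 0] FTC[of u 0] by (simp add: norm_minus_commute)
  qed
qed

lemma norm_phi1_le: "cmod (phi1 u) \<le> phi1_bound"
proof -
  have "cmod (phi1 u) \<le> cmod (phi1 0) + cmod (phi1 u - phi1 0)" by (rule norm_triangle_sub)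
  then show ?thesis using norm_phi1_diff_le[of u] by (simp add: phi1_0 phi1_bound_def norm_mult)
qed

lemma norm_phi_le: "cmod (phi u) \<le> phi1_bound * \<bar>u\<bar>"
proof -
  have "cmod (phi u - phi 0) \<le> phi1_bound * norm (u - 0)"
  proof (rule differentiable_bound[of UNIV])
    show "(phi has_derivative (\<lambda>h. h *\<^sub>R phi1 v)) (at v within UNIV)" for v
      using phi_deriv[of v] by (simp add: has_vector_derivative_def)
    show "onorm (\<lambda>h. h *\<^sub>R phi1 v) \<le> phi1_bound" for v
      using mult_left_mono[OF norm_phi1_le[of v] abs_ge_zero] by (intro onorm_le) (simp add: mult.commute)
  qed auto
  then show ?thesis by (simp add: phi_0)
qed

lemma norm_phi_second_difference_le: "cmod (phi u + phi (- u)) \<le> m2 * u\<^sup>2"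
proof -
  have "phi u + phi (- u) = (CLINT x|lborel. (iexp (u * x) - 1 - \<i> * of_real (u * x)) * of_real (\<nu> x)
      + (iexp (- u * x) - 1 - \<i> * of_real (- u * x)) * of_real (\<nu> x))"
    using Bochner_Integration.integral_add[OF phi_integrable[of u] phi_integrable[of "- u"]]
    unfolding phi_eq by simp
  also have "\<dots> = (CLINT x|lborel. (iexp (u * x) + iexp (- (u * x)) - 2) * of_real (\<nu> x))"
    by (intro Bochner_Integration.integral_cong refl) (simp add: algebra_simps)
  also have "cmod \<dots> \<le> (LINT x|lborel. u\<^sup>2 * (x\<^sup>2 * \<nu> x))"
  proof (rule norm_integral_le_of_norm_le)
    show "integrable lborel (\<lambda>x. u\<^sup>2 * (x\<^sup>2 * \<nu> x))" using moment2 by simp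
    show "cmod ((iexp (u * x) + iexp (- (u * x)) - 2) * of_real (\<nu> x)) \<le> u\<^sup>2 * (x\<^sup>2 * \<nu> x)" for x
      using mult_right_mono[OF norm_iexp_second_difference_le[of "u * x"] nu_nonneg[of x]] nu_nonneg[of x]
      by (simp add: norm_mult power_mult_distrib)
  qed
  also have "\<dots> = m2 * u\<^sup>2" unfolding m2_def by simp
  finally show ?thesis .
qed

lemma norm_phi1_lipschitz_0: "cmod (phi1 u - phi1 0) \<le> m2 * \<bar>u\<bar>"
proof -
  have "cmod (phi1 u - phi1 0) \<le> m2 * norm (u - 0)"
  proof (rule differentiable_bound[of UNIV])
    show "(phi1 has_derivative (\<lambda>h. h *\<^sub>R - h_star v)) (at v within UNIV)" for v
      using phi1_deriv[of v] by (simp add: has_vector_derivative_def)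
    show "onorm (\<lambda>h. h *\<^sub>R - h_star v) \<le> m2" for v
      using mult_left_mono[OF norm_h_star_le[of v] abs_ge_zero] by (intro onorm_le) (simp add: mult.commute)
  qed auto
  then show ?thesis by simp
qed

lemma norm_phi1_second_difference_le: "cmod (phi1 u + phi1 (- u) - 2 * phi1 0) \<le> m3 * u\<^sup>2"
proof -
  have "phi1 u + phi1 (- u) - 2 * phi1 0 = (CLINT x|lborel. \<i> * of_real x * (iexp (u * x) - 1) * of_real (\<nu> x)
      + \<i> * of_real x * (iexp (- u * x) - 1) * of_real (\<nu> x))"
    using Bochner_Integration.integral_add[OF phi1_integrable[of u] phi1_integrable[of "- u"]]
    unfolding phi1_0 phi1_def by simp
  also have "\<dots> = (CLINT x|lborel. \<i> * of_real x * (iexp (u * x) + iexp (- (u * x)) - 2) * of_real (\<nu> x))"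
    by (intro Bochner_Integration.integral_cong refl) (simp add: algebra_simps)
  also have "cmod \<dots> \<le> (LINT x|lborel. u\<^sup>2 * (\<bar>x\<bar> ^ 3 * \<nu> x))"
  proof (rule norm_integral_le_of_norm_le)
    show "integrable lborel (\<lambda>x. u\<^sup>2 * (\<bar>x\<bar> ^ 3 * \<nu> x))" using moment3 by simp
    fix x
    have "cmod (\<i> * of_real x * (iexp (u * x) + iexp (- (u * x)) - 2) * of_real (\<nu> x))
       = \<bar>x\<bar> * (cmod (iexp (u * x) + iexp (- (u * x)) - 2) * \<nu> x)"
      using nu_nonneg[of x] by (simp add: norm_mult)
    also have "\<dots> \<le> \<bar>x\<bar> * ((u * x)\<^sup>2 * \<nu> x)"
      using norm_iexp_second_difference_le[of "u * x"]
      by (intro mult_left_mono mult_right_mono nu_nonneg) simp_all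
    also have "\<dots> = u\<^sup>2 * ((\<bar>x\<bar> * \<bar>x\<bar>\<^sup>2) * \<nu> x)" by (simp only: power2_abs power_mult_distrib ac_simps)
    finally show "cmod (\<i> * of_real x * (iexp (u * x) + iexp (- (u * x)) - 2) * of_real (\<nu> x)) \<le> u\<^sup>2 * (\<bar>x\<bar> ^ 3 * \<nu> x)"
      by (simp add: power3_eq_cube power2_eq_square mult.assoc)
  qed
  also have "\<dots> = m3 * u\<^sup>2" unfolding m3_def by simp
  finally show ?thesis .
qed

lemma norm_h_star_second_difference_le: "cmod (h_star u + h_star (- u) - 2 * h_star 0) \<le> m4 * u\<^sup>2"
proof -
  have "h_star u + h_star (- u) - 2 * h_star 0 = (CLINT x|lborel. iexp (u * x) * complex_of_real (x\<^sup>2 * \<nu> x)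
      + iexp (- u * x) * complex_of_real (x\<^sup>2 * \<nu> x) - 2 * (iexp (0 * x) * complex_of_real (x\<^sup>2 * \<nu> x)))"
  proof -
    define f where "f w x = iexp (w * x) * complex_of_real (x\<^sup>2 * \<nu> x)" for w x :: real
    have f: "integrable lborel (f w)" for w using h_star_integrable unfolding f_def .
    have "(CLINT x|lborel. f u x + f (- u) x - 2 * f 0 x)
        = (CLINT x|lborel. f u x) + (CLINT x|lborel. f (- u) x) - 2 * (CLINT x|lborel. f 0 x)"
      using f[of u] f[of "- u"] f[of 0] by simp
    then show ?thesis unfolding h_star_def fourier_def f_def by simp
  qed
  also have "\<dots> = (CLINT x|lborel. (iexp (u * x) + iexp (- (u * x)) - 2) * complex_of_real (x\<^sup>2 * \<nu> x))"
    by (intro Bochner_Integration.integral_cong refl) (simp add: algebra_simps)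
  also have "cmod \<dots> \<le> (LINT x|lborel. u\<^sup>2 * (x ^ 4 * \<nu> x))"
  proof (rule norm_integral_le_of_norm_le)
    show "integrable lborel (\<lambda>x. u\<^sup>2 * (x ^ 4 * \<nu> x))" using moment4 by simp
    fix x
    have "cmod ((iexp (u * x) + iexp (- (u * x)) - 2) * complex_of_real (x\<^sup>2 * \<nu> x))
       = cmod (iexp (u * x) + iexp (- (u * x)) - 2) * (x\<^sup>2 * \<nu> x)"
      using nu_nonneg[of x] by (simp add: norm_mult norm_power)
    also have "\<dots> \<le> (u * x)\<^sup>2 * (x\<^sup>2 * \<nu> x)"
      using norm_iexp_second_difference_le[of "u * x"] nu_nonneg[of x]
      by (intro mult_right_mono) simp_all
    also have "\<dots> = u\<^sup>2 * ((x\<^sup>2 * x\<^sup>2) * \<nu> x)" by (simp only: power_mult_distrib ac_simps)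
    finally show "cmod ((iexp (u * x) + iexp (- (u * x)) - 2) * complex_of_real (x\<^sup>2 * \<nu> x)) \<le> u\<^sup>2 * (x ^ 4 * \<nu> x)"
      by (simp flip: power_add)
  qed
  also have "\<dots> = m4 * u\<^sup>2" unfolding m4_def by simp
  finally show ?thesis .
qed

end

section \<open>The law of an increment and its moments\<close>

text \<open>
  As \<open>u\<close> tends to 0, \<open>(2 - 2 cos (u x)) / u\<^sup>2\<close> tends to \<open>x\<^sup>2\<close>. By Fatou's lemma, a quadratic bound at 0 on a
  second difference of a characteristic function yields finiteness of a moment, together with a bound.
\<close>

lemma second_moment_le_of_cosine_bound:
  fixes w :: "real \<Rightarrow> real"
  assumes sets: "sets M = sets borel" and [measurable]: "w \<in> borel_measurable borel" and w: "\<And>x. 0 \<le> w x"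
    and bound: "\<And>u. 0 < u \<Longrightarrow> u \<le> 1 \<Longrightarrow> (\<integral>\<^sup>+x. ennreal (w x * (2 - 2 * cos (u * x))) \<partial>M) \<le> ennreal (K * u\<^sup>2)"
  shows "(\<integral>\<^sup>+x. ennreal (w x * x\<^sup>2) \<partial>M) \<le> ennreal K"
proof -
  have [measurable_cong]: "sets M = sets borel" by (fact sets)
  define u where "u n = inverse (real (Suc n))" for n
  have u: "0 < u n" "u n \<le> 1" for n unfolding u_def by (auto simp: field_simps)
  have lim: "(\<lambda>n. (2 - 2 * cos (u n * x)) / (u n)\<^sup>2) \<longlonglongrightarrow> x\<^sup>2" for x
  proof (rule LIM_zero_cancel, rule Lim_null_comparison)
    show "\<forall>\<^sub>F n in sequentially. norm ((2 - 2 * cos (u n * x)) / (u n)\<^sup>2 - x\<^sup>2) \<le> \<bar>x\<bar> ^ 3 * u n"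
    proof (intro always_eventually allI)
      fix n
      let ?y = "u n * x"
      have "\<bar>cos ?y - 1 + ?y\<^sup>2 / 2\<bar> = \<bar>Re (iexp ?y - (\<Sum>k\<le>2. (\<i> * ?y) ^ k / fact k))\<bar>"
        by (simp add: Re_exp numeral_2_eq_2 power2_eq_square)
      also have "\<dots> \<le> cmod (iexp ?y - (\<Sum>k\<le>2. (\<i> * ?y) ^ k / fact k))" by (rule abs_Re_le_cmod)
      also have "\<dots> \<le> \<bar>?y\<bar> ^ 3 / 6"
        using iexp_approx1[of ?y 2] by (simp add: fact_numeral eval_nat_numeral)
      finally have A: "\<bar>cos ?y - 1 + ?y\<^sup>2 / 2\<bar> \<le> \<bar>?y\<bar> ^ 3 / 6" .
      have "(2 - 2 * cos ?y) / (u n)\<^sup>2 - x\<^sup>2 = - 2 * (cos ?y - 1 + ?y\<^sup>2 / 2) / (u n)\<^sup>2"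
        using u(1)[of n] by (simp add: field_simps)
      then have "norm ((2 - 2 * cos ?y) / (u n)\<^sup>2 - x\<^sup>2) = 2 * \<bar>cos ?y - 1 + ?y\<^sup>2 / 2\<bar> / (u n)\<^sup>2"
        by (simp only: real_norm_def abs_divide abs_mult abs_neg_numeral abs_numeral abs_power2)
      also have "\<dots> \<le> 2 * (\<bar>?y\<bar> ^ 3 / 6) / (u n)\<^sup>2" using A by (intro divide_right_mono mult_left_mono) auto
      also have "\<dots> = \<bar>x\<bar> ^ 3 * u n / 3"
        using u(1)[of n] by (simp add: abs_mult power_mult_distrib power3_eq_cube power2_eq_square)
      also have "\<dots> \<le> \<bar>x\<bar> ^ 3 * u n" using u(1)[of n] by simp
      finally show "norm ((2 - 2 * cos ?y) / (u n)\<^sup>2 - x\<^sup>2) \<le> \<bar>x\<bar> ^ 3 * u n" .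
    qed
    have "(\<lambda>n. \<bar>x\<bar> ^ 3 * u n) \<longlonglongrightarrow> \<bar>x\<bar> ^ 3 * 0"
      unfolding u_def by (intro tendsto_intros LIMSEQ_inverse_real_of_nat)
    then show "(\<lambda>n. \<bar>x\<bar> ^ 3 * u n) \<longlonglongrightarrow> 0" by simp
  qed
  have "(\<integral>\<^sup>+x. ennreal (w x * x\<^sup>2) \<partial>M) = (\<integral>\<^sup>+x. liminf (\<lambda>n. ennreal (w x * ((2 - 2 * cos (u n * x)) / (u n)\<^sup>2))) \<partial>M)"
    by (intro nn_integral_cong lim_imp_Liminf[symmetric] tendsto_intros lim) auto
  also have "\<dots> \<le> liminf (\<lambda>n. \<integral>\<^sup>+x. ennreal (w x * ((2 - 2 * cos (u n * x)) / (u n)\<^sup>2)) \<partial>M)"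
    by (intro nn_integral_liminf) measurable
  also have "\<dots> \<le> ennreal K"
  proof (rule Liminf_le, simp, intro always_eventually allI)
    fix n
    have "(\<integral>\<^sup>+x. ennreal (w x * ((2 - 2 * cos (u n * x)) / (u n)\<^sup>2)) \<partial>M)
      = (\<integral>\<^sup>+x. ennreal (1 / (u n)\<^sup>2) * ennreal (w x * (2 - 2 * cos (u n * x))) \<partial>M)"
      using w by (intro nn_integral_cong) (simp add: ennreal_mult'[symmetric])
    also have "\<dots> = ennreal (1 / (u n)\<^sup>2) * (\<integral>\<^sup>+x. ennreal (w x * (2 - 2 * cos (u n * x))) \<partial>M)"
      by (intro nn_integral_cmult) measurable
    also have "\<dots> \<le> ennreal (1 / (u n)\<^sup>2) * ennreal (K * (u n)\<^sup>2)"
      using u by (intro mult_left_mono bound) auto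
    also have "\<dots> = ennreal K" using u(1)[of n] by (simp add: ennreal_mult'[symmetric])
    finally show "(\<integral>\<^sup>+x. ennreal (w x * ((2 - 2 * cos (u n * x)) / (u n)\<^sup>2)) \<partial>M) \<le> ennreal K" .
  qed
  finally show ?thesis .
qed

text \<open>
  Dominated convergence: the difference quotient minus its limit is at most \<open>2 \<bar>x f(x)\<bar>\<close>.
\<close>

lemma has_vector_derivative_fourier_integral:
  fixes f :: "real \<Rightarrow> complex"
  assumes sets: "sets M = sets borel" and f: "integrable M f" and xf: "integrable M (\<lambda>x. of_real x * f x)"
  shows "((\<lambda>u. CLINT x|M. iexp (u * x) * f x) has_vector_derivative (CLINT x|M. iexp (u * x) * (\<i> * of_real x * f x))) (at u)"
  unfolding has_vector_derivative_def has_derivative_at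
proof (intro conjI bounded_linear_intros)
  have [measurable_cong]: "sets M = sets borel" by (fact sets)
  have [measurable]: "f \<in> borel_measurable M" using f by auto
  let ?F = "\<lambda>u. CLINT x|M. iexp (u * x) * f x"
  let ?D = "CLINT x|M. iexp (u * x) * (\<i> * of_real x * f x)"
  have int_F: "integrable M (\<lambda>x. iexp (v * x) * f x)" for v
    by (rule Bochner_Integration.integrable_bound[OF integrable_norm[OF f]]) (auto simp: norm_mult)
  have int_D: "integrable M (\<lambda>x. iexp (u * x) * (\<i> * of_real x * f x))"
    by (rule Bochner_Integration.integrable_bound[OF integrable_norm[OF xf]]) (auto simp: norm_mult)
  define g where "g h x = (iexp (h * x) - 1 - \<i> * of_real (h * x)) / of_real h * (iexp (u * x) * f x)" for h x :: real
  have quotient: "norm (?F (u + h) - ?F u - h *\<^sub>R ?D) / norm h = norm (CLINT x|M. g h x)" if "h \<noteq> 0" for h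
  proof -
    have "?F (u + h) - ?F u - h *\<^sub>R ?D
        = (CLINT x|M. iexp ((u + h) * x) * f x - iexp (u * x) * f x - of_real h * (iexp (u * x) * (\<i> * of_real x * f x)))"
    proof -
      define F where "F v x = iexp (v * x) * f x" for v x
      define D where "D x = iexp (u * x) * (\<i> * of_real x * f x)" for x
      have "integrable M (F v)" for v using int_F unfolding F_def .
      moreover have "integrable M D" using int_D unfolding D_def .
      ultimately have "(CLINT x|M. F (u + h) x - F u x - of_real h * D x) = integral\<^sup>L M (F (u + h)) - integral\<^sup>L M (F u) - of_real h * integral\<^sup>L M D"
        by simp
      then show ?thesis unfolding F_def D_def by (simp add: scaleR_conv_of_real)
    qed
    also have "\<dots> = (CLINT x|M. of_real h * g h x)"
    proof (intro Bochner_Integration.integral_cong refl)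
      fix x
      have e: "iexp ((u + h) * x) = iexp (u * x) * iexp (h * x)"
        by (simp flip: exp_add) (simp add: algebra_simps)
      show "iexp ((u + h) * x) * f x - iexp (u * x) * f x - of_real h * (iexp (u * x) * (\<i> * of_real x * f x)) = of_real h * g h x"
        unfolding g_def e using that by (simp add: field_simps)
    qed
    also have "\<dots> = of_real h * (CLINT x|M. g h x)" by simp
    finally show ?thesis using that by (simp add: norm_mult)
  qed
  show "(\<lambda>h. norm (?F (u + h) - ?F u - h *\<^sub>R ?D) / norm h) \<midarrow>0\<rightarrow> 0"
    unfolding tendsto_at_iff_sequentially comp_def
  proof (intro allI impI)
    fix X :: "nat \<Rightarrow> real" assume X: "\<forall>i. X i \<in> UNIV - {0}" "X \<longlonglongrightarrow> 0"
    have "(\<lambda>i. CLINT x|M. g (X i) x) \<longlonglongrightarrow> (CLINT x|M. 0)"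
    proof (rule integral_dominated_convergence[where w="\<lambda>x. 2 * cmod (of_real x * f x)"])
      show "integrable M (\<lambda>x. 2 * cmod (complex_of_real x * f x))" using xf by simp
      show "AE x in M. (\<lambda>i. g (X i) x) \<longlonglongrightarrow> 0"
      proof (intro AE_I2, rule Lim_null_comparison)
        fix x
        show "\<forall>\<^sub>F i in sequentially. norm (g (X i) x) \<le> \<bar>X i\<bar> * (x\<^sup>2 / 2 * cmod (f x))"
        proof (intro always_eventually allI)
          fix i
          have "norm (g (X i) x) = cmod (iexp (X i * x) - 1 - \<i> * of_real (X i * x)) / \<bar>X i\<bar> * cmod (f x)"
            by (simp add: g_def norm_mult norm_divide)
          also have "\<dots> \<le> (X i * x)\<^sup>2 / 2 / \<bar>X i\<bar> * cmod (f x)"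
            by (intro mult_right_mono divide_right_mono norm_iexp_minus_affine_le) auto
          also have "(X i * x)\<^sup>2 / 2 / \<bar>X i\<bar> = \<bar>X i\<bar> * (x\<^sup>2 / 2)"
            using X(1) by (simp add: power_mult_distrib field_simps power2_eq_square)
          finally show "norm (g (X i) x) \<le> \<bar>X i\<bar> * (x\<^sup>2 / 2 * cmod (f x))" by (simp only: mult.assoc)
        qed
        show "(\<lambda>i. \<bar>X i\<bar> * (x\<^sup>2 / 2 * cmod (f x))) \<longlonglongrightarrow> 0"
          using X(2) by (auto intro!: tendsto_eq_intros)
      qed
      show "AE x in M. norm (g (X i) x) \<le> 2 * cmod (complex_of_real x * f x)" for i
      proof (intro AE_I2)
        fix x
        have "cmod (iexp (X i * x) - 1 - \<i> * of_real (X i * x)) \<le> cmod (iexp (X i * x) - 1) + cmod (\<i> * of_real (X i * x))"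
          by (rule norm_triangle_ineq4)
        also have "\<dots> \<le> \<bar>X i * x\<bar> + \<bar>X i * x\<bar>"
          using norm_iexp_minus_1_le[of "X i * x"] by (simp add: norm_mult abs_mult mult.commute)
        finally have "cmod (iexp (X i * x) - 1 - \<i> * of_real (X i * x)) / \<bar>X i\<bar> * cmod (f x) \<le> (2 * \<bar>X i * x\<bar>) / \<bar>X i\<bar> * cmod (f x)"
          by (intro mult_right_mono divide_right_mono) auto
        then show "norm (g (X i) x) \<le> 2 * cmod (complex_of_real x * f x)"
          using X(1) by (simp add: g_def norm_mult norm_divide abs_mult)
      qed
    qed (simp_all add: g_def)
    then have "(\<lambda>i. norm (CLINT x|M. g (X i) x)) \<longlonglongrightarrow> 0" by (simp add: tendsto_norm_zero)
    then show "(\<lambda>i. norm (?F (u + X i) - ?F u - X i *\<^sub>R ?D) / norm (X i)) \<longlonglongrightarrow> 0"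
      using X(1) quotient by simp
  qed
qed

text \<open>
  One constant controls size, first and second differences at 0. With all three, the property is
  stable under products: the second difference of \<open>F G\<close> involves the first differences of both factors.
\<close>

definition "second_order_bounded F K \<longleftrightarrow>
  (\<forall>u. \<bar>u\<bar> \<le> 1 \<longrightarrow> cmod (F u) \<le> K \<and> cmod (F u - F 0) \<le> K * \<bar>u\<bar> \<and> cmod (F u + F (- u) - 2 * F 0) \<le> K * u\<^sup>2)"
  for F :: "real \<Rightarrow> complex" and K :: real

lemma second_order_boundedI:
  assumes "\<And>u. \<bar>u\<bar> \<le> 1 \<Longrightarrow> cmod (F u) \<le> A" "\<And>u. \<bar>u\<bar> \<le> 1 \<Longrightarrow> cmod (F u - F 0) \<le> B * \<bar>u\<bar>"
    "\<And>u. \<bar>u\<bar> \<le> 1 \<Longrightarrow> cmod (F u + F (- u) - 2 * F 0) \<le> C * u\<^sup>2" "A \<le> K" "B \<le> K" "C \<le> K"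
  shows "second_order_bounded F K"
  unfolding second_order_bounded_def
  using assms by (meson abs_ge_zero mult_right_mono order_trans zero_le_power2)

lemma second_order_bounded_add:
  assumes "second_order_bounded F K" "second_order_bounded G K'"
  shows "second_order_bounded (\<lambda>u. F u + G u) (K + K')"
  unfolding second_order_bounded_def
proof (intro allI impI conjI)
  fix u :: real assume u: "\<bar>u\<bar> \<le> 1"
  note F = assms(1)[unfolded second_order_bounded_def, rule_format, OF u]
  note G = assms(2)[unfolded second_order_bounded_def, rule_format, OF u]
  show "cmod (F u + G u) \<le> K + K'" using F G by (intro norm_triangle_mono) auto
  have "cmod ((F u - F 0) + (G u - G 0)) \<le> K * \<bar>u\<bar> + K' * \<bar>u\<bar>" using F G by (intro norm_triangle_mono) auto
  then show "cmod (F u + G u - (F 0 + G 0)) \<le> (K + K') * \<bar>u\<bar>" by (simp add: algebra_simps)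
  have "cmod ((F u + F (- u) - 2 * F 0) + (G u + G (- u) - 2 * G 0)) \<le> K * u\<^sup>2 + K' * u\<^sup>2"
    using F G by (intro norm_triangle_mono) auto
  then show "cmod (F u + G u + (F (- u) + G (- u)) - 2 * (F 0 + G 0)) \<le> (K + K') * u\<^sup>2" by (simp add: algebra_simps)
qed

lemma second_order_bounded_scale:
  assumes "second_order_bounded F K"
  shows "second_order_bounded (\<lambda>u. c * F u) (cmod c * K)"
  unfolding second_order_bounded_def
proof (intro allI impI conjI)
  fix u :: real assume u: "\<bar>u\<bar> \<le> 1"
  note F = assms(1)[unfolded second_order_bounded_def, rule_format, OF u]
  show "cmod (c * F u) \<le> cmod c * K" using F by (simp add: norm_mult mult_left_mono)
  have "cmod (c * (F u - F 0)) \<le> cmod c * (K * \<bar>u\<bar>)" using F by (simp only: norm_mult mult_left_mono norm_ge_zero)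
  then show "cmod (c * F u - c * F 0) \<le> cmod c * K * \<bar>u\<bar>" by (simp add: algebra_simps)
  have "cmod (c * (F u + F (- u) - 2 * F 0)) \<le> cmod c * (K * u\<^sup>2)"
    using F by (simp only: norm_mult mult_left_mono norm_ge_zero)
  then show "cmod (c * F u + c * F (- u) - 2 * (c * F 0)) \<le> cmod c * K * u\<^sup>2" by (simp add: algebra_simps)
qed

lemma second_order_bounded_mult:
  assumes F: "second_order_bounded F K" and G: "second_order_bounded G K'"
  shows "second_order_bounded (\<lambda>u. F u * G u) (4 * K * K')"
  unfolding second_order_bounded_def
proof (intro allI impI conjI)
  fix u :: real assume u: "\<bar>u\<bar> \<le> 1"
  then have mu: "\<bar>- u\<bar> \<le> 1" by simp
  have z: "\<bar>0 :: real\<bar> \<le> 1" by simp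
  note F0 = F[unfolded second_order_bounded_def, rule_format, OF z]
  note G0 = G[unfolded second_order_bounded_def, rule_format, OF z]
  note F1 = F[unfolded second_order_bounded_def, rule_format, OF u]
  note G1 = G[unfolded second_order_bounded_def, rule_format, OF u]
  note F2 = F[unfolded second_order_bounded_def, rule_format, OF mu]
  note G2 = G[unfolded second_order_bounded_def, rule_format, OF mu]
  have K: "0 \<le> K" "0 \<le> K'" using F0 G0 norm_ge_zero[of "F 0"] norm_ge_zero[of "G 0"] by linarith+
  have KK: "0 \<le> K * K'" using K by simp
  have "cmod (F u * G u) \<le> K * K'" using F1 G1 K by (simp add: norm_mult mult_mono)
  then show "cmod (F u * G u) \<le> 4 * K * K'" using KK by simp
  have "F u * G u - F 0 * G 0 = (F u - F 0) * G u + F 0 * (G u - G 0)" by (simp add: algebra_simps)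
  also have "cmod \<dots> \<le> (K * \<bar>u\<bar>) * K' + K * (K' * \<bar>u\<bar>)"
    using F0 F1 G1 K by (intro norm_triangle_mono) (auto simp: norm_mult intro!: mult_mono)
  also have "\<dots> \<le> 4 * K * K' * \<bar>u\<bar>" using mult_right_mono[OF KK, of "\<bar>u\<bar>"] by (simp add: algebra_simps)
  finally show "cmod (F u * G u - F 0 * G 0) \<le> 4 * K * K' * \<bar>u\<bar>" .
  have "F u * G u + F (- u) * G (- u) - 2 * (F 0 * G 0)
    = (F 0 * (G u + G (- u) - 2 * G 0) + (F u + F (- u) - 2 * F 0) * G 0)
      + ((F u - F 0) * (G u - G 0) + (F (- u) - F 0) * (G (- u) - G 0))" by (simp add: algebra_simps)
  also have "cmod \<dots> \<le> (K * (K' * u\<^sup>2) + (K * u\<^sup>2) * K') + ((K * \<bar>u\<bar>) * (K' * \<bar>u\<bar>) + (K * \<bar>- u\<bar>) * (K' * \<bar>- u\<bar>))"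
    using F0 G0 F1 G1 F2 G2 K
    by (intro norm_triangle_mono) (auto simp: norm_mult intro!: mult_mono)
  also have "\<dots> = 4 * K * K' * u\<^sup>2" by (simp add: power2_eq_square flip: abs_mult)
  finally show "cmod (F u * G u + F (- u) * G (- u) - 2 * (F 0 * G 0)) \<le> 4 * K * K' * u\<^sup>2" .
qed

text \<open>
  The constants of the bounds below belong to the exponent only, so they are uniform in the
  sampling step \<open>\<Delta> \<le> 1\<close>.
\<close>

locale levy_increment_law = square_integrable_levy_exponent b \<sigma> \<nu> + real_distribution \<mu>
  for b \<sigma> :: real and \<nu> :: "real \<Rightarrow> real" and \<mu> :: "real measure" +
  fixes \<Delta> :: real
  assumes \<Delta>: "0 < \<Delta>" "\<Delta> \<le> 1"
    and char_eq: "char \<mu> u = exp (of_real \<Delta> * phi u)"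
begin

definition "psi1 u = (CLINT x|\<mu>. \<i> * of_real x * iexp (u * x))"
definition "psi2 u = (CLINT x|\<mu>. (\<i> * of_real x)\<^sup>2 * iexp (u * x))"

text \<open>
  For \<open>\<bar>\<Delta> \<phi>(u)\<bar> \<le> 1\<close> this is the Taylor estimate of \<open>exp\<close>; for larger values it follows from
  \<open>\<bar>\<psi>\<bar> \<le> 1\<close>. The bound is used at frequencies up to \<open>\<pi> m\<close>, where \<open>\<Delta> \<phi>\<close> may be large.
\<close>

lemma norm_char_minus_1_le: "cmod (char \<mu> u - 1) \<le> 3 * \<Delta> * phi1_bound * \<bar>u\<bar>"
proof -
  define z where "z = complex_of_real \<Delta> * phi u"
  have nz: "cmod z \<le> \<Delta> * phi1_bound * \<bar>u\<bar>"
    using \<Delta> mult_left_mono[OF norm_phi_le[of u], of \<Delta>] by (simp add: z_def norm_mult)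
  have "cmod (char \<mu> u - 1) \<le> 3 * cmod z"
  proof (cases "cmod z \<le> 1")
    case True
    have "cmod (exp z - 1) \<le> exp \<bar>Re z\<bar> * cmod z" using Taylor_exp[of z 0] by simp
    also have "\<dots> \<le> 3 * cmod z"
      using True abs_Re_le_cmod[of z] exp_le by (intro mult_right_mono order_trans[OF _ exp_le]) auto
    finally show ?thesis by (simp add: char_eq z_def)
  next
    case False
    have "cmod (char \<mu> u - 1) \<le> cmod (char \<mu> u) + cmod 1" by (rule norm_triangle_ineq4)
    then show ?thesis using cmod_char_le_1[of u] False by simp
  qed
  then show ?thesis using nz by simp
qed

lemma integral_one_minus_cos: "(\<integral>\<^sup>+x. ennreal (2 - 2 * cos (u * x)) \<partial>\<mu>) = ennreal (Re (2 - char \<mu> u - char \<mu> (- u)))"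
proof -
  have int: "integrable \<mu> (\<lambda>x. iexp (v * x))" for v
    by (rule integrable_const_bound[where B=1]) auto
  have "integrable \<mu> (\<lambda>x. cos (u * x))" by (rule integrable_const_bound[where B=1]) auto
  then have c: "integrable \<mu> (\<lambda>x. 2 - 2 * cos (u * x))" by simp
  have "Re (char \<mu> v) = (LINT x|\<mu>. cos (v * x))" for v
    unfolding char_def integral_Re[OF int, symmetric] by (simp add: Re_exp)
  then have "Re (2 - char \<mu> u - char \<mu> (- u)) = 2 - 2 * (LINT x|\<mu>. cos (u * x))" by simp
  also have "\<dots> = (LINT x|\<mu>. 2 - 2 * cos (u * x))"
    using \<open>integrable \<mu> (\<lambda>x. cos (u * x))\<close> by (simp del: space_eq_univ add: prob_space)
  finally show ?thesis using c by (simp add: nn_integral_eq_integral)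
qed

text \<open>
  The constant is not of order \<open>\<Delta>\<close>. The estimate only serves to establish that the second moment is
  finite; its value then follows from \<open>\<psi>''(0)\<close>.
\<close>

lemma norm_second_difference_char_crude:
  assumes "\<bar>u\<bar> \<le> 1"
  shows "cmod (2 - char \<mu> u - char \<mu> (- u)) \<le> (m2 + 2 * exp phi1_bound * phi1_bound\<^sup>2) * u\<^sup>2"
proof -
  define z where "z v = complex_of_real \<Delta> * phi v" for v
  have z: "cmod (z v) \<le> phi1_bound * \<bar>v\<bar>" for v
  proof -
    have "cmod (z v) \<le> 1 * (phi1_bound * \<bar>v\<bar>)"
      unfolding z_def norm_mult using \<Delta> norm_phi_le[of v] by (intro mult_mono) auto
    then show ?thesis by simp
  qed
  have t: "cmod (exp (z v) - 1 - z v) \<le> exp phi1_bound * phi1_bound\<^sup>2 * u\<^sup>2" if "\<bar>v\<bar> = \<bar>u\<bar>" for v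
  proof -
    have "phi1_bound * \<bar>v\<bar> \<le> phi1_bound" using assms that phi1_bound_nonneg by (simp add: mult_left_le)
    then have "\<bar>Re (z v)\<bar> \<le> phi1_bound" using z[of v] abs_Re_le_cmod[of "z v"] by linarith
    moreover have "(cmod (z v))\<^sup>2 \<le> (phi1_bound * \<bar>v\<bar>)\<^sup>2" by (intro power_mono z) simp
    moreover have "(phi1_bound * \<bar>v\<bar>)\<^sup>2 = phi1_bound\<^sup>2 * u\<^sup>2" using that by (simp add: power_mult_distrib)
    ultimately have "exp \<bar>Re (z v)\<bar> * (cmod (z v))\<^sup>2 \<le> exp phi1_bound * (phi1_bound\<^sup>2 * u\<^sup>2)" by (intro mult_mono) auto
    moreover have "cmod (exp (z v) - 1 - z v) \<le> exp \<bar>Re (z v)\<bar> * (cmod (z v))\<^sup>2"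
      using Taylor_exp[of "z v" 1] by (simp add: power2_eq_square diff_diff_eq)
    ultimately show ?thesis by simp
  qed
  have d: "cmod (of_real \<Delta> * (phi u + phi (- u))) \<le> 1 * (m2 * u\<^sup>2)"
    unfolding norm_mult using \<Delta> norm_phi_second_difference_le[of u] by (intro mult_mono) auto
  have "2 - char \<mu> u - char \<mu> (- u) = - ((exp (z u) - 1 - z u) + (exp (z (- u)) - 1 - z (- u)) + of_real \<Delta> * (phi u + phi (- u)))"
    by (simp add: char_eq z_def algebra_simps)
  also have "cmod \<dots> \<le> exp phi1_bound * phi1_bound\<^sup>2 * u\<^sup>2 + exp phi1_bound * phi1_bound\<^sup>2 * u\<^sup>2 + 1 * (m2 * u\<^sup>2)"
    unfolding norm_minus_cancel using d t[of u] t[of "- u"]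
    by (intro norm_triangle_mono) auto
  finally show ?thesis by (simp add: algebra_simps)
qed

lemma integrable_square: "integrable \<mu> (\<lambda>x. x\<^sup>2)"
proof -
  have "(\<integral>\<^sup>+x. ennreal (1 * x\<^sup>2) \<partial>\<mu>) \<le> ennreal (m2 + 2 * exp phi1_bound * phi1_bound\<^sup>2)"
  proof (rule second_moment_le_of_cosine_bound)
    fix u :: real assume "0 < u" "u \<le> 1"
    then show "(\<integral>\<^sup>+x. ennreal (1 * (2 - 2 * cos (u * x))) \<partial>\<mu>) \<le> ennreal ((m2 + 2 * exp phi1_bound * phi1_bound\<^sup>2) * u\<^sup>2)"
      using norm_second_difference_char_crude[of u] complex_Re_le_cmod[of "2 - char \<mu> u - char \<mu> (- u)"]
      by (simp only: mult_1 integral_one_minus_cos) (intro ennreal_leI, simp)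
  qed (auto simp: events_eq_borel)
  then show ?thesis
    by (intro integrableI_bounded) (auto simp: le_less_trans[OF _ ennreal_less_top])
qed

lemma integrable_first: "integrable \<mu> (\<lambda>x. x)"
  by (rule square_integrable_imp_integrable[OF _ integrable_square]) simp

lemma char_deriv: "(char \<mu> has_vector_derivative psi1 u) (at u)"
proof -
  have "((\<lambda>u. CLINT x|\<mu>. iexp (u * x) * 1) has_vector_derivative (CLINT x|\<mu>. iexp (u * x) * (\<i> * of_real x * 1))) (at u)"
    using integrable_first by (intro has_vector_derivative_fourier_integral) (auto simp: events_eq_borel)
  then show ?thesis by (simp add: char_def[abs_def] psi1_def mult.commute)
qed

lemma psi1_deriv: "(psi1 has_vector_derivative psi2 u) (at u)"
proof -
  have x2: "integrable \<mu> (\<lambda>x. of_real x * (\<i> * complex_of_real x))"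
    using integrable_mult_right[OF integrable_of_real[OF integrable_square, where 'a=complex], of \<i>]
    by (simp add: power2_eq_square ac_simps)
  have "((\<lambda>u. CLINT x|\<mu>. iexp (u * x) * (\<i> * of_real x)) has_vector_derivative (CLINT x|\<mu>. iexp (u * x) * (\<i> * of_real x * (\<i> * of_real x)))) (at u)"
    using integrable_first x2 by (intro has_vector_derivative_fourier_integral) (auto simp: events_eq_borel)
  then show ?thesis by (simp add: psi1_def[abs_def] psi2_def power2_eq_square mult.commute)
qed

lemma psi1_eq: "psi1 u = of_real \<Delta> * phi1 u * char \<mu> u"
proof (rule vector_derivative_unique_at[OF char_deriv])
  have "((exp \<circ> (\<lambda>u. of_real \<Delta> * phi u)) has_vector_derivative (of_real \<Delta> * phi1 u) * exp (of_real \<Delta> * phi u)) (at u)"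
    by (intro field_vector_diff_chain_at has_vector_derivative_mult_right phi_deriv DERIV_exp)
  then show "(char \<mu> has_vector_derivative of_real \<Delta> * phi1 u * char \<mu> u) (at u)"
    by (simp add: comp_def char_eq[abs_def])
qed

lemma psi2_eq: "psi2 u = of_real \<Delta> * (- h_star u + of_real \<Delta> * (phi1 u * phi1 u)) * char \<mu> u"
proof (rule vector_derivative_unique_at[OF psi1_deriv])
  have "((\<lambda>u. (of_real \<Delta> * phi1 u) * char \<mu> u) has_vector_derivative
      (of_real \<Delta> * phi1 u) * psi1 u + (of_real \<Delta> * - h_star u) * char \<mu> u) (at u)"
    by (intro has_vector_derivative_mult has_vector_derivative_mult_right phi1_deriv char_deriv)
  then show "(psi1 has_vector_derivative of_real \<Delta> * (- h_star u + of_real \<Delta> * (phi1 u * phi1 u)) * char \<mu> u) (at u)"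
    unfolding psi1_eq[abs_def] by (simp add: algebra_simps)
qed

lemma second_moment: "(LINT x|\<mu>. x\<^sup>2) = \<Delta> * m2 + \<Delta>\<^sup>2 * b\<^sup>2"
proof -
  have "psi2 0 = of_real (- (LINT x|\<mu>. x\<^sup>2))"
    unfolding psi2_def by (simp add: power_mult_distrib flip: of_real_power)
  moreover have "psi2 0 = of_real (- (\<Delta> * m2 + \<Delta>\<^sup>2 * b\<^sup>2))"
    unfolding psi2_eq by (simp add: h_star_0 phi1_0 char_zero algebra_simps power2_eq_square)
  ultimately show ?thesis by (simp only: of_real_eq_iff neg_equal_iff_equal)
qed

lemma second_moment_le: "(LINT x|\<mu>. x\<^sup>2) \<le> (m2 + b\<^sup>2) * \<Delta>"
proof -
  have "\<Delta>\<^sup>2 * b\<^sup>2 \<le> \<Delta> * b\<^sup>2"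
    using \<Delta> by (intro mult_right_mono) (auto simp: power2_eq_square mult_left_le)
  then show ?thesis unfolding second_moment by (simp add: algebra_simps)
qed

lemma char_second_order_bounded: "second_order_bounded (char \<mu>) (1 + 3 * phi1_bound + m2 + b\<^sup>2)"
proof (rule second_order_boundedI)
  fix u :: real
  show "cmod (char \<mu> u) \<le> 1" by (rule cmod_char_le_1)
  have "3 * \<Delta> * phi1_bound * \<bar>u\<bar> \<le> 3 * 1 * phi1_bound * \<bar>u\<bar>"
    using \<Delta> phi1_bound_nonneg by (intro mult_right_mono mult_left_mono) auto
  then show "cmod (char \<mu> u - char \<mu> 0) \<le> (3 * phi1_bound) * \<bar>u\<bar>"
    using norm_char_minus_1_le[of u] by (simp add: char_zero)
  have int: "integrable \<mu> (\<lambda>x. iexp (v * x))" for v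
    by (rule integrable_const_bound[where B=1]) auto
  have "char \<mu> u + char \<mu> (- u) - 2 * char \<mu> 0 = (CLINT x|\<mu>. iexp (u * x) + iexp (- (u * x)) - 2)"
    using int[of u] int[of "- u"] unfolding char_zero unfolding char_def
    by (simp del: space_eq_univ add: prob_space)
  also have "cmod \<dots> \<le> (LINT x|\<mu>. u\<^sup>2 * x\<^sup>2)"
    using integrable_square norm_iexp_second_difference_le[of "u * x" for x]
    by (intro norm_integral_le_of_norm_le) (auto simp: power_mult_distrib)
  also have "\<dots> = u\<^sup>2 * (LINT x|\<mu>. x\<^sup>2)" by simp
  also have "\<dots> \<le> u\<^sup>2 * (m2 + b\<^sup>2)"
  proof (intro mult_left_mono)
    have "(m2 + b\<^sup>2) * \<Delta> \<le> (m2 + b\<^sup>2) * 1" using \<Delta> moments_nonneg by (intro mult_left_mono) auto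
    then show "(LINT x|\<mu>. x\<^sup>2) \<le> m2 + b\<^sup>2" using second_moment_le by simp
  qed simp
  finally show "cmod (char \<mu> u + char \<mu> (- u) - 2 * char \<mu> 0) \<le> (m2 + b\<^sup>2) * u\<^sup>2" by (simp add: mult.commute)
qed (use phi1_bound_nonneg moments_nonneg in auto)

text \<open>
  The constant produced by the product rule for \<open>second_order_bounded\<close> applied to
  \<open>(- h_star + \<Delta> phi1\<^sup>2) \<psi>\<close>, which is \<open>\<psi>'' / \<Delta>\<close>, with \<open>\<Delta>\<close> replaced by 1.
\<close>

definition (in square_integrable_levy_exponent)
  "moment4_const = 4 * (m2 + m3 + m4 + 4 * (phi1_bound + m2 + m3) * (phi1_bound + m2 + m3)) * (1 + 3 * phi1_bound + m2 + b\<^sup>2)"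

lemma psi2_second_difference: "cmod (psi2 u + psi2 (- u) - 2 * psi2 0) \<le> \<Delta> * moment4_const * u\<^sup>2" if "\<bar>u\<bar> \<le> 1"
proof -
  have h_star: "second_order_bounded (\<lambda>u. (-1) * h_star u) (cmod (-1) * (m2 + m3 + m4))"
    by (rule second_order_bounded_scale, rule second_order_boundedI[OF norm_h_star_le _ norm_h_star_second_difference_le])
       (use h_star_lipschitz[of _ 0] moments_nonneg in auto)
  have phi1: "second_order_bounded phi1 (phi1_bound + m2 + m3)"
    by (rule second_order_boundedI[OF norm_phi1_le norm_phi1_lipschitz_0 norm_phi1_second_difference_le])
       (use phi1_bound_nonneg moments_nonneg in auto)
  define B where "B = 4 * (phi1_bound + m2 + m3) * (phi1_bound + m2 + m3)"
  have B: "0 \<le> B" unfolding B_def using phi1_bound_nonneg moments_nonneg by simp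
  have "second_order_bounded (\<lambda>u. of_real \<Delta> * (phi1 u * phi1 u)) (cmod (of_real \<Delta>) * B)"
    unfolding B_def by (intro second_order_bounded_scale second_order_bounded_mult phi1)
  from second_order_bounded_mult[OF second_order_bounded_add[OF h_star this] char_second_order_bounded]
  have "second_order_bounded (\<lambda>u. (- h_star u + of_real \<Delta> * (phi1 u * phi1 u)) * char \<mu> u)
      (4 * (m2 + m3 + m4 + \<Delta> * B) * (1 + 3 * phi1_bound + m2 + b\<^sup>2))"
    using \<Delta> by (simp add: comp_def)
  from second_order_bounded_scale[OF this, of "of_real \<Delta>"]
  have "second_order_bounded psi2 (\<Delta> * (4 * (m2 + m3 + m4 + \<Delta> * B) * (1 + 3 * phi1_bound + m2 + b\<^sup>2)))"
    using \<Delta> by (simp add: psi2_eq[abs_def] mult.assoc)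
  then have "cmod (psi2 u + psi2 (- u) - 2 * psi2 0) \<le> \<Delta> * (4 * (m2 + m3 + m4 + \<Delta> * B) * (1 + 3 * phi1_bound + m2 + b\<^sup>2)) * u\<^sup>2"
    using that unfolding second_order_bounded_def by blast
  also have "\<dots> \<le> \<Delta> * (4 * (m2 + m3 + m4 + 1 * B) * (1 + 3 * phi1_bound + m2 + b\<^sup>2)) * u\<^sup>2"
    using \<Delta> B phi1_bound_nonneg moments_nonneg
    by (intro mult_right_mono mult_left_mono add_left_mono) auto
  finally show ?thesis unfolding moment4_const_def B_def by simp
qed

text \<open>
  The second difference of \<open>\<psi>''\<close> at 0 is the integral of \<open>x\<^sup>2 (2 - 2 cos (u x))\<close>, so the Fatou argument
  applies with the weight \<open>x\<^sup>2\<close>.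
\<close>

lemma fourth_moment:
  shows integrable_fourth: "integrable \<mu> (\<lambda>x. x ^ 4)" and fourth_moment_le: "(LINT x|\<mu>. x ^ 4) \<le> moment4_const * \<Delta>"
proof -
  have moment4_const: "0 \<le> moment4_const" unfolding moment4_const_def using phi1_bound_nonneg moments_nonneg by simp
  have eq: "(\<integral>\<^sup>+x. ennreal (x\<^sup>2 * (2 - 2 * cos (u * x))) \<partial>\<mu>) = ennreal (Re (psi2 u + psi2 (- u) - 2 * psi2 0))" for u
  proof -
    have int: "integrable \<mu> (\<lambda>x. x\<^sup>2 * (2 - 2 * cos (u * x)))"
    proof (rule Bochner_Integration.integrable_bound)
      show "integrable \<mu> (\<lambda>x. 4 * x\<^sup>2)" using integrable_square by simp
      have "\<bar>2 - 2 * cos (u * x)\<bar> \<le> 4" for x using cos_le_one[of "u * x"] cos_ge_minus_one[of "u * x"] by linarith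
      have "\<bar>x\<^sup>2 * (2 - 2 * cos (u * x))\<bar> \<le> x\<^sup>2 * 4" for x
        unfolding abs_mult abs_power2 by (intro mult_left_mono \<open>\<bar>2 - 2 * cos (u * x)\<bar> \<le> 4\<close>) simp
      then show "AE x in \<mu>. norm (x\<^sup>2 * (2 - 2 * cos (u * x))) \<le> norm (4 * x\<^sup>2)"
        by (intro AE_I2) (simp add: mult.commute)
    qed simp
    have int_x2: "integrable \<mu> (\<lambda>x. (\<i> * of_real x)\<^sup>2 * iexp (v * x))" for v
      by (rule Bochner_Integration.integrable_bound[OF integrable_square]) (auto simp: norm_mult norm_power)
    have "psi2 u + psi2 (- u) - 2 * psi2 0
      = (CLINT x|\<mu>. (\<i> * of_real x)\<^sup>2 * iexp (u * x) + (\<i> * of_real x)\<^sup>2 * iexp (- u * x) - 2 * ((\<i> * of_real x)\<^sup>2 * iexp (0 * x)))"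
    proof -
      define F where "F v x = (\<i> * of_real x)\<^sup>2 * iexp (v * x)" for v x :: real
      have "integrable \<mu> (F v)" for v using int_x2 unfolding F_def .
      then have "(CLINT x|\<mu>. F u x + F (- u) x - 2 * F 0 x) = integral\<^sup>L \<mu> (F u) + integral\<^sup>L \<mu> (F (- u)) - 2 * integral\<^sup>L \<mu> (F 0)"
        by simp
      then show ?thesis unfolding F_def psi2_def by simp
    qed
    also have "\<dots> = (CLINT x|\<mu>. complex_of_real (x\<^sup>2 * (2 - 2 * cos (u * x))))"
      by (intro Bochner_Integration.integral_cong refl) (simp add: complex_eq_iff power2_eq_square Re_exp Im_exp algebra_simps)
    also have "\<dots> = of_real (LINT x|\<mu>. x\<^sup>2 * (2 - 2 * cos (u * x)))" by (rule integral_complex_of_real)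
    finally show ?thesis using int by (simp add: nn_integral_eq_integral)
  qed
  have "(\<integral>\<^sup>+x. ennreal (x\<^sup>2 * x\<^sup>2) \<partial>\<mu>) \<le> ennreal (moment4_const * \<Delta>)"
  proof (rule second_moment_le_of_cosine_bound)
    fix u :: real assume "0 < u" "u \<le> 1"
    then show "(\<integral>\<^sup>+x. ennreal (x\<^sup>2 * (2 - 2 * cos (u * x))) \<partial>\<mu>) \<le> ennreal (moment4_const * \<Delta> * u\<^sup>2)"
      unfolding eq using psi2_second_difference[of u] complex_Re_le_cmod[of "psi2 u + psi2 (- u) - 2 * psi2 0"]
      by (intro ennreal_leI) (simp add: ac_simps)
  qed (auto simp: events_eq_borel)
  then have *: "(\<integral>\<^sup>+x. ennreal (x ^ 4) \<partial>\<mu>) \<le> ennreal (moment4_const * \<Delta>)" by (simp flip: power_add)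
  then show int: "integrable \<mu> (\<lambda>x. x ^ 4)"
    by (intro integrableI_bounded) (auto simp: le_less_trans[OF _ ennreal_less_top])
  show "(LINT x|\<mu>. x ^ 4) \<le> moment4_const * \<Delta>"
    using * moment4_const \<Delta> by (subst (asm) nn_integral_eq_integral[OF int]) auto
qed

text \<open>
  The identity that the first estimator imitates: the term in \<open>phi1\<^sup>2\<close> cancels.
\<close>

lemma psi_identity: "psi1 u * psi1 u - psi2 u * char \<mu> u = of_real \<Delta> * h_star u * (char \<mu> u)\<^sup>2"
  unfolding psi1_eq psi2_eq by (simp add: algebra_simps power2_eq_square)

end

section \<open>Errors of the empirical characteristic functions\<close>

context prob_space
begin

lemma expectation_square_sum_indep_centered:
  fixes Y :: "'i \<Rightarrow> 'a \<Rightarrow> real"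
  assumes "finite I" "indep_vars (\<lambda>_. borel) Y I"
    and "\<And>k. k \<in> I \<Longrightarrow> integrable M (\<lambda>\<omega>. (Y k \<omega>)\<^sup>2)"
    and "\<And>k. k \<in> I \<Longrightarrow> expectation (Y k) = 0"
  shows "integrable M (\<lambda>\<omega>. (\<Sum>k\<in>I. Y k \<omega>)\<^sup>2)
    \<and> expectation (\<lambda>\<omega>. (\<Sum>k\<in>I. Y k \<omega>)\<^sup>2) = (\<Sum>k\<in>I. expectation (\<lambda>\<omega>. (Y k \<omega>)\<^sup>2))"
  using assms
proof (induction I rule: finite_induct)
  case empty
  then show ?case by simp
next
  case (insert i I)
  have rv: "random_variable borel (Y k)" if "k \<in> insert i I" for k
    using insert.prems(1) that by (auto simp: indep_vars_def)
  have int: "integrable M (Y k)" if "k \<in> insert i I" for k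
    by (rule square_integrable_imp_integrable[OF rv insert.prems(2)]) (use that in auto)
  have IH: "integrable M (\<lambda>\<omega>. (\<Sum>k\<in>I. Y k \<omega>)\<^sup>2)"
    "expectation (\<lambda>\<omega>. (\<Sum>k\<in>I. Y k \<omega>)\<^sup>2) = (\<Sum>k\<in>I. expectation (\<lambda>\<omega>. (Y k \<omega>)\<^sup>2))"
    using insert.IH[OF indep_vars_subset[OF insert.prems(1)]] insert.prems by auto
  have ind: "indep_var borel (Y i) borel (\<lambda>\<omega>. \<Sum>k\<in>I. Y k \<omega>)"
    by (rule indep_vars_sum[OF insert.hyps insert.prems(1)])
  have intS: "integrable M (\<lambda>\<omega>. \<Sum>k\<in>I. Y k \<omega>)" using int by auto
  have cross: "integrable M (\<lambda>\<omega>. Y i \<omega> * (\<Sum>k\<in>I. Y k \<omega>))"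
      "expectation (\<lambda>\<omega>. Y i \<omega> * (\<Sum>k\<in>I. Y k \<omega>)) = 0"
    using indep_var_integrable[OF ind int intS] indep_var_lebesgue_integral[OF ind int intS] insert.prems(3)
    by simp_all
  have eq: "(\<lambda>\<omega>. (\<Sum>k\<in>insert i I. Y k \<omega>)\<^sup>2) = (\<lambda>\<omega>. (Y i \<omega>)\<^sup>2 + 2 * (Y i \<omega> * (\<Sum>k\<in>I. Y k \<omega>)) + (\<Sum>k\<in>I. Y k \<omega>)\<^sup>2)"
    using insert.hyps by (intro ext) (simp add: power2_sum algebra_simps)
  show ?case
    unfolding eq using cross IH insert.prems(2)[of i] insert.hyps by simp
qed

text \<open>
  Real and imaginary parts are treated separately. In each, independence makes the centered summands
  orthogonal.
\<close>

lemma empirical_mean_L2_error: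
  fixes f :: "real \<Rightarrow> complex" and Z :: "'i \<Rightarrow> 'a \<Rightarrow> real"
  assumes I: "finite I" "I \<noteq> {}" and indep: "indep_vars (\<lambda>_. borel) Z I"
    and distr: "\<And>k. k \<in> I \<Longrightarrow> distr M borel (Z k) = \<mu>"
    and f [measurable]: "f \<in> borel_measurable borel"
    and int: "integrable \<mu> (\<lambda>x. (cmod (f x))\<^sup>2)" and V: "(LINT x|\<mu>. (cmod (f x))\<^sup>2) \<le> V"
  shows "(\<integral>\<^sup>+\<omega>. ennreal ((cmod ((\<Sum>k\<in>I. f (Z k \<omega>)) / of_nat (card I) - (CLINT x|\<mu>. f x)))\<^sup>2) \<partial>M) \<le> ennreal (V / card I)"
proof -
  have rv [measurable]: "k \<in> I \<Longrightarrow> random_variable borel (Z k)" for k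
    using indep by (auto simp: indep_vars_def)
  obtain k0 where k0: "k0 \<in> I" using I by auto
  have sets: "sets \<mu> = sets borel" using distr[OF k0] by (metis sets_distr)
  interpret \<mu>: prob_space \<mu> using prob_space_distr[OF rv[OF k0]] distr[OF k0] by simp
  have [measurable_cong]: "sets \<mu> = sets borel" by (fact sets)
  have intf: "integrable \<mu> f"
    using \<mu>.square_integrable_imp_integrable[of "\<lambda>x. cmod (f x)"] int integrable_norm_cancel[of \<mu> f] by simp
  define c where "c = (CLINT x|\<mu>. f x)"
  let ?N = "real (card I)"
  have N: "?N > 0" using I by (simp add: card_gt_0_iff)
  have int2: "integrable \<mu> (\<lambda>x. (cmod (f x - c))\<^sup>2)" "(LINT x|\<mu>. (cmod (f x - c))\<^sup>2) \<le> V"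
  proof -
    have eq: "(\<lambda>x. (cmod (f x - c))\<^sup>2) = (\<lambda>x. (cmod (f x))\<^sup>2 - 2 * (Re (f x) * Re c + Im (f x) * Im c) + (cmod c)\<^sup>2)"
      by (intro ext) (simp add: cmod_power2 power2_diff algebra_simps)
    show "integrable \<mu> (\<lambda>x. (cmod (f x - c))\<^sup>2)"
      unfolding eq using int intf by (intro Bochner_Integration.integrable_add Bochner_Integration.integrable_diff) auto
    have "(LINT x|\<mu>. (cmod (f x - c))\<^sup>2) = (LINT x|\<mu>. (cmod (f x))\<^sup>2) - 2 * (Re c * Re c + Im c * Im c) + (cmod c)\<^sup>2"
      unfolding eq using int intf by (simp add: \<mu>.prob_space c_def)
    also have "(cmod c)\<^sup>2 = Re c * Re c + Im c * Im c" using cmod_power2[of c] by (simp only: power2_eq_square)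
    also have "(LINT x|\<mu>. (cmod (f x))\<^sup>2) - 2 * (Re c * Re c + Im c * Im c) + (Re c * Re c + Im c * Im c) \<le> V"
    proof -
      have "e - 2 * r + r \<le> V" if "e \<le> V" "0 \<le> r" for e r :: real using that by simp
      then show ?thesis using V by (simp only: sum_squares_ge_zero)
    qed
    finally show "(LINT x|\<mu>. (cmod (f x - c))\<^sup>2) \<le> V" .
  qed
  have transfer: "integrable M (\<lambda>\<omega>. g (Z k \<omega>))" "expectation (\<lambda>\<omega>. g (Z k \<omega>)) = (LINT x|\<mu>. g x)"
    if "k \<in> I" "integrable \<mu> g" for g :: "real \<Rightarrow> real" and k
  proof -
    have g: "g \<in> borel_measurable borel" using borel_measurable_integrable[OF that(2)] by simp
    show "integrable M (\<lambda>\<omega>. g (Z k \<omega>))"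
      using that integrable_distr_eq[OF rv[OF that(1)] g] by (simp add: distr)
    show "expectation (\<lambda>\<omega>. g (Z k \<omega>)) = (LINT x|\<mu>. g x)"
      using integral_distr[OF rv[OF that(1)] g] that by (simp add: distr)
  qed
  have part: "integrable M (\<lambda>\<omega>. (\<Sum>k\<in>I. p (f (Z k \<omega>) - c))\<^sup>2) \<and>
      expectation (\<lambda>\<omega>. (\<Sum>k\<in>I. p (f (Z k \<omega>) - c))\<^sup>2) = ?N * (LINT x|\<mu>. (p (f x - c))\<^sup>2)"
    if [measurable]: "p \<in> borel_measurable borel" and p2: "integrable \<mu> (\<lambda>x. (p (f x - c))\<^sup>2)"
      and p1: "integrable \<mu> (\<lambda>x. p (f x - c))" and p0: "(LINT x|\<mu>. p (f x - c)) = 0" for p :: "complex \<Rightarrow> real"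
  proof -
    have "indep_vars (\<lambda>_. borel) (\<lambda>k \<omega>. p (f (Z k \<omega>) - c)) I"
      by (rule indep_vars_compose2[OF indep]) measurable
    from expectation_square_sum_indep_centered[OF I(1) this]
    show ?thesis using transfer(1)[OF _ p2] transfer(2)[OF _ p2] transfer(2)[OF _ p1] p0 by simp
  qed
  have le: "integrable \<mu> (\<lambda>x. (Re (f x - c))\<^sup>2)" "integrable \<mu> (\<lambda>x. (Im (f x - c))\<^sup>2)"
    by (rule Bochner_Integration.integrable_bound[OF int2(1)]; auto simp: cmod_power2)+
  have c0: "(LINT x|\<mu>. Re (f x - c)) = 0" "(LINT x|\<mu>. Im (f x - c)) = 0"
    using intf by (simp_all add: \<mu>.prob_space c_def)
  have intc: "integrable \<mu> (\<lambda>x. f x - c)" using intf by simp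
  note R = part[OF _ le(1) integrable_Re[OF intc] c0(1), simplified]
  note J = part[OF _ le(2) integrable_Im[OF intc] c0(2), simplified]
  have eq: "(cmod ((\<Sum>k\<in>I. f (Z k \<omega>)) / of_nat (card I) - c))\<^sup>2
      = ((\<Sum>k\<in>I. Re (f (Z k \<omega>) - c))\<^sup>2 + (\<Sum>k\<in>I. Im (f (Z k \<omega>) - c))\<^sup>2) / ?N\<^sup>2" for \<omega>
  proof -
    have "(\<Sum>k\<in>I. f (Z k \<omega>)) / of_nat (card I) - c = (\<Sum>k\<in>I. f (Z k \<omega>) - c) / of_nat (card I)"
      using N by (simp add: sum_subtractf field_simps)
    then show ?thesis
      by (simp add: norm_divide power_divide cmod_power2 del: minus_complex.simps)
  qed
  have "(\<integral>\<^sup>+\<omega>. ennreal ((cmod ((\<Sum>k\<in>I. f (Z k \<omega>)) / of_nat (card I) - c))\<^sup>2) \<partial>M)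
     = ennreal (expectation (\<lambda>\<omega>. ((\<Sum>k\<in>I. Re (f (Z k \<omega>) - c))\<^sup>2 + (\<Sum>k\<in>I. Im (f (Z k \<omega>) - c))\<^sup>2) / ?N\<^sup>2))"
    unfolding eq using R J by (intro nn_integral_eq_integral) auto
  also have "expectation (\<lambda>\<omega>. ((\<Sum>k\<in>I. Re (f (Z k \<omega>) - c))\<^sup>2 + (\<Sum>k\<in>I. Im (f (Z k \<omega>) - c))\<^sup>2) / ?N\<^sup>2)
     = (?N * (LINT x|\<mu>. (Re (f x - c))\<^sup>2) + ?N * (LINT x|\<mu>. (Im (f x - c))\<^sup>2)) / ?N\<^sup>2"
    using R J by simp
  also have "\<dots> = (LINT x|\<mu>. (cmod (f x - c))\<^sup>2) / ?N"
  proof -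
    have "(?N * p + ?N * q) / ?N\<^sup>2 = (p + q) / ?N" for p q
      using N by (simp add: field_simps power2_eq_square)
    moreover have "(LINT x|\<mu>. (cmod (f x - c))\<^sup>2) = (LINT x|\<mu>. (Re (f x - c))\<^sup>2) + (LINT x|\<mu>. (Im (f x - c))\<^sup>2)"
      unfolding cmod_power2 by (rule Bochner_Integration.integral_add[OF le])
    ultimately show ?thesis by simp
  qed
  also have "\<dots> \<le> V / ?N" using int2(2) N by (intro divide_right_mono) auto
  finally show ?thesis unfolding c_def by (simp add: ennreal_leI)
qed

lemma nn_integral_indep_halves:
  fixes Z :: "nat \<Rightarrow> 'a \<Rightarrow> real" and F G :: "(nat \<Rightarrow> real) \<Rightarrow> ennreal"
  assumes indep: "indep_vars (\<lambda>_. borel) Z I" and AB: "A \<inter> B = {}" "A \<subseteq> I" "B \<subseteq> I"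
    and F: "F \<in> borel_measurable (PiM A (\<lambda>_. borel))" and G: "G \<in> borel_measurable (PiM B (\<lambda>_. borel))"
  shows "(\<integral>\<^sup>+\<omega>. F (restrict (\<lambda>k. Z k \<omega>) A) * G (restrict (\<lambda>k. Z k \<omega>) B) \<partial>M)
    = (\<integral>\<^sup>+\<omega>. F (restrict (\<lambda>k. Z k \<omega>) A) \<partial>M) * (\<integral>\<^sup>+\<omega>. G (restrict (\<lambda>k. Z k \<omega>) B) \<partial>M)"
proof -
  let ?X = "case_bool (F \<circ> (\<lambda>\<omega>. restrict (\<lambda>k. Z k \<omega>) A)) (G \<circ> (\<lambda>\<omega>. restrict (\<lambda>k. Z k \<omega>) B))"
  have "indep_var borel (F \<circ> (\<lambda>\<omega>. restrict (\<lambda>k. Z k \<omega>) A)) borel (G \<circ> (\<lambda>\<omega>. restrict (\<lambda>k. Z k \<omega>) B))"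
    by (rule indep_var_compose[OF indep_var_restrict[OF indep AB] F G])
  moreover have "(\<lambda>_::bool. borel :: ennreal measure) = case_bool borel borel" by (auto split: bool.split)
  ultimately have "indep_vars (\<lambda>_. borel) ?X UNIV" unfolding indep_var_def by simp
  from indep_vars_nn_integral[OF _ this] show ?thesis by (simp add: UNIV_bool mult.commute comp_def)
qed

end

lemma norm_power2_sum3_le: "(cmod (x + y + z))\<^sup>2 \<le> 3 * ((cmod x)\<^sup>2 + (cmod y)\<^sup>2 + (cmod z)\<^sup>2)"
proof -
  have "(cmod (x + y + z))\<^sup>2 \<le> (cmod x + cmod y + cmod z)\<^sup>2"
    by (intro power_mono norm_triangle_le add_mono norm_triangle_ineq order_refl) simp
  also have "\<dots> \<le> 3 * ((cmod x)\<^sup>2 + (cmod y)\<^sup>2 + (cmod z)\<^sup>2)"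
    using zero_le_power2[of "cmod x - cmod y"] zero_le_power2[of "cmod x - cmod z"] zero_le_power2[of "cmod y - cmod z"]
    by (simp add: power2_eq_square algebra_simps)
  finally show ?thesis .
qed

lemma norm_power2_sum2_le: "(cmod (x + y))\<^sup>2 \<le> 2 * ((cmod x)\<^sup>2 + (cmod y)\<^sup>2)"
proof -
  have "(cmod (x + y))\<^sup>2 \<le> (cmod x + cmod y)\<^sup>2"
    by (intro power_mono norm_triangle_ineq) simp
  also have "\<dots> \<le> 2 * ((cmod x)\<^sup>2 + (cmod y)\<^sup>2)"
    using zero_le_power2[of "cmod x - cmod y"] by (simp add: power2_eq_square algebra_simps)
  finally show ?thesis .
qed

lemma nn_integral_add_le:
  fixes f g :: "'a \<Rightarrow> real"
  assumes "f \<in> borel_measurable M" "g \<in> borel_measurable M" "\<And>x. 0 \<le> f x" "\<And>x. 0 \<le> g x"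
    and "(\<integral>\<^sup>+x. ennreal (f x) \<partial>M) \<le> ennreal c" "(\<integral>\<^sup>+x. ennreal (g x) \<partial>M) \<le> ennreal d" "0 \<le> c" "0 \<le> d"
  shows "(\<integral>\<^sup>+x. ennreal (f x + g x) \<partial>M) \<le> ennreal (c + d)"
proof -
  have "(\<integral>\<^sup>+x. ennreal (f x + g x) \<partial>M) = (\<integral>\<^sup>+x. ennreal (f x) \<partial>M) + (\<integral>\<^sup>+x. ennreal (g x) \<partial>M)"
    using assms(1-4) by (simp add: ennreal_plus nn_integral_add)
  also have "\<dots> \<le> ennreal c + ennreal d" by (intro add_mono assms)
  finally show ?thesis using assms(7,8) by simp
qed

lemma nn_integral_cmult_le:
  fixes f :: "'a \<Rightarrow> real"
  assumes "f \<in> borel_measurable M" "0 \<le> k" "(\<integral>\<^sup>+x. ennreal (f x) \<partial>M) \<le> ennreal c"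
  shows "(\<integral>\<^sup>+x. ennreal (k * f x) \<partial>M) \<le> ennreal (k * c)"
proof -
  have "(\<integral>\<^sup>+x. ennreal (k * f x) \<partial>M) = ennreal k * (\<integral>\<^sup>+x. ennreal (f x) \<partial>M)"
    using assms by (simp add: ennreal_mult' nn_integral_cmult)
  also have "\<dots> \<le> ennreal k * ennreal c" by (intro mult_left_mono assms) simp
  finally show ?thesis using assms(2) by (simp add: ennreal_mult')
qed

locale iid_levy_sample = levy_increment_law b \<sigma> \<nu> \<mu> \<Delta> + P: prob_space M
  for b \<sigma> :: real and \<nu> :: "real \<Rightarrow> real" and \<mu> :: "real measure" and \<Delta> :: real and M :: "'a measure" +
  fixes Z :: "nat \<Rightarrow> 'a \<Rightarrow> real" and n :: nat
  assumes n: "0 < n"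
    and indep_Z: "P.indep_vars (\<lambda>_. borel) Z {1..2 * n}"
    and distr_Z: "\<And>k. k \<in> {1..2 * n} \<Longrightarrow> distr M borel (Z k) = \<mu>"
begin

lemma Z_measurable [measurable]: "k \<in> {1..2 * n} \<Longrightarrow> Z k \<in> borel_measurable M"
  using indep_Z by (auto simp: P.indep_vars_def)

text \<open>
  The summands of \<open>psi_half\<close> and \<open>psi2_full\<close>. Their expectations are the derivatives of order \<open>j\<close> of the
  characteristic function.
\<close>

definition "score j u x = (\<i> * complex_of_real x) ^ j * iexp (u * x)"

lemma score_measurable [measurable]: "score j u \<in> borel_measurable borel"
  unfolding score_def by measurable

lemma norm_score: "cmod (score j u x) = \<bar>x\<bar> ^ j"
  unfolding score_def by (simp add: norm_mult norm_power)

lemma integral_score: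
  "(CLINT x|\<mu>. score 0 u x) = char \<mu> u" "(CLINT x|\<mu>. score 1 u x) = psi1 u" "(CLINT x|\<mu>. score 2 u x) = psi2 u"
  unfolding score_def char_def psi1_def psi2_def by simp_all

lemma score_moments:
  "integrable \<mu> (\<lambda>x. (cmod (score 0 u x))\<^sup>2)" "(LINT x|\<mu>. (cmod (score 0 u x))\<^sup>2) \<le> 1"
  "integrable \<mu> (\<lambda>x. (cmod (score 1 u x))\<^sup>2)" "(LINT x|\<mu>. (cmod (score 1 u x))\<^sup>2) \<le> (m2 + b\<^sup>2) * \<Delta>"
  "integrable \<mu> (\<lambda>x. (cmod (score 2 u x))\<^sup>2)" "(LINT x|\<mu>. (cmod (score 2 u x))\<^sup>2) \<le> moment4_const * \<Delta>"
  unfolding norm_score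
  using integrable_square integrable_fourth second_moment_le fourth_moment_le prob_space
  by (simp_all flip: power_mult)

lemma psi_half_error:
  assumes q: "q = 1 \<or> q = 2"
  shows "(\<integral>\<^sup>+\<omega>. ennreal ((cmod (psi_half n (\<lambda>k. Z k \<omega>) 0 q u - char \<mu> u))\<^sup>2) \<partial>M) \<le> ennreal (1 / n)"
    and "(\<integral>\<^sup>+\<omega>. ennreal ((cmod (psi_half n (\<lambda>k. Z k \<omega>) 1 q u - psi1 u))\<^sup>2) \<partial>M) \<le> ennreal ((m2 + b\<^sup>2) * \<Delta> / n)"
    and "(\<integral>\<^sup>+\<omega>. ennreal ((cmod (psi_half n (\<lambda>k. Z k \<omega>) 2 q u - psi2 u))\<^sup>2) \<partial>M) \<le> ennreal (moment4_const * \<Delta> / n)"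
proof -
  let ?I = "{1 + (q - 1) * n..q * n}"
  have sub: "?I \<subseteq> {1..2 * n}" and card: "card ?I = n" and I: "finite ?I" "?I \<noteq> {}" using q n by auto
  have eq: "psi_half n (\<lambda>k. Z k \<omega>) j q u = (\<Sum>k\<in>?I. score j u (Z k \<omega>)) / of_nat (card ?I)" for j \<omega>
    unfolding psi_half_def score_def card ..
  note err = P.empirical_mean_L2_error[OF I P.indep_vars_subset[OF indep_Z sub] distr_Z[OF subsetD[OF sub]] score_measurable]
  show "(\<integral>\<^sup>+\<omega>. ennreal ((cmod (psi_half n (\<lambda>k. Z k \<omega>) 0 q u - char \<mu> u))\<^sup>2) \<partial>M) \<le> ennreal (1 / n)"
    using err[OF _ score_moments(1,2)] unfolding eq integral_score card by simp
  show "(\<integral>\<^sup>+\<omega>. ennreal ((cmod (psi_half n (\<lambda>k. Z k \<omega>) 1 q u - psi1 u))\<^sup>2) \<partial>M) \<le> ennreal ((m2 + b\<^sup>2) * \<Delta> / n)"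
    using err[OF _ score_moments(3,4)] unfolding eq integral_score card by simp
  show "(\<integral>\<^sup>+\<omega>. ennreal ((cmod (psi_half n (\<lambda>k. Z k \<omega>) 2 q u - psi2 u))\<^sup>2) \<partial>M) \<le> ennreal (moment4_const * \<Delta> / n)"
    using err[OF _ score_moments(5,6)] unfolding eq integral_score card by simp
qed

lemma psi2_full_error:
  "(\<integral>\<^sup>+\<omega>. ennreal ((cmod (psi2_full n (\<lambda>k. Z k \<omega>) u - psi2 u))\<^sup>2) \<partial>M) \<le> ennreal (moment4_const * \<Delta> / n)"
proof -
  have I: "finite {1..2 * n}" "{1..2 * n} \<noteq> {}" using n by auto
  have "(\<integral>\<^sup>+\<omega>. ennreal ((cmod (psi2_full n (\<lambda>k. Z k \<omega>) u - psi2 u))\<^sup>2) \<partial>M) \<le> ennreal (moment4_const * \<Delta> / (2 * n))"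
    using P.empirical_mean_L2_error[OF I indep_Z distr_Z score_measurable score_moments(5,6)]
    unfolding psi2_full_def integral_score by (simp add: score_def)
  also have "\<dots> \<le> ennreal (moment4_const * \<Delta> / n)"
  proof (intro ennreal_leI divide_left_mono)
    have "0 \<le> (LINT x|\<mu>. x ^ 4)" by (intro Bochner_Integration.integral_nonneg) simp
    then show "0 \<le> moment4_const * \<Delta>" using fourth_moment_le by linarith
  qed (use n in auto)
  finally show ?thesis .
qed

lemma psi_half_measurable [measurable]:
  assumes "q = 1 \<or> q = 2"
  shows "(\<lambda>p. psi_half n (\<lambda>k. Z k (fst p)) j q (snd p)) \<in> borel_measurable (M \<Otimes>\<^sub>M borel)"
proof -
  have "(\<lambda>p. (\<i> * of_real (Z k (fst p))) ^ j * iexp (snd p * Z k (fst p))) \<in> borel_measurable (M \<Otimes>\<^sub>M borel)"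
    if "k \<in> {1 + (q - 1) * n..q * n}" for k
  proof -
    have [measurable]: "Z k \<in> borel_measurable M" using that assms by (intro Z_measurable) auto
    show ?thesis by measurable
  qed
  then show ?thesis unfolding psi_half_def by (intro borel_measurable_divide borel_measurable_sum) auto
qed

lemma psi2_full_measurable [measurable]:
  "(\<lambda>p. psi2_full n (\<lambda>k. Z k (fst p)) (snd p)) \<in> borel_measurable (M \<Otimes>\<^sub>M borel)"
proof -
  have "(\<lambda>p. (\<i> * of_real (Z k (fst p))) ^ 2 * iexp (snd p * Z k (fst p))) \<in> borel_measurable (M \<Otimes>\<^sub>M borel)"
    if "k \<in> {1..2 * n}" for k
  proof -
    have [measurable]: "Z k \<in> borel_measurable M" using that by (intro Z_measurable) auto
    show ?thesis by measurable
  qed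
  then show ?thesis unfolding psi2_full_def by (intro borel_measurable_divide borel_measurable_sum) auto
qed

lemma psi_half_measurable1:
  assumes "q = 1 \<or> q = 2"
  shows "(\<lambda>\<omega>. psi_half n (\<lambda>k. Z k \<omega>) j q u) \<in> borel_measurable M"
  using measurable_compose[OF measurable_Pair2'[of u borel M] psi_half_measurable[OF assms, of j]] by simp

lemma psi2_full_measurable1:
  shows "(\<lambda>\<omega>. psi2_full n (\<lambda>k. Z k \<omega>) u) \<in> borel_measurable M"
  using measurable_compose[OF measurable_Pair2'[of u borel M] psi2_full_measurable] by simp

lemma norm_psi1_le: "cmod (psi1 u) \<le> phi1_bound * \<Delta>"
proof -
  have "cmod (psi1 u) \<le> \<Delta> * phi1_bound * 1"
    unfolding psi1_eq norm_mult using \<Delta> norm_phi1_le[of u] cmod_char_le_1[of u] phi1_bound_nonneg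
    by (intro mult_mono) auto
  then show ?thesis by (simp add: mult.commute)
qed

lemma norm_psi2_le: "cmod (psi2 u) \<le> (m2 + b\<^sup>2) * \<Delta>"
proof -
  have "cmod (psi2 u) \<le> (LINT x|\<mu>. x\<^sup>2)"
    unfolding psi2_def using integrable_square
    by (intro norm_integral_le_of_norm_le) (auto simp: norm_mult norm_power)
  then show ?thesis using second_moment_le by simp
qed

lemma norm_psi_half_0_le: "cmod (psi_half n z 0 q u) \<le> 1" if "q = 1 \<or> q = 2"
proof -
  have "cmod (\<Sum>k = 1 + (q - 1) * n..q * n. (\<i> * of_real (z k)) ^ 0 * iexp (u * z k)) \<le> (\<Sum>k = 1 + (q - 1) * n..q * n. 1)"
    by (intro sum_norm_le) simp
  also have "\<dots> = n" using that by auto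
  finally show ?thesis unfolding psi_half_def using n by (simp add: norm_divide divide_le_eq)
qed

text \<open>
  The four summands belong to the four terms of the decomposition in \<open>h_hat_star_pointwise_error\<close>.
\<close>

definition (in square_integrable_levy_exponent)
  "variance_const = 6 * ((m2 + b\<^sup>2) * (2 * (m2 + b\<^sup>2) + 2 * phi1_bound\<^sup>2) + phi1_bound\<^sup>2 * (m2 + b\<^sup>2) + moment4_const + (m2 + b\<^sup>2)\<^sup>2)"

lemma (in square_integrable_levy_exponent) constants_nonneg: "0 \<le> moment4_const" "0 \<le> variance_const"
  unfolding variance_const_def moment4_const_def using phi1_bound_nonneg moments_nonneg by simp_all

lemma n1: "1 \<le> real n" using n by simp

text \<open>
  Independence of the two halves of the sample factorizes the expectation. In the other product of
  the estimator a simpler argument is available, since the factor from the second half is at most 1.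
\<close>

lemma first_product_error:
  "(\<integral>\<^sup>+\<omega>. ennreal ((cmod (psi_half n (\<lambda>k. Z k \<omega>) 1 1 u - psi1 u))\<^sup>2 * (cmod (psi_half n (\<lambda>k. Z k \<omega>) 1 2 u))\<^sup>2) \<partial>M)
    \<le> ennreal ((m2 + b\<^sup>2) * (2 * (m2 + b\<^sup>2) + 2 * phi1_bound\<^sup>2) * \<Delta>\<^sup>2 / n)"
proof -
  let ?v = "m2 + b\<^sup>2"
  have v: "0 \<le> ?v" using moments_nonneg by simp
  define F where "F z = ennreal ((cmod (psi_half n z 1 1 u - psi1 u))\<^sup>2)" for z
  define G where "G z = ennreal ((cmod (psi_half n z 1 2 u))\<^sup>2)" for z
  have F: "F (restrict (\<lambda>k. Z k \<omega>) {1..n}) = F (\<lambda>k. Z k \<omega>)" for \<omega>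
    unfolding F_def psi_half_def by simp
  have G: "G (restrict (\<lambda>k. Z k \<omega>) {1 + n..2 * n}) = G (\<lambda>k. Z k \<omega>)" for \<omega>
    unfolding G_def psi_half_def by simp
  have "(\<integral>\<^sup>+\<omega>. F (restrict (\<lambda>k. Z k \<omega>) {1..n}) * G (restrict (\<lambda>k. Z k \<omega>) {1 + n..2 * n}) \<partial>M)
     = (\<integral>\<^sup>+\<omega>. F (restrict (\<lambda>k. Z k \<omega>) {1..n}) \<partial>M) * (\<integral>\<^sup>+\<omega>. G (restrict (\<lambda>k. Z k \<omega>) {1 + n..2 * n}) \<partial>M)"
  proof (rule P.nn_integral_indep_halves[OF indep_Z])
    show "F \<in> borel_measurable (Pi\<^sub>M {1..n} (\<lambda>_. borel))"
      unfolding F_def psi_half_def by measurable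
    show "G \<in> borel_measurable (Pi\<^sub>M {1 + n..2 * n} (\<lambda>_. borel))"
      unfolding G_def psi_half_def by measurable
  qed auto
  then have "(\<integral>\<^sup>+\<omega>. F (\<lambda>k. Z k \<omega>) * G (\<lambda>k. Z k \<omega>) \<partial>M) = (\<integral>\<^sup>+\<omega>. F (\<lambda>k. Z k \<omega>) \<partial>M) * (\<integral>\<^sup>+\<omega>. G (\<lambda>k. Z k \<omega>) \<partial>M)"
    unfolding F G .
  also have "\<dots> \<le> ennreal (?v * \<Delta> / n) * ennreal ((2 * ?v + 2 * phi1_bound\<^sup>2) * \<Delta>)"
  proof (intro mult_mono)
    show "(\<integral>\<^sup>+\<omega>. F (\<lambda>k. Z k \<omega>) \<partial>M) \<le> ennreal (?v * \<Delta> / n)"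
      unfolding F_def by (rule psi_half_error(2)) simp
    have "(\<integral>\<^sup>+\<omega>. G (\<lambda>k. Z k \<omega>) \<partial>M)
       \<le> (\<integral>\<^sup>+\<omega>. ennreal (2 * (cmod (psi_half n (\<lambda>k. Z k \<omega>) 1 2 u - psi1 u))\<^sup>2 + 2 * (cmod (psi1 u))\<^sup>2) \<partial>M)"
      unfolding G_def
      using norm_power2_sum2_le[of "psi_half n (\<lambda>k. Z k \<omega>) 1 2 u - psi1 u" "psi1 u" for \<omega>]
      by (intro nn_integral_mono ennreal_leI) (simp add: distrib_left)
    also have "\<dots> \<le> ennreal (2 * (?v * \<Delta> / n) + 2 * (phi1_bound * \<Delta>)\<^sup>2)"
    proof (rule nn_integral_add_le)
      show "(\<integral>\<^sup>+\<omega>. ennreal (2 * (cmod (psi_half n (\<lambda>k. Z k \<omega>) 1 2 u - psi1 u))\<^sup>2) \<partial>M) \<le> ennreal (2 * (?v * \<Delta> / n))"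
        using psi_half_error(2)[of 2] psi_half_measurable1[of 2] by (intro nn_integral_cmult_le) auto
      show "(\<integral>\<^sup>+\<omega>. ennreal (2 * (cmod (psi1 u))\<^sup>2) \<partial>M) \<le> ennreal (2 * (phi1_bound * \<Delta>)\<^sup>2)"
        using norm_psi1_le[of u] by (simp add: P.emeasure_space_1 ennreal_leI power_mono)
    qed (use v \<Delta> psi_half_measurable1[of 2] in auto)
    also have "\<dots> \<le> ennreal ((2 * ?v + 2 * phi1_bound\<^sup>2) * \<Delta>)"
    proof (intro ennreal_leI)
      have "?v * \<Delta> / n \<le> ?v * \<Delta> / 1" using v \<Delta> n1 by (intro divide_left_mono) auto
      moreover have "(phi1_bound * \<Delta>)\<^sup>2 \<le> phi1_bound\<^sup>2 * \<Delta>"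
        unfolding power_mult_distrib using \<Delta> by (intro mult_left_mono) (auto simp: power2_eq_square mult_left_le)
      moreover have "(2 * ?v + 2 * phi1_bound\<^sup>2) * \<Delta> = 2 * (?v * \<Delta> / 1) + 2 * (phi1_bound\<^sup>2 * \<Delta>)"
        by (simp add: algebra_simps)
      ultimately show "2 * (?v * \<Delta> / n) + 2 * (phi1_bound * \<Delta>)\<^sup>2 \<le> (2 * ?v + 2 * phi1_bound\<^sup>2) * \<Delta>"
        by linarith
    qed
    finally show "(\<integral>\<^sup>+\<omega>. G (\<lambda>k. Z k \<omega>) \<partial>M) \<le> ennreal ((2 * ?v + 2 * phi1_bound\<^sup>2) * \<Delta>)" .
  qed auto
  also have "\<dots> = ennreal (?v * (2 * ?v + 2 * phi1_bound\<^sup>2) * \<Delta>\<^sup>2 / n)"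
  proof -
    have "0 \<le> ?v * \<Delta> / n" "0 \<le> (2 * ?v + 2 * phi1_bound\<^sup>2) * \<Delta>"
      using v \<Delta> by (auto intro!: mult_nonneg_nonneg add_nonneg_nonneg divide_nonneg_nonneg)
    moreover have "?v * \<Delta> / n * ((2 * ?v + 2 * phi1_bound\<^sup>2) * \<Delta>) = ?v * (2 * ?v + 2 * phi1_bound\<^sup>2) * \<Delta>\<^sup>2 / n"
      by (simp add: power2_eq_square ac_simps)
    ultimately show ?thesis by (simp only: ennreal_mult[symmetric])
  qed
  finally show ?thesis unfolding F_def G_def by (simp add: ennreal_mult)
qed

text \<open>
  Write \<open>A\<^sub>1, B\<^sub>1\<close> and \<open>A\<^sub>2, C\<^sub>2\<close> for the empirical quantities from the first and second half, and
  \<open>\<alpha> = \<psi>'\<close>, \<open>\<beta> = \<psi>''\<close>, \<open>\<gamma> = \<psi>\<close> for their means. The products are centered one factor at a time,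
  \<open>A\<^sub>1 A\<^sub>2 - \<alpha>\<^sup>2 = (A\<^sub>1 - \<alpha>) A\<^sub>2 + \<alpha> (A\<^sub>2 - \<alpha>)\<close> and likewise for \<open>B\<^sub>1 C\<^sub>2\<close>. Of the four mean
  squares, that of \<open>(B\<^sub>1 - \<beta>) C\<^sub>2\<close> is of order \<open>\<Delta> / n\<close> and determines the rate; the others are of order
  \<open>\<Delta>\<^sup>2 / n\<close> or smaller.
\<close>

lemma h_hat_star_pointwise_error:
  "(\<integral>\<^sup>+\<omega>. ennreal ((cmod (h_hat_star n \<Delta> (\<lambda>k. Z k \<omega>) u - h_star u))\<^sup>2) \<partial>M)
    \<le> ennreal (variance_const / (n * \<Delta>) + 216 * phi1_bound\<^sup>2 * \<Delta>\<^sup>2 * (u\<^sup>2 * (cmod (h_star u))\<^sup>2))"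
proof -
  let ?v = "m2 + b\<^sup>2"
  have v: "0 \<le> ?v" using moments_nonneg by simp
  define A1 where "A1 \<omega> = psi_half n (\<lambda>k. Z k \<omega>) 1 1 u" for \<omega>
  define A2 where "A2 \<omega> = psi_half n (\<lambda>k. Z k \<omega>) 1 2 u" for \<omega>
  define B1 where "B1 \<omega> = psi_half n (\<lambda>k. Z k \<omega>) 2 1 u" for \<omega>
  define C2 where "C2 \<omega> = psi_half n (\<lambda>k. Z k \<omega>) 0 2 u" for \<omega>
  have [measurable]: "A1 \<in> borel_measurable M" "A2 \<in> borel_measurable M" "B1 \<in> borel_measurable M" "C2 \<in> borel_measurable M"
    unfolding A1_def A2_def B1_def C2_def by (intro psi_half_measurable1; simp)+
  define \<alpha> where "\<alpha> = psi1 u"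
  define \<beta> where "\<beta> = psi2 u"
  define \<gamma> where "\<gamma> = char \<mu> u"
  define t where "t \<omega> = (cmod (A1 \<omega> - \<alpha>))\<^sup>2 * (cmod (A2 \<omega>))\<^sup>2 + (cmod \<alpha>)\<^sup>2 * (cmod (A2 \<omega> - \<alpha>))\<^sup>2
      + (cmod (B1 \<omega> - \<beta>))\<^sup>2 + (cmod \<beta>)\<^sup>2 * (cmod (C2 \<omega> - \<gamma>))\<^sup>2" for \<omega>
  have t_nonneg: "0 \<le> t \<omega>" for \<omega> unfolding t_def by simp
  have [measurable]: "t \<in> borel_measurable M" unfolding t_def by measurable
  define bias where "bias = (cmod (h_star u * (\<gamma>\<^sup>2 - 1)))\<^sup>2"
  have pointwise: "(cmod (h_hat_star n \<Delta> (\<lambda>k. Z k \<omega>) u - h_star u))\<^sup>2 \<le> 6 / \<Delta>\<^sup>2 * t \<omega> + 6 * bias" for \<omega>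
  proof -
    have id: "\<alpha> * \<alpha> - \<beta> * \<gamma> = of_real \<Delta> * h_star u * \<gamma>\<^sup>2"
      unfolding \<alpha>_def \<beta>_def \<gamma>_def by (rule psi_identity)
    define x where "x = ((A1 \<omega> - \<alpha>) * A2 \<omega> + \<alpha> * (A2 \<omega> - \<alpha>)) / of_real \<Delta>"
    define y where "y = - ((B1 \<omega> - \<beta>) * C2 \<omega> + \<beta> * (C2 \<omega> - \<gamma>)) / of_real \<Delta>"
    define w where "w = h_star u * (\<gamma>\<^sup>2 - 1)"
    have "h_hat_star n \<Delta> (\<lambda>k. Z k \<omega>) u - h_star u = (A1 \<omega> * A2 \<omega> - B1 \<omega> * C2 \<omega>) / of_real \<Delta> - h_star u"
      unfolding h_hat_star_def A1_def A2_def B1_def C2_def ..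
    also have "A1 \<omega> * A2 \<omega> - B1 \<omega> * C2 \<omega> = ((A1 \<omega> - \<alpha>) * A2 \<omega> + \<alpha> * (A2 \<omega> - \<alpha>))
        - ((B1 \<omega> - \<beta>) * C2 \<omega> + \<beta> * (C2 \<omega> - \<gamma>)) + of_real \<Delta> * h_star u * \<gamma>\<^sup>2"
      unfolding id[symmetric] by (simp add: algebra_simps)
    also have "(p - q + of_real \<Delta> * c * g) / of_real \<Delta> - c = p / of_real \<Delta> + - q / of_real \<Delta> + c * (g - 1)"
      for p q c g :: complex
      using \<Delta> by (simp add: field_simps)
    finally have eq: "h_hat_star n \<Delta> (\<lambda>k. Z k \<omega>) u - h_star u = x + y + w"
      unfolding x_def y_def w_def .
    have x: "(cmod x)\<^sup>2 \<le> 2 / \<Delta>\<^sup>2 * ((cmod (A1 \<omega> - \<alpha>))\<^sup>2 * (cmod (A2 \<omega>))\<^sup>2 + (cmod \<alpha>)\<^sup>2 * (cmod (A2 \<omega> - \<alpha>))\<^sup>2)"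
      using norm_power2_sum2_le[of "(A1 \<omega> - \<alpha>) * A2 \<omega>" "\<alpha> * (A2 \<omega> - \<alpha>)"] \<Delta>
      unfolding x_def by (simp add: norm_divide norm_mult power_divide power_mult_distrib divide_right_mono)
    have C: "(cmod (C2 \<omega>))\<^sup>2 \<le> 1"
      using norm_psi_half_0_le[of 2 "\<lambda>k. Z k \<omega>" u] unfolding C2_def by (simp add: power_le_one)
    have "(cmod ((B1 \<omega> - \<beta>) * C2 \<omega> + \<beta> * (C2 \<omega> - \<gamma>)))\<^sup>2
        \<le> 2 * ((cmod (B1 \<omega> - \<beta>))\<^sup>2 * (cmod (C2 \<omega>))\<^sup>2 + (cmod \<beta>)\<^sup>2 * (cmod (C2 \<omega> - \<gamma>))\<^sup>2)"
      using norm_power2_sum2_le[of "(B1 \<omega> - \<beta>) * C2 \<omega>" "\<beta> * (C2 \<omega> - \<gamma>)"] by (simp add: norm_mult power_mult_distrib)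
    also have "\<dots> \<le> 2 * ((cmod (B1 \<omega> - \<beta>))\<^sup>2 * 1 + (cmod \<beta>)\<^sup>2 * (cmod (C2 \<omega> - \<gamma>))\<^sup>2)"
      using C by (intro mult_left_mono add_right_mono) auto
    finally have y: "(cmod y)\<^sup>2 \<le> 2 / \<Delta>\<^sup>2 * ((cmod (B1 \<omega> - \<beta>))\<^sup>2 + (cmod \<beta>)\<^sup>2 * (cmod (C2 \<omega> - \<gamma>))\<^sup>2)"
      unfolding y_def norm_divide norm_minus_cancel by (simp add: power_divide divide_right_mono)
    have "(cmod (x + y + w))\<^sup>2 \<le> 3 * ((cmod x)\<^sup>2 + (cmod y)\<^sup>2 + (cmod w)\<^sup>2)"
      by (rule norm_power2_sum3_le)
    also have "\<dots> \<le> 3 * (2 / \<Delta>\<^sup>2 * t \<omega> + bias)"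
      using x y unfolding t_def bias_def w_def by (simp add: distrib_left)
    also have "\<dots> \<le> 6 / \<Delta>\<^sup>2 * t \<omega> + 6 * bias" unfolding bias_def by simp
    finally show ?thesis unfolding eq .
  qed
  have "(\<integral>\<^sup>+\<omega>. ennreal (t \<omega>) \<partial>M) \<le> ennreal (?v * (2 * ?v + 2 * phi1_bound\<^sup>2) * \<Delta>\<^sup>2 / n + (phi1_bound * \<Delta>)\<^sup>2 * (?v * \<Delta> / n)
      + moment4_const * \<Delta> / n + (?v * \<Delta>)\<^sup>2 * (1 / n))"
    unfolding t_def
  proof (intro nn_integral_add_le)
    show "(\<integral>\<^sup>+\<omega>. ennreal ((cmod (A1 \<omega> - \<alpha>))\<^sup>2 * (cmod (A2 \<omega>))\<^sup>2) \<partial>M) \<le> ennreal (?v * (2 * ?v + 2 * phi1_bound\<^sup>2) * \<Delta>\<^sup>2 / n)"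
      unfolding A1_def A2_def \<alpha>_def by (rule first_product_error)
    have "(\<integral>\<^sup>+\<omega>. ennreal ((cmod \<alpha>)\<^sup>2 * (cmod (A2 \<omega> - \<alpha>))\<^sup>2) \<partial>M) \<le> ennreal ((cmod \<alpha>)\<^sup>2 * (?v * \<Delta> / n))"
      using psi_half_error(2)[of 2 u] unfolding A2_def[symmetric] \<alpha>_def[symmetric] by (intro nn_integral_cmult_le) auto
    also have "\<dots> \<le> ennreal ((phi1_bound * \<Delta>)\<^sup>2 * (?v * \<Delta> / n))"
      using norm_psi1_le[of u] v \<Delta> unfolding \<alpha>_def
      by (intro ennreal_leI mult_right_mono power_mono) auto
    finally show "(\<integral>\<^sup>+\<omega>. ennreal ((cmod \<alpha>)\<^sup>2 * (cmod (A2 \<omega> - \<alpha>))\<^sup>2) \<partial>M) \<le> ennreal ((phi1_bound * \<Delta>)\<^sup>2 * (?v * \<Delta> / n))" .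
    show "(\<integral>\<^sup>+\<omega>. ennreal ((cmod (B1 \<omega> - \<beta>))\<^sup>2) \<partial>M) \<le> ennreal (moment4_const * \<Delta> / n)"
      using psi_half_error(3)[of 1 u] unfolding B1_def \<beta>_def by simp
    have "(\<integral>\<^sup>+\<omega>. ennreal ((cmod \<beta>)\<^sup>2 * (cmod (C2 \<omega> - \<gamma>))\<^sup>2) \<partial>M) \<le> ennreal ((cmod \<beta>)\<^sup>2 * (1 / n))"
      using psi_half_error(1)[of 2 u] unfolding C2_def[symmetric] \<gamma>_def[symmetric] by (intro nn_integral_cmult_le) auto
    also have "\<dots> \<le> ennreal ((?v * \<Delta>)\<^sup>2 * (1 / n))"
      using norm_psi2_le[of u] unfolding \<beta>_def
      by (intro ennreal_leI mult_right_mono power_mono) auto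
    finally show "(\<integral>\<^sup>+\<omega>. ennreal ((cmod \<beta>)\<^sup>2 * (cmod (C2 \<omega> - \<gamma>))\<^sup>2) \<partial>M) \<le> ennreal ((?v * \<Delta>)\<^sup>2 * (1 / n))" .
  qed (use v \<Delta> constants_nonneg phi1_bound_nonneg in \<open>auto intro!: divide_nonneg_nonneg mult_nonneg_nonneg add_nonneg_nonneg\<close>)
  also have "\<dots> \<le> ennreal (\<Delta> / n * (variance_const / 6))"
  proof (rule ennreal_leI)
    have D2: "\<Delta>\<^sup>2 \<le> \<Delta>" "\<Delta> ^ 3 \<le> \<Delta>"
      using \<Delta> by (auto simp: power2_eq_square power3_eq_cube mult_left_le mult_le_one)
    have e1: "?v * (2 * ?v + 2 * phi1_bound\<^sup>2) * \<Delta>\<^sup>2 \<le> ?v * (2 * ?v + 2 * phi1_bound\<^sup>2) * \<Delta>"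
      using D2 v by (intro mult_left_mono) auto
    have e2: "phi1_bound\<^sup>2 * ?v * \<Delta> ^ 3 \<le> phi1_bound\<^sup>2 * ?v * \<Delta>" using D2 v by (intro mult_left_mono) auto
    have e3: "?v\<^sup>2 * \<Delta>\<^sup>2 \<le> ?v\<^sup>2 * \<Delta>" using D2 by (intro mult_left_mono) auto
    have "?v * (2 * ?v + 2 * phi1_bound\<^sup>2) * \<Delta>\<^sup>2 / n + (phi1_bound * \<Delta>)\<^sup>2 * (?v * \<Delta> / n) + moment4_const * \<Delta> / n + (?v * \<Delta>)\<^sup>2 * (1 / n)
      = (?v * (2 * ?v + 2 * phi1_bound\<^sup>2) * \<Delta>\<^sup>2 + phi1_bound\<^sup>2 * ?v * \<Delta> ^ 3 + moment4_const * \<Delta> + ?v\<^sup>2 * \<Delta>\<^sup>2) / n"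
      by (simp add: add_divide_distrib power_mult_distrib power3_eq_cube power2_eq_square ac_simps)
    also have "\<dots> \<le> (?v * (2 * ?v + 2 * phi1_bound\<^sup>2) * \<Delta> + phi1_bound\<^sup>2 * ?v * \<Delta> + moment4_const * \<Delta> + ?v\<^sup>2 * \<Delta>) / n"
      using e1 e2 e3 by (intro divide_right_mono add_mono) auto
    also have "(p * \<Delta> + q * \<Delta> + r * \<Delta> + s * \<Delta>) / n = \<Delta> / n * (6 * (p + q + r + s) / 6)" for p q r s
      by (simp add: algebra_simps add_divide_distrib)
    finally have "?v * (2 * ?v + 2 * phi1_bound\<^sup>2) * \<Delta>\<^sup>2 / n + (phi1_bound * \<Delta>)\<^sup>2 * (?v * \<Delta> / n) + moment4_const * \<Delta> / n + (?v * \<Delta>)\<^sup>2 * (1 / n)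
       \<le> \<Delta> / n * (variance_const / 6)" unfolding variance_const_def .
    then show "?v * (2 * ?v + 2 * phi1_bound\<^sup>2) * \<Delta>\<^sup>2 / n + (phi1_bound * \<Delta>)\<^sup>2 * (?v * \<Delta> / n) + moment4_const * \<Delta> / n + (?v * \<Delta>)\<^sup>2 * (1 / n)
       \<le> \<Delta> / n * (variance_const / 6)" .
  qed
  finally have T: "(\<integral>\<^sup>+\<omega>. ennreal (t \<omega>) \<partial>M) \<le> ennreal (\<Delta> / n * (variance_const / 6))" .
  have bias: "bias \<le> 36 * phi1_bound\<^sup>2 * \<Delta>\<^sup>2 * (u\<^sup>2 * (cmod (h_star u))\<^sup>2)"
  proof -
    have "cmod (\<gamma>\<^sup>2 - 1) = cmod (\<gamma> - 1) * cmod (\<gamma> + 1)"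
      unfolding norm_mult[symmetric] by (simp add: algebra_simps power2_eq_square)
    also have "\<dots> \<le> (3 * \<Delta> * phi1_bound * \<bar>u\<bar>) * 2"
    proof (intro mult_mono)
      show "cmod (\<gamma> - 1) \<le> 3 * \<Delta> * phi1_bound * \<bar>u\<bar>" unfolding \<gamma>_def by (rule norm_char_minus_1_le)
      show "cmod (\<gamma> + 1) \<le> 2"
        using norm_triangle_ineq[of \<gamma> 1] cmod_char_le_1[of u] unfolding \<gamma>_def by simp
    qed (use \<Delta> phi1_bound_nonneg in auto)
    finally have "(cmod (\<gamma>\<^sup>2 - 1))\<^sup>2 \<le> ((3 * \<Delta> * phi1_bound * \<bar>u\<bar>) * 2)\<^sup>2" by (intro power_mono) auto
    from mult_left_mono[OF this, of "(cmod (h_star u))\<^sup>2"] show ?thesis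
      unfolding bias_def norm_mult power_mult_distrib by (simp add: ac_simps)
  qed
  have "(\<integral>\<^sup>+\<omega>. ennreal ((cmod (h_hat_star n \<Delta> (\<lambda>k. Z k \<omega>) u - h_star u))\<^sup>2) \<partial>M)
      \<le> (\<integral>\<^sup>+\<omega>. ennreal (6 / \<Delta>\<^sup>2 * t \<omega> + 6 * bias) \<partial>M)"
    by (intro nn_integral_mono ennreal_leI pointwise)
  also have "\<dots> \<le> ennreal (6 / \<Delta>\<^sup>2 * (\<Delta> / n * (variance_const / 6)) + 6 * bias)"
  proof (rule nn_integral_add_le)
    show "(\<integral>\<^sup>+\<omega>. ennreal (6 / \<Delta>\<^sup>2 * t \<omega>) \<partial>M) \<le> ennreal (6 / \<Delta>\<^sup>2 * (\<Delta> / n * (variance_const / 6)))"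
      using T by (intro nn_integral_cmult_le) auto
    show "(\<integral>\<^sup>+\<omega>. ennreal (6 * bias) \<partial>M) \<le> ennreal (6 * bias)" by (simp add: P.emeasure_space_1)
  qed (use t_nonneg \<Delta> constants_nonneg in \<open>auto simp: bias_def\<close>)
  also have "\<dots> \<le> ennreal (variance_const / (n * \<Delta>) + 216 * phi1_bound\<^sup>2 * \<Delta>\<^sup>2 * (u\<^sup>2 * (cmod (h_star u))\<^sup>2))"
  proof (intro ennreal_leI add_mono)
    show "6 / \<Delta>\<^sup>2 * (\<Delta> / n * (variance_const / 6)) \<le> variance_const / (n * \<Delta>)"
      using \<Delta> by (simp add: power2_eq_square mult.commute)
    show "6 * bias \<le> 216 * phi1_bound\<^sup>2 * \<Delta>\<^sup>2 * (u\<^sup>2 * (cmod (h_star u))\<^sup>2)"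
      using mult_left_mono[OF bias, of 6] by (simp only: mult.assoc[symmetric]) simp
  qed
  finally show ?thesis .
qed

text \<open>
  Here the term \<open>\<Delta>\<^sup>2 phi1\<^sup>2 \<psi>\<close> of \<open>\<psi>''\<close> does not cancel. It contributes a squared bias \<open>O(\<Delta>\<^sup>2)\<close> at each
  frequency.
\<close>

lemma h_bar_star_pointwise_error:
  "(\<integral>\<^sup>+\<omega>. ennreal ((cmod (h_bar_star n \<Delta> (\<lambda>k. Z k \<omega>) u - h_star u))\<^sup>2) \<partial>M)
    \<le> ennreal (3 * moment4_const / (n * \<Delta>) + 27 * phi1_bound\<^sup>2 * \<Delta>\<^sup>2 * (u\<^sup>2 * (cmod (h_star u))\<^sup>2) + 3 * phi1_bound ^ 4 * \<Delta>\<^sup>2)"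
proof -
  define P2 where "P2 \<omega> = psi2_full n (\<lambda>k. Z k \<omega>) u" for \<omega>
  have [measurable]: "P2 \<in> borel_measurable M" unfolding P2_def by (rule psi2_full_measurable1)
  define bias where "bias = 9 * phi1_bound\<^sup>2 * \<Delta>\<^sup>2 * (u\<^sup>2 * (cmod (h_star u))\<^sup>2) + phi1_bound ^ 4 * \<Delta>\<^sup>2"
  have pointwise: "(cmod (h_bar_star n \<Delta> (\<lambda>k. Z k \<omega>) u - h_star u))\<^sup>2 \<le> 3 / \<Delta>\<^sup>2 * (cmod (P2 \<omega> - psi2 u))\<^sup>2 + 3 * bias" for \<omega>
  proof -
    define x where "x = - (P2 \<omega> - psi2 u) / of_real \<Delta>"
    define y where "y = h_star u * (char \<mu> u - 1)"
    define w where "w = - (of_real \<Delta> * (phi1 u * phi1 u) * char \<mu> u)"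
    have eq: "h_bar_star n \<Delta> (\<lambda>k. Z k \<omega>) u - h_star u = x + y + w"
      using \<Delta> unfolding x_def y_def w_def h_bar_star_def P2_def psi2_eq by (simp add: field_simps)
    have x: "(cmod x)\<^sup>2 = 1 / \<Delta>\<^sup>2 * (cmod (P2 \<omega> - psi2 u))\<^sup>2"
      unfolding x_def by (simp add: norm_divide power_divide norm_minus_commute)
    have "(cmod (char \<mu> u - 1))\<^sup>2 \<le> (3 * \<Delta> * phi1_bound * \<bar>u\<bar>)\<^sup>2"
      by (intro power_mono norm_char_minus_1_le) simp
    from mult_left_mono[OF this, of "(cmod (h_star u))\<^sup>2"]
    have y: "(cmod y)\<^sup>2 \<le> 9 * phi1_bound\<^sup>2 * \<Delta>\<^sup>2 * (u\<^sup>2 * (cmod (h_star u))\<^sup>2)"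
      unfolding y_def norm_mult power_mult_distrib by (simp add: ac_simps)
    have "cmod w \<le> \<Delta> * (phi1_bound * phi1_bound) * 1"
      unfolding w_def norm_minus_cancel norm_mult using \<Delta> phi1_bound_nonneg norm_phi1_le[of u] cmod_char_le_1[of u]
      by (intro mult_mono) auto
    then have "(cmod w)\<^sup>2 \<le> (\<Delta> * (phi1_bound * phi1_bound) * 1)\<^sup>2" by (intro power_mono) auto
    then have w: "(cmod w)\<^sup>2 \<le> phi1_bound ^ 4 * \<Delta>\<^sup>2" by (simp add: power_mult_distrib mult.commute flip: power_add)
    have "(cmod (x + y + w))\<^sup>2 \<le> 3 * ((cmod x)\<^sup>2 + (cmod y)\<^sup>2 + (cmod w)\<^sup>2)"
      by (rule norm_power2_sum3_le)
    also have "\<dots> \<le> 3 * (1 / \<Delta>\<^sup>2 * (cmod (P2 \<omega> - psi2 u))\<^sup>2 + bias)"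
      using x y w unfolding bias_def by (intro mult_left_mono) auto
    finally show ?thesis unfolding eq by (simp add: distrib_left)
  qed
  have b0: "0 \<le> bias" unfolding bias_def by (auto intro!: add_nonneg_nonneg mult_nonneg_nonneg)
  have "(\<integral>\<^sup>+\<omega>. ennreal ((cmod (h_bar_star n \<Delta> (\<lambda>k. Z k \<omega>) u - h_star u))\<^sup>2) \<partial>M)
      \<le> (\<integral>\<^sup>+\<omega>. ennreal (3 / \<Delta>\<^sup>2 * (cmod (P2 \<omega> - psi2 u))\<^sup>2 + 3 * bias) \<partial>M)"
    by (intro nn_integral_mono ennreal_leI pointwise)
  also have "\<dots> \<le> ennreal (3 / \<Delta>\<^sup>2 * (moment4_const * \<Delta> / n) + 3 * bias)"
  proof (rule nn_integral_add_le)
    show "(\<integral>\<^sup>+\<omega>. ennreal (3 / \<Delta>\<^sup>2 * (cmod (P2 \<omega> - psi2 u))\<^sup>2) \<partial>M) \<le> ennreal (3 / \<Delta>\<^sup>2 * (moment4_const * \<Delta> / n))"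
      using psi2_full_error[of u] unfolding P2_def[symmetric] by (intro nn_integral_cmult_le) auto
    show "(\<integral>\<^sup>+\<omega>. ennreal (3 * bias) \<partial>M) \<le> ennreal (3 * bias)" by (simp add: P.emeasure_space_1)
  qed (use b0 \<Delta> constants_nonneg in auto)
  also have "3 / \<Delta>\<^sup>2 * (moment4_const * \<Delta> / n) + 3 * bias = 3 * moment4_const / (n * \<Delta>) + 27 * phi1_bound\<^sup>2 * \<Delta>\<^sup>2 * (u\<^sup>2 * (cmod (h_star u))\<^sup>2) + 3 * phi1_bound ^ 4 * \<Delta>\<^sup>2"
    using \<Delta> unfolding bias_def by (simp add: power2_eq_square field_simps)
  finally show ?thesis .
qed

end

section \<open>Nonasymptotic risk bounds\<close>

lemma integrable_one_plus_square_powr: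
  fixes a :: real
  assumes a: "a > 1 / 2"
  shows "integrable lborel (\<lambda>u. (1 + u\<^sup>2) powr (- a))"
proof -
  define f where "f u = (1 + u) powr (- (2 * a))" for u :: real
  define g where "g u = f u * indicator {0..} u" for u :: real
  have [measurable]: "f \<in> borel_measurable borel" unfolding f_def by measurable
  have [measurable]: "g \<in> borel_measurable borel" unfolding g_def by measurable
  have g0: "0 \<le> g u" for u unfolding g_def f_def by simp
  have "(\<integral>\<^sup>+u. ennreal (g u) \<partial>lborel) = (\<integral>\<^sup>+u. ennreal (f u) * indicator {0..} u \<partial>lborel)"
    unfolding g_def by (intro nn_integral_cong) (auto split: split_indicator)
  also have "\<dots> = ennreal (0 - (1 + 0) powr (1 - 2 * a) / (1 - 2 * a))"
  proof (rule nn_integral_FTC_atLeast)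
    show "DERIV (\<lambda>u. (1 + u) powr (1 - 2 * a) / (1 - 2 * a)) u :> f u" if "0 \<le> u" for u
    proof -
      have "DERIV (\<lambda>u. (1 + u) powr (1 - 2 * a)) u :> (1 - 2 * a) * f u"
        using that unfolding f_def by (auto intro!: derivative_eq_intros)
      from DERIV_cdivide[OF this, of "1 - 2 * a"] show ?thesis using a by simp
    qed
    have "((\<lambda>u. (1 + u) powr - (2 * a - 1)) \<longlongrightarrow> 0) at_top"
      using a by (intro tendsto_neg_powr filterlim_tendsto_add_at_top[OF tendsto_const] filterlim_ident) auto
    from tendsto_divide[OF this tendsto_const, of "1 - 2 * a"]
    show "((\<lambda>u. (1 + u) powr (1 - 2 * a) / (1 - 2 * a)) \<longlongrightarrow> 0) at_top" using a by simp
  qed (auto simp: f_def)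
  finally have g: "integrable lborel g"
    using g0 by (intro integrableI_nonneg) auto
  show ?thesis
  proof (rule Bochner_Integration.integrable_bound)
    show "integrable lborel (\<lambda>u. 2 powr a * (g u + g (0 + (-1) * u)))"
      using g lborel_integrable_real_affine[OF g, of "-1" 0] by simp
    have "(1 + u\<^sup>2) powr (- a) \<le> 2 powr a * (g u + g (- u))" for u
    proof -
      have "(1 + \<bar>u\<bar>)\<^sup>2 / 2 \<le> 1 + u\<^sup>2"
        using zero_le_power2[of "1 - \<bar>u\<bar>"] by (simp add: power2_sum power2_diff)
      then have "(1 + u\<^sup>2) powr (- a) \<le> ((1 + \<bar>u\<bar>)\<^sup>2 / 2) powr (- a)"
        using a by (intro powr_mono2') auto
      also have "\<dots> = (1 + \<bar>u\<bar>) powr (- (2 * a)) * 2 powr a"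
        by (simp add: powr_divide powr_minus powr_powr field_simps flip: powr_numeral)
      also have "(1 + \<bar>u\<bar>) powr (- (2 * a)) \<le> g u + g (- u)"
        unfolding g_def f_def by (auto split: split_indicator)
      finally show ?thesis by (simp add: mult.commute mult_left_mono)
    qed
    then show "AE u in lborel. norm ((1 + u\<^sup>2) powr (- a)) \<le> norm (2 powr a * (g u + g (0 + (-1) * u)))"
      using g0 by (intro AE_I2) simp
  qed measurable
qed

text \<open>
  The geometric mean of the integrable functions \<open>(1 + u\<^sup>2)\<^sup>a \<bar>F(u)\<bar>\<^sup>2\<close> and \<open>(1 + u\<^sup>2)\<^bsup>- a\<^esup>\<close> is \<open>\<bar>F(u)\<bar>\<close>.
\<close>

lemma integrable_of_weighted_L2:
  fixes F :: "real \<Rightarrow> complex"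
  assumes a: "a > 1 / 2" and [measurable]: "F \<in> borel_measurable borel"
    and R: "(\<integral>\<^sup>+u. ennreal ((1 + u\<^sup>2) powr a * (cmod (F u))\<^sup>2) \<partial>lborel) \<le> ennreal R"
  shows "integrable lborel F"
proof (rule Bochner_Integration.integrable_bound)
  have "integrable lborel (\<lambda>u. (1 + u\<^sup>2) powr a * (cmod (F u))\<^sup>2)"
    using R by (intro integrableI_nonneg) (auto intro: le_less_trans)
  then show "integrable lborel (\<lambda>u. (1 + u\<^sup>2) powr a * (cmod (F u))\<^sup>2 + (1 + u\<^sup>2) powr (- a))"
    using integrable_one_plus_square_powr[OF a] by simp
  have "cmod (F u) \<le> (1 + u\<^sup>2) powr a * (cmod (F u))\<^sup>2 + (1 + u\<^sup>2) powr (- a)" for u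
  proof -
    define w where "w = (1 + u\<^sup>2) powr (a / 2)"
    have "1 + u\<^sup>2 \<noteq> 0" by (smt (verit) zero_le_power2)
    then have w: "0 < w" unfolding w_def by simp
    have w2: "(1 + u\<^sup>2) powr a = w\<^sup>2" "(1 + u\<^sup>2) powr (- a) = (1 / w)\<^sup>2"
      using powr_add[of "1 + u\<^sup>2" "a / 2" "a / 2"] unfolding w_def
      by (simp_all add: power2_eq_square powr_minus field_simps)
    have "2 * (w * cmod (F u)) * (1 / w) \<le> (w * cmod (F u))\<^sup>2 + (1 / w)\<^sup>2" by (rule sum_squares_bound)
    moreover have "2 * (w * cmod (F u)) * (1 / w) = 2 * cmod (F u)" using w by simp
    ultimately show ?thesis unfolding w2 power_mult_distrib using norm_ge_zero[of "F u"] by linarith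
  qed
  then show "AE u in lborel. norm (F u) \<le> norm ((1 + u\<^sup>2) powr a * (cmod (F u))\<^sup>2 + (1 + u\<^sup>2) powr (- a))"
    by (intro AE_I2) (auto intro: order_trans)
qed simp

locale smooth_levy_exponent = square_integrable_levy_exponent +
  fixes a R :: real
  assumes a: "1 / 2 < a" and R: "0 < R"
    and smooth: "(\<integral>\<^sup>+u. ennreal ((1 + u\<^sup>2) powr a * (cmod (h_star u))\<^sup>2) \<partial>lborel) \<le> ennreal R"
begin

lemma weighted_bound:
  fixes k :: "real \<Rightarrow> real"
  assumes "k \<in> borel_measurable borel" "0 \<le> B" "\<And>u. k u \<le> B * (1 + u\<^sup>2) powr a"
  shows "(\<integral>\<^sup>+u. ennreal (k u * (cmod (h_star u))\<^sup>2) \<partial>lborel) \<le> ennreal (B * R)"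
proof -
  have "(\<integral>\<^sup>+u. ennreal (k u * (cmod (h_star u))\<^sup>2) \<partial>lborel)
      \<le> (\<integral>\<^sup>+u. ennreal (B * ((1 + u\<^sup>2) powr a * (cmod (h_star u))\<^sup>2)) \<partial>lborel)"
    using mult_right_mono[OF assms(3) zero_le_power2] by (intro nn_integral_mono ennreal_leI) (simp add: mult.assoc)
  also have "\<dots> \<le> ennreal (B * R)"
    using assms(2) smooth by (intro nn_integral_cmult_le) auto
  finally show ?thesis .
qed

lemma tail_bound:
  assumes "0 \<le> c"
  shows "(\<integral>\<^sup>+u. ennreal (indicator (- {-c..c}) u * (cmod (h_star u))\<^sup>2) \<partial>lborel) \<le> ennreal ((1 + c\<^sup>2) powr (- a) * R)"
proof (rule weighted_bound)
  fix u :: real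
  show "indicator (- {-c..c}) u \<le> (1 + c\<^sup>2) powr (- a) * (1 + u\<^sup>2) powr a"
  proof (cases "u \<in> {-c..c}")
    case False
    then have "c \<le> \<bar>u\<bar>" by auto
    then have "c\<^sup>2 \<le> u\<^sup>2" using assms by (metis abs_le_square_iff abs_of_nonneg)
    then have "(1 + c\<^sup>2) powr a \<le> (1 + u\<^sup>2) powr a" using a by (intro powr_mono2) auto
    moreover have "1 + c\<^sup>2 \<noteq> 0" by (smt (verit) zero_le_power2)
    then have "0 < (1 + c\<^sup>2) powr a" by simp
    ultimately show ?thesis using False by (simp add: powr_minus field_simps)
  qed simp
qed auto

text \<open>
  On \<open>[- c, c]\<close>, \<open>u\<^sup>2 \<le> (1 + u\<^sup>2)\<^sup>a\<close> if \<open>a \<ge> 1\<close>; otherwise the missing power \<open>1 - a\<close> of \<open>1 + u\<^sup>2\<close> is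
  bounded by its value at \<open>c\<close>.
\<close>

lemma low_frequency_bound:
  assumes "0 \<le> c"
  shows "(\<integral>\<^sup>+u. ennreal (indicator {-c..c} u * u\<^sup>2 * (cmod (h_star u))\<^sup>2) \<partial>lborel) \<le> ennreal ((1 + c\<^sup>2) powr (max 0 (1 - a)) * R)"
proof (rule weighted_bound)
  fix u :: real
  show "indicator {-c..c} u * u\<^sup>2 \<le> (1 + c\<^sup>2) powr (max 0 (1 - a)) * (1 + u\<^sup>2) powr a"
  proof (cases "u \<in> {-c..c}")
    case True
    then have "\<bar>u\<bar> \<le> c" by auto
    then have "u\<^sup>2 \<le> c\<^sup>2" using assms by (metis abs_le_square_iff abs_of_nonneg)
    have "u\<^sup>2 \<le> (1 + u\<^sup>2) powr 1" by simp
    also have "\<dots> \<le> (1 + u\<^sup>2) powr (max 0 (1 - a) + a)" by (intro powr_mono) auto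
    also have "\<dots> = (1 + u\<^sup>2) powr (max 0 (1 - a)) * (1 + u\<^sup>2) powr a" by (rule powr_add)
    also have "\<dots> \<le> (1 + c\<^sup>2) powr (max 0 (1 - a)) * (1 + u\<^sup>2) powr a"
      using \<open>u\<^sup>2 \<le> c\<^sup>2\<close> by (intro mult_right_mono powr_mono2) auto
    finally show ?thesis using True by simp
  qed simp
qed auto

text \<open>
  Tonelli's theorem exchanges expectation and frequency integral: frequencies up to \<open>\<pi> m\<close> contribute the
  pointwise error, the others the energy of \<open>h_star\<close> there.
\<close>

lemma L2_risk_cutoff_le:
  fixes g :: "'b \<Rightarrow> real \<Rightarrow> complex"
  assumes "prob_space M" and m: "0 \<le> m"
    and cont: "\<And>\<omega>. continuous_on UNIV (g \<omega>)"
    and meas: "(\<lambda>p. g (fst p) (snd p)) \<in> borel_measurable (M \<Otimes>\<^sub>M borel)"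
    and AB: "0 \<le> A" "0 \<le> B"
    and error: "\<And>u. (\<integral>\<^sup>+\<omega>. ennreal ((cmod (g \<omega> u - h_star u))\<^sup>2) \<partial>M) \<le> ennreal (A + B * (u\<^sup>2 * (cmod (h_star u))\<^sup>2))"
  shows "L2_risk M (\<lambda>\<omega>. cutoff_inverse m (g \<omega>)) (\<lambda>x. x\<^sup>2 * \<nu> x)
    \<le> ennreal (m * A + B * R * (1 + (pi * m)\<^sup>2) powr (max 0 (1 - a)) + R * (1 + (pi * m)\<^sup>2) powr (- a))"
proof -
  interpret M: prob_space M by fact
  interpret pair: pair_sigma_finite M lborel by standard
  define c where "c = pi * m"
  have c: "0 \<le> c" unfolding c_def using m by simp
  have [measurable]: "(\<lambda>p. g (fst p) (snd p)) \<in> borel_measurable (M \<Otimes>\<^sub>M borel)" by (rule meas)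
  define E where "E \<omega> u = ennreal ((cmod (indicator {-c..c} u * g \<omega> u - h_star u))\<^sup>2)" for \<omega> u
  have E: "case_prod E \<in> borel_measurable (M \<Otimes>\<^sub>M lborel)"
    unfolding E_def split_beta by measurable
  have "L2_risk M (\<lambda>\<omega>. cutoff_inverse m (g \<omega>)) (\<lambda>x. x\<^sup>2 * \<nu> x)
    \<le> (\<integral>\<^sup>+\<omega>. ennreal (1 / (2 * pi)) * (\<integral>\<^sup>+u. E \<omega> u \<partial>lborel) \<partial>M)"
    unfolding L2_risk_def E_def h_star_def c_def
    using moment2 nu_nonneg fourier_h_integrable cont
    by (intro nn_integral_mono L2_error_cutoff_inverse_le) auto
  also have "\<dots> = ennreal (1 / (2 * pi)) * (\<integral>\<^sup>+\<omega>. (\<integral>\<^sup>+u. E \<omega> u \<partial>lborel) \<partial>M)"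
    using E by (intro nn_integral_cmult lborel.borel_measurable_nn_integral)
  also have "(\<integral>\<^sup>+\<omega>. (\<integral>\<^sup>+u. E \<omega> u \<partial>lborel) \<partial>M) = (\<integral>\<^sup>+u. (\<integral>\<^sup>+\<omega>. E \<omega> u \<partial>M) \<partial>lborel)"
    by (rule pair.Fubini'[OF E, symmetric])
  also have "\<dots> \<le> (\<integral>\<^sup>+u. ennreal (A * indicator {-c..c} u + B * (indicator {-c..c} u * u\<^sup>2 * (cmod (h_star u))\<^sup>2)
      + indicator (- {-c..c}) u * (cmod (h_star u))\<^sup>2) \<partial>lborel)"
  proof (rule nn_integral_mono)
    fix u
    show "(\<integral>\<^sup>+\<omega>. E \<omega> u \<partial>M) \<le> ennreal (A * indicator {-c..c} u + B * (indicator {-c..c} u * u\<^sup>2 * (cmod (h_star u))\<^sup>2)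
      + indicator (- {-c..c}) u * (cmod (h_star u))\<^sup>2)"
      using error[of u] by (cases "u \<in> {-c..c}") (simp_all add: E_def M.emeasure_space_1)
  qed
  also have "\<dots> \<le> ennreal (A * (2 * c) + B * ((1 + c\<^sup>2) powr (max 0 (1 - a)) * R) + (1 + c\<^sup>2) powr (- a) * R)"
  proof (intro nn_integral_add_le nn_integral_cmult_le tail_bound low_frequency_bound)
    show "(\<integral>\<^sup>+u. ennreal (indicator {-c..c} u) \<partial>lborel) \<le> ennreal (2 * c)"
      using c by (simp add: ennreal_indicator)
  qed (use AB c R in auto)
  finally have "L2_risk M (\<lambda>\<omega>. cutoff_inverse m (g \<omega>)) (\<lambda>x. x\<^sup>2 * \<nu> x)
     \<le> ennreal (1 / (2 * pi)) * ennreal (A * (2 * c) + B * ((1 + c\<^sup>2) powr (max 0 (1 - a)) * R) + (1 + c\<^sup>2) powr (- a) * R)"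
    by (simp add: mult_left_mono)
  also have "\<dots> = ennreal (1 / (2 * pi) * (A * (2 * c) + B * ((1 + c\<^sup>2) powr (max 0 (1 - a)) * R) + (1 + c\<^sup>2) powr (- a) * R))"
    by (rule ennreal_mult'[symmetric]) simp
  also have "\<dots> \<le> ennreal (m * A + B * R * (1 + c\<^sup>2) powr (max 0 (1 - a)) + R * (1 + c\<^sup>2) powr (- a))"
  proof (rule ennreal_leI)
    have p: "0 \<le> 1 / (2 * pi)" "1 / (2 * pi) \<le> 1" using pi_gt3 by (simp_all add: field_simps)
    have "1 / (2 * pi) * (A * (2 * c)) = m * A" unfolding c_def by simp
    moreover have "1 / (2 * pi) * (B * ((1 + c\<^sup>2) powr (max 0 (1 - a)) * R) + (1 + c\<^sup>2) powr (- a) * R)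
        \<le> 1 * (B * ((1 + c\<^sup>2) powr (max 0 (1 - a)) * R) + (1 + c\<^sup>2) powr (- a) * R)"
      using p AB R by (intro mult_right_mono) auto
    ultimately show "1 / (2 * pi) * (A * (2 * c) + B * ((1 + c\<^sup>2) powr (max 0 (1 - a)) * R) + (1 + c\<^sup>2) powr (- a) * R)
       \<le> m * A + B * R * (1 + c\<^sup>2) powr (max 0 (1 - a)) + R * (1 + c\<^sup>2) powr (- a)"
      by (simp add: distrib_left ac_simps)
  qed
  finally show ?thesis unfolding c_def .
qed

end

locale iid_smooth_levy_sample = iid_levy_sample b \<sigma> \<nu> \<mu> \<Delta> M Z n + smooth_levy_exponent b \<sigma> \<nu> a R
  for b \<sigma> :: real and \<nu> :: "real \<Rightarrow> real" and \<mu> :: "real measure" and \<Delta> :: real and M :: "'a measure"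
    and Z :: "nat \<Rightarrow> 'a \<Rightarrow> real" and n :: nat and a R :: real
begin

lemma risk_h_hat_le:
  assumes "0 \<le> m"
  shows "L2_risk M (\<lambda>\<omega>. h_hat n \<Delta> m (\<lambda>k. Z k \<omega>)) (\<lambda>x. x\<^sup>2 * \<nu> x)
    \<le> ennreal (m * (variance_const / (n * \<Delta>)) + 216 * phi1_bound\<^sup>2 * \<Delta>\<^sup>2 * R * (1 + (pi * m)\<^sup>2) powr (max 0 (1 - a))
        + R * (1 + (pi * m)\<^sup>2) powr (- a))"
  unfolding h_hat_def
proof (rule L2_risk_cutoff_le[OF P.prob_space_axioms assms _ _ _ _ h_hat_star_pointwise_error])
  show "continuous_on UNIV (h_hat_star n \<Delta> (\<lambda>k. Z k \<omega>))" for \<omega>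
    unfolding h_hat_star_def[abs_def] psi_half_def using \<Delta> n by (intro continuous_intros) auto
  show "(\<lambda>p. h_hat_star n \<Delta> (\<lambda>k. Z k (fst p)) (snd p)) \<in> borel_measurable (M \<Otimes>\<^sub>M borel)"
    unfolding h_hat_star_def using psi_half_measurable[of 1] psi_half_measurable[of 2]
    by (intro borel_measurable_divide borel_measurable_diff borel_measurable_times) auto
qed (use constants_nonneg \<Delta> in auto)

lemma risk_h_bar_le:
  assumes "0 \<le> m"
  shows "L2_risk M (\<lambda>\<omega>. h_bar n \<Delta> m (\<lambda>k. Z k \<omega>)) (\<lambda>x. x\<^sup>2 * \<nu> x)
    \<le> ennreal (m * (3 * moment4_const / (n * \<Delta>) + 3 * phi1_bound ^ 4 * \<Delta>\<^sup>2) + 27 * phi1_bound\<^sup>2 * \<Delta>\<^sup>2 * R * (1 + (pi * m)\<^sup>2) powr (max 0 (1 - a))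
        + R * (1 + (pi * m)\<^sup>2) powr (- a))"
  unfolding h_bar_def
proof (rule L2_risk_cutoff_le[OF P.prob_space_axioms assms])
  show "continuous_on UNIV (h_bar_star n \<Delta> (\<lambda>k. Z k \<omega>))" for \<omega>
    unfolding h_bar_star_def[abs_def] psi2_full_def using \<Delta> n by (intro continuous_intros) auto
  show "(\<lambda>p. h_bar_star n \<Delta> (\<lambda>k. Z k (fst p)) (snd p)) \<in> borel_measurable (M \<Otimes>\<^sub>M borel)"
    unfolding h_bar_star_def using psi2_full_measurable
    by (intro borel_measurable_divide borel_measurable_uminus) auto
  show "(\<integral>\<^sup>+\<omega>. ennreal ((cmod (h_bar_star n \<Delta> (\<lambda>k. Z k \<omega>) u - h_star u))\<^sup>2) \<partial>M)
    \<le> ennreal (3 * moment4_const / (n * \<Delta>) + 3 * phi1_bound ^ 4 * \<Delta>\<^sup>2 + 27 * phi1_bound\<^sup>2 * \<Delta>\<^sup>2 * (u\<^sup>2 * (cmod (h_star u))\<^sup>2))" for u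
    using h_bar_star_pointwise_error[of u] by (simp add: ac_simps)
qed (use constants_nonneg \<Delta> in auto)

end

section \<open>Rates of convergence\<close>

text \<open>
  Here \<open>N\<close> stands for \<open>n \<Delta>\<close> and \<open>D\<close> for \<open>\<Delta>\<close>, so the two regimes are \<open>n \<Delta>\<^sup>2 \<le> 1\<close> and \<open>n \<Delta>\<^sup>3 \<le> 1\<close>. Either
  gives \<open>D\<^sup>2 \<le> 1 / N\<close>, which suffices except in the last bound for \<open>a < 1\<close>. That case uses
  \<open>D\<^sup>2 \<le> N\<^sup>-\<^sup>2\<close>, which the first regime provides.
\<close>

lemma rate_comparison:
  fixes a N D m c C :: real
  defines "p \<equiv> 1 / (2 * a + 1)"
  defines "r \<equiv> N powr (- (2 * a / (2 * a + 1)))"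
  assumes a: "1 / 2 < a" and N: "1 \<le> N" and D: "0 < D"
    and c: "0 < c" and C: "0 < C" and m: "c * N powr p \<le> m" "m \<le> C * N powr p"
    and regime: "N * D \<le> 1 \<or> 1 \<le> a \<and> N * D\<^sup>2 \<le> 1"
    and D1: "D \<le> 1"
  shows "m / N \<le> C * r"
    and "m * D\<^sup>2 \<le> C * r"
    and "(1 + (pi * m)\<^sup>2) powr (- a) \<le> c powr (- (2 * a)) * r"
    and "D\<^sup>2 * (1 + (pi * m)\<^sup>2) powr (max 0 (1 - a)) \<le> (1 + (pi * C)\<^sup>2) * r"
proof -
  have p: "0 < p" "p \<le> 1" "p - 1 = - (2 * a / (2 * a + 1))" "- (2 * a / (2 * a + 1)) = - (2 * a * p)"
    using a unfolding p_def by (simp_all add: field_simps)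
  have Np: "1 \<le> N powr p" using N p by (simp add: ge_one_powr_ge_zero)
  have m0: "0 < m" using c Np m(1) by (meson less_le_trans mult_pos_pos zero_less_one)
  have r: "N powr p / N = r" using N powr_diff[of N p 1] unfolding r_def p(3)[symmetric] by simp
  have mN: "m / N \<le> C * r"
    using divide_right_mono[OF m(2), of N] N r by (simp add: field_simps)
  show "m / N \<le> C * r" by (rule mN)
  have ND: "N * D\<^sup>2 \<le> 1"
    using regime
  proof
    assume "N * D \<le> 1"
    then have "N * D * D \<le> 1 * 1" using D D1 N by (intro mult_mono) auto
    then show ?thesis by (simp add: power2_eq_square mult.assoc)
  qed simp
  then have D2: "D\<^sup>2 \<le> 1 / N" using N by (simp add: field_simps)
  have "m * D\<^sup>2 \<le> m * (1 / N)" using D2 m0 by (intro mult_left_mono) auto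
  then show "m * D\<^sup>2 \<le> C * r" using mN by simp
  have "(c * N powr p)\<^sup>2 \<le> 1 + (pi * m)\<^sup>2"
  proof -
    have "c * N powr p \<le> pi * m"
    proof -
      have "1 * m \<le> pi * m" using m0 pi_gt3 by (intro mult_right_mono) auto
      then show ?thesis using m(1) by simp
    qed
    then have "(c * N powr p)\<^sup>2 \<le> (pi * m)\<^sup>2" using c by (intro power_mono) auto
    then show ?thesis by simp
  qed
  then have "(1 + (pi * m)\<^sup>2) powr (- a) \<le> ((c * N powr p)\<^sup>2) powr (- a)"
    using a c N by (intro powr_mono2') auto
  also have "\<dots> = c powr (- (2 * a)) * r"
    using c N unfolding r_def p(4)
    by (simp add: powr_mult powr_powr power_mult_distrib ac_simps flip: powr_numeral)
  finally show "(1 + (pi * m)\<^sup>2) powr (- a) \<le> c powr (- (2 * a)) * r" .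
  have ge1: "1 \<le> 1 + (pi * C)\<^sup>2" by simp
  show "D\<^sup>2 * (1 + (pi * m)\<^sup>2) powr (max 0 (1 - a)) \<le> (1 + (pi * C)\<^sup>2) * r"
  proof (cases "1 \<le> a")
    case True
    have "1 + (pi * m)\<^sup>2 \<noteq> 0" by (smt (verit) zero_le_power2)
    then have "D\<^sup>2 * (1 + (pi * m)\<^sup>2) powr (max 0 (1 - a)) = D\<^sup>2" using True by simp
    also have "\<dots> \<le> N powr (-1)" using D2 N by (simp add: powr_minus divide_inverse)
    also have "\<dots> \<le> r" unfolding r_def using N a by (intro powr_mono) (auto simp: field_simps)
    also have "\<dots> \<le> (1 + (pi * C)\<^sup>2) * r" using mult_right_mono[OF ge1, of r] unfolding r_def by simp
    finally show ?thesis .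
  next
    case False
    then have ND1: "N * D \<le> 1" using regime by simp
    have "D \<le> 1 / N" using ND1 N by (simp add: field_simps)
    then have "D\<^sup>2 \<le> (1 / N)\<^sup>2" using D by (intro power_mono) auto
    also have "\<dots> = N powr (-2)" using N by (simp add: powr_minus power_one_over inverse_eq_divide)
    finally have D2': "D\<^sup>2 \<le> N powr (-2)" .
    have "1 + (pi * m)\<^sup>2 \<le> (N powr p)\<^sup>2 + (pi * C)\<^sup>2 * (N powr p)\<^sup>2"
    proof (intro add_mono)
      show "1 \<le> (N powr p)\<^sup>2" using Np by (simp add: one_le_power)
      have "pi * m \<le> pi * (C * N powr p)" using m(2) by (intro mult_left_mono) auto
      then have "(pi * m)\<^sup>2 \<le> (pi * (C * N powr p))\<^sup>2" using m0 by (intro power_mono) auto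
      then show "(pi * m)\<^sup>2 \<le> (pi * C)\<^sup>2 * (N powr p)\<^sup>2" by (simp add: power_mult_distrib mult.assoc)
    qed
    also have "\<dots> = (1 + (pi * C)\<^sup>2) * N powr (2 * p)"
      using N by (simp add: algebra_simps powr_powr flip: powr_numeral)
    finally have "(1 + (pi * m)\<^sup>2) powr (1 - a) \<le> ((1 + (pi * C)\<^sup>2) * N powr (2 * p)) powr (1 - a)"
      using False by (intro powr_mono2) auto
    also have "\<dots> = (1 + (pi * C)\<^sup>2) powr (1 - a) * N powr (2 * p * (1 - a))"
      using N by (simp add: powr_mult powr_powr)
    also have "\<dots> \<le> (1 + (pi * C)\<^sup>2) powr 1 * N powr (2 * p * (1 - a))"
      using a False by (intro mult_right_mono powr_mono) auto
    finally have P: "(1 + (pi * m)\<^sup>2) powr (1 - a) \<le> (1 + (pi * C)\<^sup>2) * N powr (2 * p * (1 - a))" by simp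
    have "D\<^sup>2 * (1 + (pi * m)\<^sup>2) powr (max 0 (1 - a)) \<le> N powr (-2) * ((1 + (pi * C)\<^sup>2) * N powr (2 * p * (1 - a)))"
      using False P D2' by (intro mult_mono) auto
    also have "\<dots> = (1 + (pi * C)\<^sup>2) * N powr (2 * p * (1 - a) - 2)"
      using N by (simp add: ac_simps flip: powr_add)
    also have "\<dots> \<le> (1 + (pi * C)\<^sup>2) * r"
    proof (intro mult_left_mono)
      have "2 * p * (1 - a) - 2 \<le> - (2 * a * p)" using p by (simp add: algebra_simps)
      then show "N powr (2 * p * (1 - a) - 2) \<le> r" unfolding r_def p(4) using N by (intro powr_mono) auto
    qed simp
    finally show ?thesis .
  qed
qed

lemma levy_increments_iid:
  assumes levy: "levy_process M L" and \<Delta>: "0 < \<Delta>"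
  shows "prob_space.indep_vars M (\<lambda>_. borel) (\<lambda>k \<omega>. increment L \<Delta> \<omega> k) {1..N}"
    and "k \<in> {1..N} \<Longrightarrow> distr M borel (\<lambda>\<omega>. increment L \<Delta> \<omega> k) = distr M borel (L \<Delta>)"
proof -
  interpret levy_process M L by fact
  \<comment> \<open>The truncated \<open>i - 1\<close> aligns the index with that of \<open>increment\<close>, at the price of a
    trivial increment at \<open>i = 0\<close>.\<close>
  have "mono (\<lambda>i::nat. real (i - 1) * \<Delta>)" using \<Delta> by (intro monoI mult_right_mono) auto
  then have "indep_vars (\<lambda>_. borel) (\<lambda>i \<omega>. L (real (Suc i - 1) * \<Delta>) \<omega> - L (real (i - 1) * \<Delta>) \<omega>) {..<Suc N}"
    by (intro indep_increments) auto
  then have "indep_vars (\<lambda>_. borel) (\<lambda>i \<omega>. L (real (Suc i - 1) * \<Delta>) \<omega> - L (real (i - 1) * \<Delta>) \<omega>) {1..N}"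
    by (rule indep_vars_subset) auto
  also have "?this \<longleftrightarrow> indep_vars (\<lambda>_. borel) (\<lambda>k \<omega>. increment L \<Delta> \<omega> k) {1..N}"
    by (intro indep_vars_cong) (auto simp: increment_def of_nat_diff fun_eq_iff)
  finally show "indep_vars (\<lambda>_. borel) (\<lambda>k \<omega>. increment L \<Delta> \<omega> k) {1..N}" .
  assume k: "k \<in> {1..N}"
  have "distr M borel (\<lambda>\<omega>. L ((real k - 1) * \<Delta> + \<Delta>) \<omega> - L ((real k - 1) * \<Delta>) \<omega>) = distr M borel (L \<Delta>)"
    using k \<Delta> by (intro stationary_increments) auto
  then show "distr M borel (\<lambda>\<omega>. increment L \<Delta> \<omega> k) = distr M borel (L \<Delta>)"
    unfolding increment_def by (simp add: algebra_simps)
qed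

theorem proposition3p2:
  fixes M :: "'a measure" and L :: "real \<Rightarrow> 'a \<Rightarrow> real"
    and \<nu> h :: "real \<Rightarrow> real" and b \<sigma> a R :: real and \<Delta> :: "nat \<Rightarrow> real"
  defines "h \<equiv> \<lambda>x. x\<^sup>2 * \<nu> x"
  defines "admissible \<equiv> \<lambda>m :: nat \<Rightarrow> real.
      of_order m (\<lambda>n. (real n * \<Delta> n) powr (1 / (2 * a + 1))) \<and>
      (\<forall>\<^sub>F n in sequentially. m n \<le> real n * \<Delta> n)"
  defines "rate \<equiv> \<lambda>n. (real n * \<Delta> n) powr (- (2 * a / (2 * a + 1)))"
  defines "risk_hat \<equiv> \<lambda>(m :: nat \<Rightarrow> real) n.
      L2_risk M (\<lambda>\<omega>. h_hat n (\<Delta> n) (m n) (increment L (\<Delta> n) \<omega>)) h"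
  defines "risk_bar \<equiv> \<lambda>(m :: nat \<Rightarrow> real) n.
      L2_risk M (\<lambda>\<omega>. h_bar n (\<Delta> n) (m n) (increment L (\<Delta> n) \<omega>)) h"
  assumes levy: "levy_process M L"
    and density: "levy_density \<nu>"
    and moment2: "integrable lborel (\<lambda>x. x\<^sup>2 * \<nu> x)"
    and moment4: "integrable lborel (\<lambda>x. x ^ 4 * \<nu> x)"
    and char_fun: "\<And>t u. 0 \<le> t \<Longrightarrow>
      char (distr M borel (L t)) u = exp (of_real t * levy_exponent b \<sigma> \<nu> u)"
    and mean: "b = prob_space.expectation M (L 1)"
    and no_gaussian: "\<sigma>\<^sup>2 = 0"
    and h_L2: "integrable lborel (\<lambda>x. (h x)\<^sup>2)"
    and a: "a > 1 / 2" and R: "R > 0"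
    and h_smooth: "(\<lambda>x. complex_of_real (h x)) \<in> smoothness_class a R"
    and \<Delta>_pos: "\<And>n. \<Delta> n > 0"
    and \<Delta>_tendsto: "\<Delta> \<longlonglongrightarrow> 0"
    and n\<Delta>_tendsto: "filterlim (\<lambda>n. real n * \<Delta> n) at_top sequentially"
  shows "(\<exists>m. admissible m) \<and>
    (\<forall>m. admissible m \<longrightarrow>
      ((\<forall>\<^sub>F n in sequentially. real n * (\<Delta> n)\<^sup>2 \<le> 1) \<longrightarrow>
        risk_bigo (risk_hat m) rate \<and> risk_bigo (risk_bar m) rate) \<and>
      (a \<ge> 1 \<and> (\<forall>\<^sub>F n in sequentially. real n * (\<Delta> n) ^ 3 \<le> 1) \<longrightarrow>
        risk_bigo (risk_hat m) rate \<and> risk_bigo (risk_bar m) rate))"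
proof (intro conjI allI impI)
  define N where "N n = real n * \<Delta> n" for n
  define p where "p = 1 / (2 * a + 1)"
  have p: "0 < p" "p \<le> 1" using a unfolding p_def by (simp_all add: field_simps)
  have N1: "\<forall>\<^sub>F n in sequentially. 1 \<le> N n"
    using n\<Delta>_tendsto unfolding N_def filterlim_at_top by blast
  show "\<exists>m. admissible m"
  proof (intro exI)
    show "admissible (\<lambda>n. N n powr p)"
      unfolding admissible_def of_order_def
    proof (intro conjI exI[of _ 1])
      show "\<forall>\<^sub>F n in sequentially. 1 \<le> N n powr p / (real n * \<Delta> n) powr (1 / (2 * a + 1)) \<and> N n powr p / (real n * \<Delta> n) powr (1 / (2 * a + 1)) \<le> 1"
        using N1 unfolding N_def[symmetric] p_def[symmetric] by eventually_elim simp
      show "\<forall>\<^sub>F n in sequentially. N n powr p \<le> real n * \<Delta> n"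
        using N1
      proof eventually_elim
        case (elim n)
        then have "N n powr p \<le> N n powr 1" using p by (intro powr_mono) auto
        then show ?case using elim by (simp add: N_def)
      qed
    qed auto
  qed
  interpret levy_process M L by (rule levy)
  define h_star where "h_star = fourier (\<lambda>x. complex_of_real (x\<^sup>2 * \<nu> x))"
  have smooth: "(\<integral>\<^sup>+u. ennreal ((1 + u\<^sup>2) powr a * (cmod (h_star u))\<^sup>2) \<partial>lborel) \<le> ennreal R"
    using h_smooth unfolding smoothness_class_def h_def h_star_def by simp
  have "integrable lborel h_star"
  proof (rule integrable_of_weighted_L2[OF a _ smooth])
    have [measurable]: "(\<lambda>x. complex_of_real (x\<^sup>2 * \<nu> x)) \<in> borel_measurable lborel"
      using moment2 by (intro borel_measurable_integrable integrable_of_real)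
    show "h_star \<in> borel_measurable borel" unfolding h_star_def by measurable
  qed
  then interpret X: square_integrable_levy_exponent b \<sigma> \<nu>
    using density moment2 moment4 no_gaussian unfolding h_star_def by unfold_locales auto
  have sample: "iid_smooth_levy_sample b \<sigma> \<nu> (distr M borel (L (\<Delta> n))) (\<Delta> n) M (\<lambda>k \<omega>. increment L (\<Delta> n) \<omega> k) n a R"
    if "0 < n" "\<Delta> n \<le> 1" for n
  proof -
    interpret D: real_distribution "distr M borel (L (\<Delta> n))"
      using measurable_L[of "\<Delta> n"] \<Delta>_pos[of n] by (intro real_distribution_distr) auto
    show ?thesis
      using that \<Delta>_pos[of n] char_fun[of "\<Delta> n"] levy_increments_iid[OF levy \<Delta>_pos[of n]] a R smooth
      by unfold_locales (auto simp: X.h_star_def h_star_def)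
  qed
  fix m assume m: "admissible m"
  then obtain c C where c: "0 < c" "0 < C"
    and order: "\<forall>\<^sub>F n in sequentially. c \<le> m n / N n powr p \<and> m n / N n powr p \<le> C"
    unfolding admissible_def of_order_def N_def p_def by auto
  have m_order: "\<forall>\<^sub>F n in sequentially. c * N n powr p \<le> m n \<and> m n \<le> C * N n powr p"
    using N1 order
  proof eventually_elim
    case (elim n)
    then have "0 < N n powr p" by simp
    then show ?case using elim(2) by (simp add: pos_le_divide_eq pos_divide_le_eq)
  qed
  have \<Delta>1: "\<forall>\<^sub>F n in sequentially. \<Delta> n \<le> 1"
    using order_tendstoD(2)[OF \<Delta>_tendsto, of 1] by (auto elim: eventually_mono)
  have risks: "risk_bigo (risk_hat m) rate \<and> risk_bigo (risk_bar m) rate"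
    if regime: "\<forall>\<^sub>F n in sequentially. N n * \<Delta> n \<le> 1 \<or> 1 \<le> a \<and> N n * (\<Delta> n)\<^sup>2 \<le> 1"
  proof
    let ?e = "\<lambda>n. (1 + (pi * m n)\<^sup>2) powr (max 0 (1 - a))" and ?t = "\<lambda>n. (1 + (pi * m n)\<^sup>2) powr (- a)"
    define B where "B = 1 + (pi * C)\<^sup>2"
    define T where "T = c powr (- (2 * a))"
    have BT: "0 < B" "0 < T" unfolding B_def T_def using c by (auto simp: add_pos_nonneg)
    have key: "\<forall>\<^sub>F n in sequentially. 0 < n \<and> \<Delta> n \<le> 1 \<and> 0 \<le> m n \<and> m n / N n \<le> C * rate n \<and> m n * (\<Delta> n)\<^sup>2 \<le> C * rate n
      \<and> ?t n \<le> T * rate n \<and> (\<Delta> n)\<^sup>2 * ?e n \<le> B * rate n"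
      using N1 m_order \<Delta>1 regime eventually_gt_at_top[of 0]
    proof eventually_elim
      case (elim n)
      note * = rate_comparison[OF a elim(1) \<Delta>_pos[of n] c, folded p_def, OF conjunct1[OF elim(2)] conjunct2[OF elim(2)] elim(4,3)]
      have "0 \<le> c * N n powr p" using c by simp
      then show ?case
        using elim * unfolding rate_def T_def B_def N_def by auto
    qed
    show "risk_bigo (risk_hat m) rate"
      unfolding risk_bigo_def
    proof (intro exI conjI)
      let ?C = "X.variance_const * C + 216 * X.phi1_bound\<^sup>2 * R * B + R * T + 1"
      show "0 < ?C"
        using X.constants_nonneg c BT R by (auto intro!: add_nonneg_pos add_nonneg_nonneg mult_nonneg_nonneg)
      show "\<forall>\<^sub>F n in sequentially. risk_hat m n \<le> ennreal (?C * rate n)"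
        using key
      proof eventually_elim
        case (elim n)
        interpret S: iid_smooth_levy_sample b \<sigma> \<nu> "distr M borel (L (\<Delta> n))" "\<Delta> n" M "\<lambda>k \<omega>. increment L (\<Delta> n) \<omega> k" n a R
          using elim by (intro sample) auto
        have "risk_hat m n \<le> ennreal (m n * (X.variance_const / N n) + 216 * X.phi1_bound\<^sup>2 * (\<Delta> n)\<^sup>2 * R * ?e n + R * ?t n)"
          using S.risk_h_hat_le[of "m n"] elim unfolding risk_hat_def h_def N_def by simp
        also have "m n * (X.variance_const / N n) + 216 * X.phi1_bound\<^sup>2 * (\<Delta> n)\<^sup>2 * R * ?e n + R * ?t n
           = X.variance_const * (m n / N n) + (216 * X.phi1_bound\<^sup>2 * R) * ((\<Delta> n)\<^sup>2 * ?e n) + R * ?t n" by simp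
        also have "\<dots> \<le> X.variance_const * (C * rate n) + (216 * X.phi1_bound\<^sup>2 * R) * (B * rate n) + R * (T * rate n)"
          using elim X.constants_nonneg R by (intro add_mono mult_left_mono) auto
        also have "\<dots> \<le> ?C * rate n" unfolding rate_def by (simp add: algebra_simps)
        finally show ?case by (simp add: ennreal_leI)
      qed
    qed
    show "risk_bigo (risk_bar m) rate"
      unfolding risk_bigo_def
    proof (intro exI conjI)
      let ?C = "3 * X.moment4_const * C + 3 * X.phi1_bound ^ 4 * C + 27 * X.phi1_bound\<^sup>2 * R * B + R * T + 1"
      show "0 < ?C"
        using X.constants_nonneg c BT R by (auto intro!: add_nonneg_pos add_nonneg_nonneg mult_nonneg_nonneg)
      show "\<forall>\<^sub>F n in sequentially. risk_bar m n \<le> ennreal (?C * rate n)"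
        using key
      proof eventually_elim
        case (elim n)
        interpret S: iid_smooth_levy_sample b \<sigma> \<nu> "distr M borel (L (\<Delta> n))" "\<Delta> n" M "\<lambda>k \<omega>. increment L (\<Delta> n) \<omega> k" n a R
          using elim by (intro sample) auto
        have "risk_bar m n \<le> ennreal (m n * (3 * X.moment4_const / N n + 3 * X.phi1_bound ^ 4 * (\<Delta> n)\<^sup>2) + 27 * X.phi1_bound\<^sup>2 * (\<Delta> n)\<^sup>2 * R * ?e n + R * ?t n)"
          using S.risk_h_bar_le[of "m n"] elim unfolding risk_bar_def h_def N_def by simp
        also have "m n * (3 * X.moment4_const / N n + 3 * X.phi1_bound ^ 4 * (\<Delta> n)\<^sup>2) + 27 * X.phi1_bound\<^sup>2 * (\<Delta> n)\<^sup>2 * R * ?e n + R * ?t n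
           = (3 * X.moment4_const) * (m n / N n) + (3 * X.phi1_bound ^ 4) * (m n * (\<Delta> n)\<^sup>2) + (27 * X.phi1_bound\<^sup>2 * R) * ((\<Delta> n)\<^sup>2 * ?e n) + R * ?t n"
          by (simp add: distrib_left)
        also have "\<dots> \<le> (3 * X.moment4_const) * (C * rate n) + (3 * X.phi1_bound ^ 4) * (C * rate n) + (27 * X.phi1_bound\<^sup>2 * R) * (B * rate n) + R * (T * rate n)"
          using elim X.constants_nonneg R by (intro add_mono mult_left_mono) auto
        also have "\<dots> \<le> ?C * rate n" unfolding rate_def by (simp add: algebra_simps)
        finally show ?case by (simp add: ennreal_leI)
      qed
    qed
  qed
  {
    assume "\<forall>\<^sub>F n in sequentially. real n * (\<Delta> n)\<^sup>2 \<le> 1"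
    then have "\<forall>\<^sub>F n in sequentially. N n * \<Delta> n \<le> 1 \<or> 1 \<le> a \<and> N n * (\<Delta> n)\<^sup>2 \<le> 1"
      by eventually_elim (simp add: N_def power2_eq_square mult.assoc)
    from risks[OF this] show "risk_bigo (risk_hat m) rate" "risk_bigo (risk_bar m) rate" by auto
  next
    assume "a \<ge> 1 \<and> (\<forall>\<^sub>F n in sequentially. real n * (\<Delta> n) ^ 3 \<le> 1)"
    then have "1 \<le> a" and "\<forall>\<^sub>F n in sequentially. real n * (\<Delta> n) ^ 3 \<le> 1" by auto
    from this(2) have "\<forall>\<^sub>F n in sequentially. N n * \<Delta> n \<le> 1 \<or> 1 \<le> a \<and> N n * (\<Delta> n)\<^sup>2 \<le> 1"
      by eventually_elim (use \<open>1 \<le> a\<close> in \<open>simp add: N_def power3_eq_cube power2_eq_square mult.assoc\<close>)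
    from risks[OF this] show "risk_bigo (risk_hat m) rate" "risk_bigo (risk_bar m) rate" by auto
  }
qed

end
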